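(* Let $N>1$, $K\in\mathbb R$ and let $\{M_i\}_{i\in\mathbb N}$, $\{T_i\}_{i\in\mathbb N}$, $\{\varepsilon_i\}_{i\in\mathbb N}$ be positive sequences with $\lim_{i\to\infty}\varepsilon_i=0$. Let $\mathcal X$ be the class of covered Lorentzian pre-length spaces $(X,\mathcal U)$ satisfying the following conditions: (i) $X$ is a generalized cone, i.e. $X={}^{-}J\times_fY$. (ii) $(Y,d,\mathfrak m)$ is an essentially non-branching metric measure space satisfying the $\mathrm{MCP}(K,N)$-condition. (iii) $\mathcal U=\{U_i\}_{i\in\mathbb N}=\{(a_i,b_i)\times B_i(y_0)\}_{i\in\mathbb N}$ for some $y_0\in Y$ and $(a_i,b_i)\subset J$ with $|a_i-b_i|<T_i$, $(a_i,b_i)\subset(a_j,b_j)$ if $i\le j$, and $(a_i-\varepsilon_i,b_i+\varepsilon_i)\subset J$ for all $i\in\mathbb N$. (iv) $f\le M_i$ on $(a_i-\varepsilon_i,b_i+\varepsilon_i)$. Then $\mathcal X$ is precompact with respect to Lorentzian Gromov–Hausdorff convergence.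
   Context: **Lorentzian pre-length spaces.** A Lorentzian pre-length space $(X,d,\ll,\le,\tau)$ is a set $X$ with a metric $d$, transitive relations $\ll\,\subset\,\le$ with $\le$ reflexive, and a map $\tau:X\times X\to[0,\infty]$ that is lower semicontinuous for $d$, satisfies $\tau(p,r)\ge\tau(p,q)+\tau(q,r)$ for $p\le q\le r$, and $\tau(p,q)>0\iff p\ll q$. Causal diamonds: $J(p,q)=\{x:p\le x\le q\}$. **Generalized cones.** Let $(Y,d_Y)$ be a length space, $J\subset\mathbb R$ an open interval, $f:J\to(0,\infty)$ continuous. On $J\times Y$ put $D((t,y),(t',y'))=|t-t'|+d_Y(y,y')$. An absolutely continuous curve $\gamma=(\alpha,\beta)$ with $\alpha$ strictly monotone is timelike/null/causal if $-\dot\alpha^2+(f\circ\alpha)^2v_\beta^2$ is $<0$/$=0$/$\le0$ a.e., $v_\beta$ being the metric derivative of $\beta$; it is future directed if $\alpha$ is increasing. $x\ll x'$ (resp. $x\le x'$) iff there is a future-directed timelike (resp. causal) curve from $x$ to $x'$, and $x\le x$ always. $L(\gamma)=\int\sqrt{\dot\alpha^2-(f\circ\alpha)^2v_\beta^2}$ and $\tau(x,y)=\sup L(\gamma)$ over future-directed causal curves from $x$ to $y$ (0 if none). The Lorentzian pre-length space $(J\times Y,D,\ll,\le,\tau)$ is ${}^{-}J\times_fY$. **Covered spaces and Lorentzian Gromov–Hausdorff (LGH) convergence (Mondino–Sämann).** A covered Lorentzian pre-length space $(X,\mathcal U)$ is a Lorentzian pre-length space $X$ with a countable cover $\mathcal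 U=\{U_k\}_{k\in\mathbb N}$, $U_k\subset U_{k+1}$. For $A\subset X$, $\varepsilon>0$, an $\varepsilon$-net for $A$ is a collection of causal diamonds $\{J(p_i,q_i)\}_{i\in\Omega}$ with $\tau(p_i,q_i)\le\varepsilon$, $A\cap J(p_i,q_i)\neq\emptyset$ and $A\subset\bigcup_iJ(p_i,q_i)$; its vertex set is $V(S)=\{p_i,q_i:i\in\Omega\}$. A correspondence between sets $V,W$ is $R\subset V\times W$ with both projections surjective; for subsets of Lorentzian pre-length spaces its distortion is $\operatorname{dis}R=\sup\{|\tau_V(v,v')-\tau_W(w,w')|:(v,w),(v',w')\in R\}$. $(X_n,\mathcal U_n)$ converges to $(X,\mathcal U)$ if for all $k,l\in\mathbb N$ there are finite $1/l$-nets $S^{k,l}_n$ of $U_{n,k}$ in $X_n$ (for all large $n$) and $S^{k,l}$ of $U_k$ in $X$, with vertex sets increasing in $l$, and correspondences $R^{k,l}_n$ between $V(S^{k,l}_n)$ and $V(S^{k,l})$, increasing in $l$ and matching the diamonds of the nets, with $\operatorname{dis}R^{k,l}_n\to0$ as $n\to\infty$, and such that $\bigcup_lV(S^{k,l})$ is forward dense in $U_k$, i.e. each $x\in U_k$ is the limit of a sequence $v_1\le v_2\le\dots\le x$ of such vertices. A class is precompact if every sequence in it has a subsequence converging to some covered Lorentzian pre-length space (not necessarily in the class). **Metric measure conditions.** $B_r(y_0)$ is the open ball of radius $r$. $(Y,d,\mathfrak m)$ is essentially non-branching if for any two boundedly supported, absolutely continuous $\mu_0,\mu_1$ with finite second moments,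 every $W_2$-optimal dynamical plan between them is concentrated on a non-branching set of geodesics. $\mathrm{MCP}(K,N)$ (Ohta, Sturm): for every $y\in\operatorname{supp}\mathfrak m$ and bounded Borel $A$ with $0<\mathfrak m(A)<\infty$ (and $A\subset B_{\pi\sqrt{(N-1)/K}}(y)$ if $K>0$) there is a $W_2$-optimal dynamical plan $\pi$ on constant-speed geodesics $\gamma:[0,1]\to Y$ with $(e_0)_\#\pi=\delta_y$, $(e_1)_\#\pi=\mathfrak m(A)^{-1}\mathfrak m|_A$ and $\mathfrak m\ge(e_t)_\#\big(\tau^{(t)}_{K,N}(d(\gamma_0,\gamma_1))^N\,\mathfrak m(A)\,d\pi\big)$ for all $t\in[0,1]$, where $\tau^{(t)}_{K,N}(\theta)=t^{1/N}\sigma^{(t)}_{K/(N-1)}(\theta)^{1-1/N}$ and $\sigma^{(t)}_\kappa(\theta)=\sin(t\sqrt\kappa\theta)/\sin(\sqrt\kappa\theta)$ for $\kappa>0$, $t$ for $\kappa=0$, $\sinh(t\sqrt{-\kappa}\theta)/\sinh(\sqrt{-\kappa}\theta)$ for $\kappa<0$.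
   Formalization: "Metric measure space" is read as complete and separable with a locally finite Borel measure whose support is all of Y; without full support the claim fails (a Dirac measure on infinite-dimensional Hilbert space satisfies MCP(K,N) and is essentially non-branching). *)

theory Defs
  imports "HOL-Probability.Probability"
begin

section \<open>Lorentzian pre-length spaces\<close>

text \<open>All spaces are carried by sets (the \<^const>\<open>mspace\<close> of a metric), so that a sequence of
  different spaces can live over one ambient type.  The relations and the time separation are only
  meaningful on the carrier.\<close>

record 'a lspace =
  lmetric :: "'a metric"
  chron :: "'a \<Rightarrow> 'a \<Rightarrow> bool"
  caus :: "'a \<Rightarrow> 'a \<Rightarrow> bool"
  tsep :: "'a \<Rightarrow> 'a \<Rightarrow> ennreal"

abbreviation lcarrier :: "'a lspace \<Rightarrow> 'a set" where
  "lcarrier X \<equiv> mspace (lmetric X)"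

definition lorentzian_pre_length_space :: "'a lspace \<Rightarrow> bool" where
  "lorentzian_pre_length_space X \<longleftrightarrow>
     (\<forall>p\<in>lcarrier X. \<forall>q\<in>lcarrier X. chron X p q \<longrightarrow> caus X p q) \<and>
     (\<forall>p\<in>lcarrier X. caus X p p) \<and>
     (\<forall>p\<in>lcarrier X. \<forall>q\<in>lcarrier X. \<forall>r\<in>lcarrier X. caus X p q \<and> caus X q r \<longrightarrow> caus X p r) \<and>
     (\<forall>p\<in>lcarrier X. \<forall>q\<in>lcarrier X. \<forall>r\<in>lcarrier X. chron X p q \<and> chron X q r \<longrightarrow> chron X p r) \<and>
     (\<forall>c. openin (prod_topology (mtopology_of (lmetric X)) (mtopology_of (lmetric X)))
            {(p, q) \<in> lcarrier X \<times> lcarrier X. c < tsep X p q}) \<and>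
     (\<forall>p\<in>lcarrier X. \<forall>q\<in>lcarrier X. \<forall>r\<in>lcarrier X.
        caus X p q \<and> caus X q r \<longrightarrow> tsep X p q + tsep X q r \<le> tsep X p r) \<and>
     (\<forall>p\<in>lcarrier X. \<forall>q\<in>lcarrier X. 0 < tsep X p q \<longleftrightarrow> chron X p q)"

definition causal_diamond :: "'a lspace \<Rightarrow> 'a \<Rightarrow> 'a \<Rightarrow> 'a set" where
  "causal_diamond X p q = {x \<in> lcarrier X. caus X p x \<and> caus X x q}"

type_synonym 'a covered = "'a lspace \<times> (nat \<Rightarrow> 'a set)"

definition covered_lpls :: "'a covered \<Rightarrow> bool" where
  "covered_lpls = (\<lambda>(X, U). lorentzian_pre_length_space X \<and>
     (\<forall>k. U k \<subseteq> U (Suc k)) \<and> (\<Union>k. U k) = lcarrier X)"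


section \<open>Lorentzian Gromov--Hausdorff convergence\<close>

text \<open>A finite net is a finite indexed family of diamonds, given as the list of the pairs
  \<open>(p, q)\<close> of their vertices; repetitions are allowed.\<close>

definition finite_net :: "'a lspace \<Rightarrow> 'a set \<Rightarrow> real \<Rightarrow> ('a \<times> 'a) list \<Rightarrow> bool" where
  "finite_net X A e S \<longleftrightarrow>
     (\<forall>(p, q) \<in> set S. p \<in> lcarrier X \<and> q \<in> lcarrier X \<and> tsep X p q \<le> ennreal e \<and>
        A \<inter> causal_diamond X p q \<noteq> {}) \<and>
     A \<subseteq> (\<Union>(p, q) \<in> set S. causal_diamond X p q)"

definition net_vertices :: "('a \<times> 'a) list \<Rightarrow> 'a set" where
  "net_vertices S = fst ` set S \<union> snd ` set S"

definition correspondence :: "'a set \<Rightarrow> 'b set \<Rightarrow> ('a \<times> 'b) set \<Rightarrow> bool" where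
  "correspondence V W R \<longleftrightarrow> R \<subseteq> V \<times> W \<and> fst ` R = V \<and> snd ` R = W"

text \<open>The absolute difference on \<open>[0, \<infinity>]\<close>, with \<open>\<bar>\<infinity> - \<infinity>\<bar> = 0\<close>
  (subtraction on \<^typ>\<open>ennreal\<close> is truncated and has \<open>\<infinity> - \<infinity> = \<infinity>\<close>).\<close>

definition ennreal_absdiff :: "ennreal \<Rightarrow> ennreal \<Rightarrow> ennreal" where
  "ennreal_absdiff x y = (if x = y then 0 else max (x - y) (y - x))"

definition distortion :: "'a lspace \<Rightarrow> 'b lspace \<Rightarrow> ('a \<times> 'b) set \<Rightarrow> ennreal" where
  "distortion X Y R = (SUP ((v, w), (v', w')) \<in> R \<times> R. ennreal_absdiff (tsep X v v') (tsep Y w w'))"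

text \<open>Corresponding nets are indexed by the same finite set, and the correspondence relates the
  vertices of equally indexed diamonds.\<close>

definition matching_nets :: "('a \<times> 'b) set \<Rightarrow> ('a \<times> 'a) list \<Rightarrow> ('b \<times> 'b) list \<Rightarrow> bool" where
  "matching_nets R = list_all2 (\<lambda>(p, q) (p', q'). (p, p') \<in> R \<and> (q, q') \<in> R)"

definition forward_dense :: "'a lspace \<Rightarrow> 'a set \<Rightarrow> 'a set \<Rightarrow> bool" where
  "forward_dense X V A \<longleftrightarrow>
     (\<forall>x\<in>A. \<exists>v :: nat \<Rightarrow> 'a. (\<forall>i. v i \<in> V \<and> caus X (v i) (v (Suc i)) \<and> caus X (v i) x) \<and>
        limitin (mtopology_of (lmetric X)) v x sequentially)"

definition lgh_converges :: "(nat \<Rightarrow> 'a covered) \<Rightarrow> 'b covered \<Rightarrow> bool" where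
  "lgh_converges XU = (\<lambda>(X, U). \<exists>(Sn :: nat \<Rightarrow> nat \<Rightarrow> nat \<Rightarrow> ('a \<times> 'a) list)
       (S :: nat \<Rightarrow> nat \<Rightarrow> ('b \<times> 'b) list) (R :: nat \<Rightarrow> nat \<Rightarrow> nat \<Rightarrow> ('a \<times> 'b) set).
     (\<forall>k. \<forall>l\<ge>1.
        finite_net X (U k) (1 / real l) (S k l) \<and>
        net_vertices (S k l) \<subseteq> net_vertices (S k (Suc l)) \<and>
        (\<forall>\<^sub>F n in sequentially.
           finite_net (fst (XU n)) (snd (XU n) k) (1 / real l) (Sn n k l) \<and>
           net_vertices (Sn n k l) \<subseteq> net_vertices (Sn n k (Suc l)) \<and>
           correspondence (net_vertices (Sn n k l)) (net_vertices (S k l)) (R n k l) \<and>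
           R n k l \<subseteq> R n k (Suc l) \<and>
           matching_nets (R n k l) (Sn n k l) (S k l)) \<and>
        (\<lambda>n. distortion (fst (XU n)) X (R n k l)) \<longlonglongrightarrow> 0) \<and>
     (\<forall>k. forward_dense X (\<Union>l\<in>{1..}. net_vertices (S k l)) (U k)))"

text \<open>Every limit space \<open>X\<close> has at most the cardinality of the continuum: each of its points is a
  metric limit of a sequence in the countable set of all net vertices.  Hence it is no restriction
  to let the carrier of the limit be a set of real numbers (with an arbitrary metric on it).\<close>

definition lgh_precompact :: "'a covered set \<Rightarrow> bool" where
  "lgh_precompact C \<longleftrightarrow>
     (\<forall>XU :: nat \<Rightarrow> 'a covered. (\<forall>n. XU n \<in> C) \<longrightarrow>
        (\<exists>(r :: nat \<Rightarrow> nat) (Z :: real covered).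
           strict_mono r \<and> covered_lpls Z \<and> lgh_converges (XU \<circ> r) Z))"


section \<open>Generalized cones\<close>

definition curve_length :: "'y metric \<Rightarrow> (real \<Rightarrow> 'y) \<Rightarrow> ennreal" where
  "curve_length Y c =
     Sup {\<Sum>i<length ts - 1. ennreal (mdist Y (c (ts ! i)) (c (ts ! Suc i))) | ts.
            sorted ts \<and> set ts \<subseteq> {0..1}}"

definition length_space :: "'y metric \<Rightarrow> bool" where
  "length_space Y \<longleftrightarrow> (\<forall>x\<in>mspace Y. \<forall>y\<in>mspace Y. ennreal (mdist Y x y) =
     Inf {curve_length Y c | c. pathin (mtopology_of Y) c \<and> c 0 = x \<and> c 1 = y})"

definition ac_curve :: "'x metric \<Rightarrow> real \<Rightarrow> real \<Rightarrow> (real \<Rightarrow> 'x) \<Rightarrow> bool" where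
  "ac_curve X a b c \<longleftrightarrow> c \<in> {a..b} \<rightarrow> mspace X \<and>
     (\<exists>g. set_integrable lborel {a..b} g \<and>
        (\<forall>s t. a \<le> s \<and> s \<le> t \<and> t \<le> b \<longrightarrow> mdist X (c s) (c t) \<le> (LINT u:{s..t}|lborel. g u)))"

text \<open>For absolutely continuous curves the limit exists at almost every parameter.\<close>

definition metric_deriv :: "'x metric \<Rightarrow> (real \<Rightarrow> 'x) \<Rightarrow> real \<Rightarrow> real" where
  "metric_deriv X c t = Lim (at t) (\<lambda>s. mdist X (c s) (c t) / \<bar>s - t\<bar>)"

definition cone_metric :: "real set \<Rightarrow> 'y metric \<Rightarrow> (real \<times> 'y) metric" where
  "cone_metric J Y =
     metric (J \<times> mspace Y, \<lambda>(t, y) (t', y'). \<bar>t - t'\<bar> + mdist Y y y')"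

lemma Metric_space_cone:
  "Metric_space (J \<times> mspace Y) (\<lambda>(t, y) (t', y'). \<bar>t - t'\<bar> + mdist Y y y')"
proof unfold_locales
  interpret Metric_space "mspace Y" "mdist Y" by simp
  fix x y z :: "real \<times> 'a"
  show "0 \<le> (case x of (t, y) \<Rightarrow> \<lambda>(t', y'). \<bar>t - t'\<bar> + mdist Y y y') y"
    by (simp split: prod.split)
  show "(case x of (t, y) \<Rightarrow> \<lambda>(t', y'). \<bar>t - t'\<bar> + mdist Y y y') y =
        (case y of (t, y) \<Rightarrow> \<lambda>(t', y'). \<bar>t - t'\<bar> + mdist Y y y') x"
    by (simp add: commute abs_minus_commute split: prod.split)
  assume x: "x \<in> J \<times> mspace Y" and y: "y \<in> J \<times> mspace Y"
  have "\<bar>fst x - fst y\<bar> + mdist Y (snd x) (snd y) = 0 \<longleftrightarrow>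
        \<bar>fst x - fst y\<bar> = 0 \<and> mdist Y (snd x) (snd y) = 0"
    by (rule add_nonneg_eq_0_iff) simp_all
  then show "(case x of (t, y) \<Rightarrow> \<lambda>(t', y'). \<bar>t - t'\<bar> + mdist Y y y') y = 0 \<longleftrightarrow> x = y"
    using x y by (auto simp: case_prod_beta prod_eq_iff)
  assume z: "z \<in> J \<times> mspace Y"
  have "mdist Y (snd x) (snd z) \<le> mdist Y (snd x) (snd y) + mdist Y (snd y) (snd z)"
    using x y z by (intro triangle) auto
  then show "(case x of (t, y) \<Rightarrow> \<lambda>(t', y'). \<bar>t - t'\<bar> + mdist Y y y') z \<le>
        (case x of (t, y) \<Rightarrow> \<lambda>(t', y'). \<bar>t - t'\<bar> + mdist Y y y') y +
        (case y of (t, y) \<Rightarrow> \<lambda>(t', y'). \<bar>t - t'\<bar> + mdist Y y y') z"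
    by (simp add: case_prod_beta)
qed

definition cone_norm_sq ::
  "(real \<Rightarrow> real) \<Rightarrow> 'y metric \<Rightarrow> (real \<Rightarrow> real) \<Rightarrow> (real \<Rightarrow> 'y) \<Rightarrow> real \<Rightarrow> real" where
  "cone_norm_sq f Y \<alpha> \<beta> t = - (deriv \<alpha> t)\<^sup>2 + (f (\<alpha> t))\<^sup>2 * (metric_deriv Y \<beta> t)\<^sup>2"

text \<open>Future-directed curves \<open>(\<alpha>, \<beta>) : [a, b] \<rightarrow> J \<times> Y\<close> from \<open>x\<close> to \<open>x'\<close>; the almost everywhere
  conditions are imposed on the open interval since only there are \<^const>\<open>deriv\<close> and
  \<^const>\<open>metric_deriv\<close> independent of values outside \<open>[a, b]\<close>.\<close>

definition fd_curve :: "real set \<Rightarrow> 'y metric \<Rightarrow> real \<times> 'y \<Rightarrow> real \<times> 'y \<Rightarrow> real \<Rightarrow> real \<Rightarrow>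
    (real \<Rightarrow> real) \<Rightarrow> (real \<Rightarrow> 'y) \<Rightarrow> bool" where
  "fd_curve J Y x x' a b \<alpha> \<beta> \<longleftrightarrow> a < b \<and> ac_curve (cone_metric J Y) a b (\<lambda>t. (\<alpha> t, \<beta> t)) \<and>
     strict_mono_on {a..b} \<alpha> \<and> (\<alpha> a, \<beta> a) = x \<and> (\<alpha> b, \<beta> b) = x'"

definition fd_timelike :: "real set \<Rightarrow> (real \<Rightarrow> real) \<Rightarrow> 'y metric \<Rightarrow> real \<times> 'y \<Rightarrow> real \<times> 'y \<Rightarrow>
    real \<Rightarrow> real \<Rightarrow> (real \<Rightarrow> real) \<Rightarrow> (real \<Rightarrow> 'y) \<Rightarrow> bool" where
  "fd_timelike J f Y x x' a b \<alpha> \<beta> \<longleftrightarrow> fd_curve J Y x x' a b \<alpha> \<beta> \<and>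
     (AE t in lborel. t \<in> {a<..<b} \<longrightarrow> cone_norm_sq f Y \<alpha> \<beta> t < 0)"

definition fd_causal :: "real set \<Rightarrow> (real \<Rightarrow> real) \<Rightarrow> 'y metric \<Rightarrow> real \<times> 'y \<Rightarrow> real \<times> 'y \<Rightarrow>
    real \<Rightarrow> real \<Rightarrow> (real \<Rightarrow> real) \<Rightarrow> (real \<Rightarrow> 'y) \<Rightarrow> bool" where
  "fd_causal J f Y x x' a b \<alpha> \<beta> \<longleftrightarrow> fd_curve J Y x x' a b \<alpha> \<beta> \<and>
     (AE t in lborel. t \<in> {a<..<b} \<longrightarrow> cone_norm_sq f Y \<alpha> \<beta> t \<le> 0)"

definition cone_length ::
  "(real \<Rightarrow> real) \<Rightarrow> 'y metric \<Rightarrow> real \<Rightarrow> real \<Rightarrow> (real \<Rightarrow> real) \<Rightarrow> (real \<Rightarrow> 'y) \<Rightarrow> ennreal" where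
  "cone_length f Y a b \<alpha> \<beta> =
     (\<integral>\<^sup>+ t. ennreal (sqrt (- cone_norm_sq f Y \<alpha> \<beta> t)) \<partial>(lebesgue_on {a<..<b}))"

definition cone :: "real set \<Rightarrow> (real \<Rightarrow> real) \<Rightarrow> 'y metric \<Rightarrow> (real \<times> 'y) lspace" where
  "cone J f Y = \<lparr>
     lmetric = cone_metric J Y,
     chron = (\<lambda>x x'. \<exists>a b \<alpha> \<beta>. fd_timelike J f Y x x' a b \<alpha> \<beta>),
     caus = (\<lambda>x x'. x = x' \<or> (\<exists>a b \<alpha> \<beta>. fd_causal J f Y x x' a b \<alpha> \<beta>)),
     tsep = (\<lambda>x x'. Sup {cone_length f Y a b \<alpha> \<beta> | a b \<alpha> \<beta>. fd_causal J f Y x x' a b \<alpha> \<beta>})\<rparr>"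

definition is_generalized_cone ::
  "(real \<times> 'y) lspace \<Rightarrow> real set \<Rightarrow> (real \<Rightarrow> real) \<Rightarrow> 'y metric \<Rightarrow> bool" where
  "is_generalized_cone X J f Y \<longleftrightarrow> open J \<and> is_interval J \<and> J \<noteq> {} \<and>
     continuous_on J f \<and> (\<forall>t\<in>J. 0 < f t) \<and> length_space Y \<and> X = cone J f Y"


section \<open>Metric measure spaces and the measure contraction property\<close>

definition borel_of :: "'x metric \<Rightarrow> 'x measure" where
  "borel_of X = sigma (mspace X) {U. openin (mtopology_of X) U}"

definition msupport :: "'x metric \<Rightarrow> 'x measure \<Rightarrow> 'x set" where
  "msupport X \<mu> = {x \<in> mspace X. \<forall>r>0. 0 < emeasure \<mu> (mball_of X x r)}"

text \<open>A complete separable metric space with a locally finite Borel measure of full support.  Without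
  full support the \<open>MCP\<close> condition would say nothing about the space off the support.\<close>

definition metric_measure_space :: "'y metric \<Rightarrow> 'y measure \<Rightarrow> bool" where
  "metric_measure_space Y m \<longleftrightarrow>
     mcomplete_of Y \<and> separable_space (mtopology_of Y) \<and>
     sets m = sets (borel_of Y) \<and>
     (\<forall>y\<in>mspace Y. \<exists>r>0. emeasure m (mball_of Y y r) < \<infinity>) \<and>
     msupport Y m = mspace Y"

text \<open>Constant-speed geodesics \<open>[0, 1] \<rightarrow> Y\<close>, with the uniform distance.  As elements of
  \<^const>\<open>cfunspace\<close> they are \<^const>\<open>undefined\<close> outside \<open>[0, 1]\<close>.\<close>

definition geo :: "'y metric \<Rightarrow> (real \<Rightarrow> 'y) metric" where
  "geo Y = submetric (cfunspace (top_of_set {0..1}) Y)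
     {\<gamma>. \<forall>s\<in>{0..1}. \<forall>t\<in>{0..1}. mdist Y (\<gamma> s) (\<gamma> t) = \<bar>s - t\<bar> * mdist Y (\<gamma> 0) (\<gamma> 1)}"

definition prob_on :: "'x metric \<Rightarrow> 'x measure \<Rightarrow> bool" where
  "prob_on X \<mu> \<longleftrightarrow> prob_space \<mu> \<and> sets \<mu> = sets (borel_of X)"

definition W2_sq :: "'y metric \<Rightarrow> 'y measure \<Rightarrow> 'y measure \<Rightarrow> ennreal" where
  "W2_sq Y \<mu>\<^sub>0 \<mu>\<^sub>1 = Inf {\<integral>\<^sup>+ (x, y). ennreal ((mdist Y x y)\<^sup>2) \<partial>q | q.
     prob_space q \<and> sets q = sets (borel_of Y \<Otimes>\<^sub>M borel_of Y) \<and>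
     distr q (borel_of Y) fst = \<mu>\<^sub>0 \<and> distr q (borel_of Y) snd = \<mu>\<^sub>1}"

definition optimal_dynamical_plan ::
  "'y metric \<Rightarrow> 'y measure \<Rightarrow> 'y measure \<Rightarrow> (real \<Rightarrow> 'y) measure \<Rightarrow> bool" where
  "optimal_dynamical_plan Y \<mu>\<^sub>0 \<mu>\<^sub>1 \<pi> \<longleftrightarrow> prob_on (geo Y) \<pi> \<and>
     distr \<pi> (borel_of Y) (\<lambda>\<gamma>. \<gamma> 0) = \<mu>\<^sub>0 \<and> distr \<pi> (borel_of Y) (\<lambda>\<gamma>. \<gamma> 1) = \<mu>\<^sub>1 \<and>
     (\<integral>\<^sup>+ \<gamma>. ennreal ((mdist Y (\<gamma> 0) (\<gamma> 1))\<^sup>2) \<partial>\<pi>) = W2_sq Y \<mu>\<^sub>0 \<mu>\<^sub>1"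

definition non_branching :: "(real \<Rightarrow> 'y) set \<Rightarrow> bool" where
  "non_branching \<Gamma> \<longleftrightarrow> (\<forall>\<gamma>\<in>\<Gamma>. \<forall>\<eta>\<in>\<Gamma>. (\<exists>t. 0 < t \<and> t < 1 \<and> (\<forall>s\<in>{0..t}. \<gamma> s = \<eta> s)) \<longrightarrow> \<gamma> = \<eta>)"

definition admissible_marginal :: "'y metric \<Rightarrow> 'y measure \<Rightarrow> 'y measure \<Rightarrow> bool" where
  "admissible_marginal Y m \<mu> \<longleftrightarrow> prob_on Y \<mu> \<and>
     Metric_space.mbounded (mspace Y) (mdist Y) (msupport Y \<mu>) \<and> absolutely_continuous m \<mu> \<and>
     (\<exists>y\<in>mspace Y. (\<integral>\<^sup>+ x. ennreal ((mdist Y y x)\<^sup>2) \<partial>\<mu>) < \<infinity>)"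

definition essentially_non_branching :: "'y metric \<Rightarrow> 'y measure \<Rightarrow> bool" where
  "essentially_non_branching Y m \<longleftrightarrow>
     (\<forall>\<mu>\<^sub>0 \<mu>\<^sub>1 \<pi>. admissible_marginal Y m \<mu>\<^sub>0 \<and> admissible_marginal Y m \<mu>\<^sub>1 \<and>
        optimal_dynamical_plan Y \<mu>\<^sub>0 \<mu>\<^sub>1 \<pi> \<longrightarrow>
        (\<exists>\<Gamma>\<subseteq>mspace (geo Y). non_branching \<Gamma> \<and> (AE \<gamma> in \<pi>. \<gamma> \<in> \<Gamma>)))"

text \<open>At \<open>\<theta> = 0\<close> the value is the limit \<open>t\<close> of the quotients.  For \<open>\<kappa> > 0\<close> the formula is only
  used for \<open>sqrt \<kappa> * \<theta> < pi\<close>, which is what the radius restriction in \<open>MCP\<close> below ensures.\<close>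

definition sigma_coeff :: "real \<Rightarrow> real \<Rightarrow> real \<Rightarrow> real" where
  "sigma_coeff \<kappa> t \<theta> =
     (if \<theta> = 0 \<or> \<kappa> = 0 then t
      else if \<kappa> > 0 then sin (t * sqrt \<kappa> * \<theta>) / sin (sqrt \<kappa> * \<theta>)
      else sinh (t * sqrt (- \<kappa>) * \<theta>) / sinh (sqrt (- \<kappa>) * \<theta>))"

definition tau_coeff :: "real \<Rightarrow> real \<Rightarrow> real \<Rightarrow> real \<Rightarrow> real" where
  "tau_coeff K N t \<theta> = t powr (1 / N) * sigma_coeff (K / (N - 1)) t \<theta> powr (1 - 1 / N)"

definition MCP :: "real \<Rightarrow> real \<Rightarrow> 'y metric \<Rightarrow> 'y measure \<Rightarrow> bool" where
  "MCP K N Y m \<longleftrightarrow>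
     (\<forall>y \<in> msupport Y m. \<forall>A \<in> sets m.
        Metric_space.mbounded (mspace Y) (mdist Y) A \<and> 0 < emeasure m A \<and> emeasure m A < \<infinity> \<and>
        (K > 0 \<longrightarrow> A \<subseteq> mball_of Y y (pi * sqrt ((N - 1) / K))) \<longrightarrow>
        (\<exists>\<pi>. optimal_dynamical_plan Y (return (borel_of Y) y) (uniform_measure m A) \<pi> \<and>
           (\<forall>t\<in>{0..1}. \<forall>B\<in>sets m.
              emeasure (distr
                (density \<pi> (\<lambda>\<gamma>. ennreal (tau_coeff K N t (mdist Y (\<gamma> 0) (\<gamma> 1)) powr N) * emeasure m A))
                (borel_of Y) (\<lambda>\<gamma>. \<gamma> t)) B \<le> emeasure m B)))"

end

theory Submission
  imports Defs
begin

text \<open>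
  With the conformal time \<open>H\<close>, a primitive of \<open>1 / f\<close>, one has \<open>(s, y) \<le> (t, z)\<close> as soon as
  \<open>d(y, z) < H t - H s\<close>, and the time separation is at most \<open>t - s\<close> and vanishes on null pairs,
  where \<open>d(y, z) = H t - H s\<close>.  So the set \<open>U\<^sub>k\<close> is covered by diamonds over the points of a
  net of the ball and of a grid of times.  By \<open>f \<le> M\<^sub>k\<close> a fixed mesh suffices, and the measure
  contraction property bounds the cardinality of nets of balls in terms of \<open>K\<close> and \<open>N\<close>.

  The vertex sets have to increase, although the lowest and highest vertices lie outside
  \<open>U\<^sub>k\<close>: such a vertex stays in all finer nets by means of a diamond spanned with a null related
  point of \<open>U\<^sub>k\<close>.  This is the reason for measuring the excess of the nets over \<open>U\<^sub>k\<close> in conformal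
  time, and for keeping it smaller than the diameter of the ball.

  With uniformly bounded cardinalities, a diagonal subsequence makes all time separations between
  vertices converge and all causal relations between them eventually constant.  The eventual
  vertices, with the limiting time separation and the discrete metric, form the limit space.
\<close>

text \<open>The length of a causal curve is an integral of pointwise derivatives. Upper bounds for
  the time separation thus need \<open>deriv\<close> and \<open>metric_deriv\<close> to exist almost
  everywhere and increments to be integrals of derivatives. Vitali coverings and the Radon-Nikodym
  theorem give both.

  Measure contraction joins a point by geodesics only to almost every point of a small ball. Causal
  relations are therefore built from strict inequalities, and end points are moved to nearby points
  that a geodesic reaches.

  The delicate point is uniformity. The excess has to be small compared with the diameter of the
  ball in the base, which has no positive lower bound in the class, whereas the number of diamonds
  must not depend on the space. At small scales the packing estimate involves only the ratio of the
  two radii, so a smaller ball with a proportionally smaller excess needs no more centres. A ball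
  with a single point has no null related partners and is treated separately.

  The tower of nets in the n-th space has depth n only. This suffices, as convergence constrains
  each level for large n only.\<close>

section \<open>Differentiation of integrals and absolutely continuous functions\<close>

text \<open>The measure with density \<open>u\<close> vanishes on the zero set of \<open>u\<close>,
  which therefore lies in an open set of small mass. The points where averages above
  \<open>c\<close> recur are covered, up to a null set, by disjoint balls in this open set whose
  Lebesgue measure is controlled by their mass.\<close>

lemma vanishing_density_small_averages:
  fixes u :: "real \<Rightarrow> real"
  assumes u: "integrable lborel u" and pos: "\<And>x. 0 \<le> u x"
  shows "AE x in lborel. u x = 0 \<longrightarrow> (\<forall>c>0. \<exists>\<delta>>0. \<forall>s t. s \<le> x \<and> x \<le> t \<and> s < t \<and> t - s < \<delta> \<longrightarrow>
           (LINT y:{s..t}|lborel. u y) \<le> c * (t - s))"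
proof -
  define \<nu> where "\<nu> = density lborel (\<lambda>x. ennreal (u x))"
  define E where "E = {x. u x = 0}"
  define bad where "bad c = {x \<in> E. \<forall>\<delta>>0. \<exists>s t. s \<le> x \<and> x \<le> t \<and> s < t \<and> t - s < \<delta> \<and>
      c * (t - s) < (LINT y:{s..t}|lborel. u y)}" for c
  have [measurable]: "u \<in> borel_measurable borel" using u by auto
  have E_meas: "E \<in> sets borel" unfolding E_def by measurable
  have sets_nu: "sets \<nu> = sets borel" by (simp add: \<nu>_def)
  have nu_ge: "ennreal (LINT y:{s..t}|lborel. u y) \<le> emeasure \<nu> A"
    if "{s..t} \<subseteq> A" "A \<in> sets borel" for s t A
  proof -
    have "ennreal (LINT y:{s..t}|lborel. u y) = (\<integral>\<^sup>+ y. ennreal (indicator {s..t} y * u y) \<partial>lborel)"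
      unfolding set_lebesgue_integral_def real_scaleR_def
      using pos by (intro nn_integral_eq_integral[symmetric] integrable_mult_indicator[OF _ u, unfolded real_scaleR_def])
         (auto intro: integrable_mult_indicator[where ?f=u, unfolded real_scaleR_def])
    also have "\<dots> \<le> (\<integral>\<^sup>+ y. ennreal (u y) * indicator A y \<partial>lborel)"
      using that by (intro nn_integral_mono) (auto simp: indicator_def)
    also have "\<dots> = emeasure \<nu> A"
      unfolding \<nu>_def using that by (subst emeasure_density) auto
    finally show ?thesis .
  qed
  have nu_E: "emeasure \<nu> E = 0"
    unfolding \<nu>_def using E_meas
    by (subst emeasure_density) (auto simp: E_def indicator_def intro!: nn_integral_zero' AE_I2)
  have nu_fin: "emeasure \<nu> (space \<nu>) \<noteq> \<infinity>"
    using u pos by (simp add: \<nu>_def emeasure_density integrable_iff_bounded less_top)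
  have "negligible (bad c)" if c: "c > 0" for c
    unfolding negligible_outer_le
  proof (intro allI impI)
    fix e :: real assume e: "e > 0"
    have "(INF U\<in>{U. E \<subseteq> U \<and> open U}. emeasure \<nu> U) = 0"
      using outer_regular[OF sets_nu nu_fin E_meas] nu_E by simp
    moreover have "0 < ennreal (c * e / 2)" using c e by simp
    ultimately obtain U where U: "E \<subseteq> U" "open U" "emeasure \<nu> U < ennreal (c * e / 2)"
      by (metis (mono_tags, lifting) INF_less_iff mem_Collect_eq)
    define K where "K = {(a :: real, r :: real). 0 < r \<and> ball a r \<subseteq> U \<and>
        ennreal (c * r) \<le> emeasure \<nu> (ball a r)}"
    obtain C where C: "countable C" "C \<subseteq> K"
        "pairwise (\<lambda>i j. disjnt (ball (fst i) (snd i)) (ball (fst j) (snd j))) C"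
        "negligible (bad c - (\<Union>i\<in>C. ball (fst i) (snd i)))"
    proof (rule Vitali_covering_theorem_balls[of "bad c" K fst snd])
      fix x d :: real assume x: "x \<in> bad c" and d: "d > 0"
      then have "x \<in> U" using U(1) by (auto simp: bad_def)
      then obtain \<eta> where \<eta>: "\<eta> > 0" "ball x \<eta> \<subseteq> U" using U(2) openE by blast
      have "min d (\<eta>/2) > 0" using d \<eta> by auto
      then obtain s t where st: "s \<le> x" "x \<le> t" "s < t" "t - s < min d (\<eta>/2)"
        "c * (t - s) < (LINT y:{s..t}|lborel. u y)"
        using x unfolding bad_def mem_Collect_eq by meson
      \<comment> \<open>The radius is the full length of the interval, so that \<open>x\<close> is
        inside the open ball even as an end point of the interval. This costs the factor 2 in
        \<open>2 / c\<close>.\<close>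
      have sub: "ball ((s+t)/2) (t - s) \<subseteq> U"
      proof
        fix y assume "y \<in> ball ((s+t)/2) (t - s)"
        then have "y \<in> ball x \<eta>" using st(1-4) by (auto simp: ball_eq_greaterThanLessThan field_simps)
        then show "y \<in> U" using \<eta> by auto
      qed
      have xin: "dist ((s+t)/2) x < t - s" using st(1-3) by (auto simp: dist_real_def abs_less_iff field_simps)
      have "ennreal (c * (t - s)) \<le> ennreal (LINT y:{s..t}|lborel. u y)"
        using st by (intro ennreal_leI) auto
      also have "\<dots> \<le> emeasure \<nu> (ball ((s+t)/2) (t - s))"
        using st(3) by (intro nu_ge) (auto simp: ball_eq_greaterThanLessThan field_simps)
      finally show "\<exists>i. i \<in> K \<and> x \<in> ball (fst i) (snd i) \<and> snd i < d"
        using st(3,4) sub xin by (intro exI[of _ "((s+t)/2, t - s)"]) (simp add: K_def)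
    qed blast
    define W where "W = (\<Union>i\<in>C. ball (fst i) (snd i))"
    have disj: "disjoint_family_on (\<lambda>i. ball (fst i) (snd i)) C"
      using C(3) by (auto simp: disjoint_family_on_def pairwise_def disjnt_def)
    have WU: "W \<subseteq> U" using C(2) unfolding W_def K_def by fastforce
    have oW: "open W" by (auto simp: W_def)
    have "emeasure lborel W = (\<integral>\<^sup>+ i. emeasure lborel (ball (fst i) (snd i)) \<partial>count_space C)"
      unfolding W_def using C disj by (intro emeasure_UN_countable) auto
    also have "\<dots> \<le> (\<integral>\<^sup>+ i. ennreal (2 / c) * emeasure \<nu> (ball (fst i) (snd i)) \<partial>count_space C)"
    proof (intro nn_integral_mono)
      fix i assume "i \<in> space (count_space C)"
      then have i: "0 < snd i" "ennreal (c * snd i) \<le> emeasure \<nu> (ball (fst i) (snd i))"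
        using C(2) by (auto simp: K_def)
      have "emeasure lborel (ball (fst i) (snd i)) = ennreal (2 * snd i)"
        using i(1) by (simp add: ball_eq_greaterThanLessThan)
      also have "\<dots> = ennreal (2 / c) * ennreal (c * snd i)"
        using c i by (subst ennreal_mult[symmetric]) auto
      also have "\<dots> \<le> ennreal (2 / c) * emeasure \<nu> (ball (fst i) (snd i))"
        using i by (intro mult_left_mono) auto
      finally show "emeasure lborel (ball (fst i) (snd i)) \<le> \<dots>" .
    qed
    also have "\<dots> = ennreal (2 / c) * (\<integral>\<^sup>+ i. emeasure \<nu> (ball (fst i) (snd i)) \<partial>count_space C)"
      by (rule nn_integral_cmult) auto
    also have "(\<integral>\<^sup>+ i. emeasure \<nu> (ball (fst i) (snd i)) \<partial>count_space C) = emeasure \<nu> W"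
      unfolding W_def using C disj by (intro emeasure_UN_countable[symmetric]) (auto simp: sets_nu)
    also have "\<dots> \<le> ennreal (c * e / 2)"
      using emeasure_mono[OF WU, of \<nu>] U by (simp add: sets_nu)
    also have "ennreal (2 / c) * ennreal (c * e / 2) = ennreal e"
      using c e by (subst ennreal_mult[symmetric]) auto
    finally have W_le: "emeasure lborel W \<le> ennreal e" by (simp add: mult_left_mono)
    define T where "T = (bad c - W) \<union> W"
    have neg: "negligible (bad c - W)" using C(4) by (simp add: W_def)
    have Wl: "emeasure lebesgue W = emeasure lborel W" using oW by simp
    have Wm: "W \<in> lmeasurable"
      using W_le oW Wl by (intro fmeasurableI) (auto simp: le_less_trans[OF _ ennreal_less_top])
    have "T \<in> lmeasurable" "measure lebesgue T \<le> e"
    proof -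
      show "T \<in> lmeasurable" unfolding T_def
        using neg Wm by (intro fmeasurable.Un) (auto simp: negligible_iff_measure)
      have "measure lebesgue T \<le> measure lebesgue (bad c - W) + measure lebesgue W"
        unfolding T_def using neg Wm by (intro measure_Un_le) (auto simp: negligible_iff_measure)
      also have "\<dots> \<le> e" 
        using neg W_le e Wl by (simp add: negligible_iff_measure measure_def enn2real_leI)
      finally show "measure lebesgue T \<le> e" .
    qed
    then show "\<exists>T. bad c \<subseteq> T \<and> T \<in> lmeasurable \<and> measure lebesgue T \<le> e"
      by (intro exI[of _ T]) (auto simp: T_def)
  qed
  then have "negligible (\<Union>n. bad (1 / Suc n))" by (intro negligible_countable_Union) auto
  then have "AE x in lborel. x \<notin> (\<Union>n. bad (1 / Suc n))"
  proof -
    assume "negligible (\<Union>n. bad (1 / Suc n))"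
    then have "AE x in lebesgue. x \<notin> (\<Union>n. bad (1 / Suc n))"
      by (intro AE_not_in) (simp only: negligible_iff_null_sets)
    then show ?thesis by (simp only: AE_completion_iff)
  qed
  then show ?thesis
  proof (rule AE_mp[OF _ AE_I2], intro impI allI)
    fix x c :: real assume x: "x \<notin> (\<Union>n. bad (1 / Suc n))" "u x = 0" and c: "c > 0"
    obtain n where n: "1 / Suc n < c" using c nat_approx_posE by auto
    have "x \<notin> bad (1 / Suc n)" using x by auto
    then have "\<exists>\<delta>>0. \<forall>s t. \<not> (s \<le> x \<and> x \<le> t \<and> s < t \<and> t - s < \<delta> \<and>
        1 / Suc n * (t - s) < (LINT y:{s..t}|lborel. u y))"
      using x(2) unfolding bad_def E_def by blast
    then obtain \<delta> where \<delta>: "\<delta> > 0" "\<And>s t. \<not> (s \<le> x \<and> x \<le> t \<and> s < t \<and> t - s < \<delta> \<and>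
        1 / Suc n * (t - s) < (LINT y:{s..t}|lborel. u y))"
      by blast
    show "\<exists>\<delta>>0. \<forall>s t. s \<le> x \<and> x \<le> t \<and> s < t \<and> t - s < \<delta> \<longrightarrow> (LINT y:{s..t}|lborel. u y) \<le> c * (t - s)"
    proof (intro exI conjI allI impI)
      fix s t assume "s \<le> x \<and> x \<le> t \<and> s < t \<and> t - s < \<delta>"
      then have "(LINT y:{s..t}|lborel. u y) \<le> 1 / Suc n * (t - s)" and st: "s < t" using \<delta>(2)[of s t] by linarith+
      note this(1)
      also have "1 / Suc n * (t - s) \<le> c * (t - s)"
        using n st by (intro mult_right_mono) auto
      finally show "(LINT y:{s..t}|lborel. u y) \<le> c * (t - s)" .
    qed fact
  qed
qed

text \<open>Rational levels reduce the claim to vanishing densities: the positive part of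
  \<open>h - r\<close> is 0 at \<open>x\<close> if \<open>h x < r\<close>, and \<open>r\<close> can
  be taken below \<open>h x + c / 2\<close>. The cut-off to a bounded interval keeps this function
  integrable.\<close>

lemma averages_eventually_le:
  fixes h :: "real \<Rightarrow> real"
  assumes h: "integrable lborel h"
  shows "AE x in lborel. \<forall>c>0. \<exists>\<delta>>0. \<forall>s t. s \<le> x \<and> x \<le> t \<and> s < t \<and> t - s < \<delta> \<longrightarrow>
           (LINT y:{s..t}|lborel. h y) \<le> (h x + c) * (t - s)"
proof -
  define u where "u r n x = indicator {-real n..real n} x * max 0 (h x - real_of_rat r)" for r n x
  have [measurable]: "h \<in> borel_measurable borel" using h by auto
  have u_int: "integrable lborel (u r n)" for r n
  proof -
    have "integrable lborel (\<lambda>x. indicator {-real n..real n} x *\<^sub>R max 0 (h x - real_of_rat r))"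
    proof (rule Bochner_Integration.integrable_bound[where f="\<lambda>x. \<bar>h x\<bar> + \<bar>real_of_rat r\<bar> * indicator {-real n..real n} x"])
      show "integrable lborel (\<lambda>x. \<bar>h x\<bar> + \<bar>real_of_rat r\<bar> * indicat_real {- real n..real n} x)"
        using h by (intro Bochner_Integration.integrable_add integrable_abs) auto
    next
      have "max 0 (h x - real_of_rat r) \<le> \<bar>h x\<bar> + \<bar>real_of_rat r\<bar>" for x
        using abs_triangle_ineq4[of "h x" "real_of_rat r"] abs_ge_self[of "h x - real_of_rat r"] by (simp add: max_def)
      then show "AE x in lborel. norm (indicat_real {- real n..real n} x *\<^sub>R max 0 (h x - real_of_rat r))
        \<le> norm (\<bar>h x\<bar> + \<bar>real_of_rat r\<bar> * indicat_real {- real n..real n} x)"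
        by (auto simp: indicator_def)
    qed auto
    then show ?thesis by (simp add: u_def[abs_def])
  qed
  have "AE x in lborel. \<forall>r n. u r n x = 0 \<longrightarrow> (\<forall>c>0. \<exists>\<delta>>0. \<forall>s t. s \<le> x \<and> x \<le> t \<and> s < t \<and> t - s < \<delta> \<longrightarrow>
           (LINT y:{s..t}|lborel. u r n y) \<le> c * (t - s))"
    unfolding AE_all_countable
    by (intro allI vanishing_density_small_averages u_int) (auto simp: u_def)
  then show ?thesis
  proof (rule AE_mp[OF _ AE_I2], intro impI allI)
    fix x c :: real assume c: "c > 0" and *: "\<forall>r n. u r n x = 0 \<longrightarrow> (\<forall>c>0. \<exists>\<delta>>0. \<forall>s t. s \<le> x \<and> x \<le> t \<and> s < t \<and> t - s < \<delta> \<longrightarrow>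
           (LINT y:{s..t}|lborel. u r n y) \<le> c * (t - s))"
    \<comment> \<open>Intervals around \<open>x\<close> of length below 1 lie where the cut-off is
      inactive; hence the minimum with 1 below.\<close>
    obtain n :: nat where n: "\<bar>x\<bar> + 1 < n" using reals_Archimedean2 by blast
    obtain r where r: "h x < real_of_rat r" "real_of_rat r < h x + c/2"
      using of_rat_dense[of "h x" "h x + c/2"] c by auto
    have "u r n x = 0" using r by (simp add: u_def)
    then obtain \<delta> where \<delta>: "\<delta> > 0" "\<And>s t. s \<le> x \<Longrightarrow> x \<le> t \<Longrightarrow> s < t \<Longrightarrow> t - s < \<delta> \<Longrightarrow>
       (LINT y:{s..t}|lborel. u r n y) \<le> c/2 * (t - s)"
      using * c half_gt_zero[of c] by meson
    show "\<exists>\<delta>>0. \<forall>s t. s \<le> x \<and> x \<le> t \<and> s < t \<and> t - s < \<delta> \<longrightarrow>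
           (LINT y:{s..t}|lborel. h y) \<le> (h x + c) * (t - s)"
    proof (intro exI[of _ "min \<delta> 1"] conjI allI impI)
      fix s t assume st: "s \<le> x \<and> x \<le> t \<and> s < t \<and> t - s < min \<delta> 1"
      have hi: "set_integrable lborel {s..t} h"
        using h unfolding set_integrable_def by (intro integrable_mult_indicator) auto
      have ui: "set_integrable lborel {s..t} (u r n)"
        using u_int unfolding set_integrable_def by (intro integrable_mult_indicator) auto
      have ci: "set_integrable lborel {s..t} (\<lambda>_. real_of_rat r)"
        unfolding set_integrable_def by (intro integrable_scaleR_left integrable_real_indicator) (auto simp: emeasure_lborel_Icc_eq)
      have "(LINT y:{s..t}|lborel. h y) \<le> (LINT y:{s..t}|lborel. u r n y + real_of_rat r)"
      proof (rule set_integral_mono)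
        show "h y \<le> u r n y + real_of_rat r" if "y \<in> {s..t}" for y
          using that st n by (auto simp: u_def indicator_def)
      qed (use hi ui ci in auto)
      also have "\<dots> = (LINT y:{s..t}|lborel. u r n y) + (LINT y:{s..t}|lborel. real_of_rat r)"
        by (intro set_integral_add ui ci)
      also have "(LINT y:{s..t}|lborel. real_of_rat r) = real_of_rat r * (t - s)"
        using st by (subst set_integral_const) auto
      also have "(LINT y:{s..t}|lborel. u r n y) + real_of_rat r * (t - s) \<le> c/2 * (t - s) + (h x + c/2) * (t - s)"
        using st \<delta>(2)[of s t] r by (intro add_mono mult_right_mono) auto
      finally show "(LINT y:{s..t}|lborel. h y) \<le> (h x + c) * (t - s)"
        by (simp add: algebra_simps)
    qed (use \<delta> in auto)
  qed
qed

lemma set_integral_split_at: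
  fixes h :: "real \<Rightarrow> real"
  assumes h: "set_integrable lborel {a..b} h" and "a \<le> s" "s \<le> t" "t \<le> b"
  shows "(LINT y:{a..t}|lborel. h y) = (LINT y:{a..s}|lborel. h y) + (LINT y:{s..t}|lborel. h y)"
proof -
  have "(LINT y:{a..s} \<union> {s<..t}|lborel. h y) = (LINT y:{a..s}|lborel. h y) + (LINT y:{s<..t}|lborel. h y)"
    using assms by (intro set_integral_Un) (auto intro: set_integrable_subset[OF h])
  moreover have "{a..s} \<union> {s<..t} = {a..t}" using assms by auto
  moreover have "(LINT y:{s<..t}|lborel. h y) = (LINT y:{s..t}|lborel. h y)"
    by (rule set_integral_discrete_difference[where X="{s}"]) auto
  ultimately show ?thesis by simp
qed

text \<open>The one-sided estimate is applied to the density and to its negative. It admits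
  \<open>x\<close> as an end point of the interval, which is the situation of a difference
  quotient.\<close>

theorem lebesgue_differentiation_interval:
  fixes h \<phi> :: "real \<Rightarrow> real"
  assumes h: "set_integrable lborel {a..b} h"
    and \<phi>: "\<And>s t. a \<le> s \<Longrightarrow> s \<le> t \<Longrightarrow> t \<le> b \<Longrightarrow> \<phi> t - \<phi> s = (LINT y:{s..t}|lborel. h y)"
  shows "AE x in lborel. x \<in> {a<..<b} \<longrightarrow> (\<phi> has_real_derivative h x) (at x)"
proof -
  define k where "k x = indicator {a..b} x * h x" for x
  have k: "integrable lborel k" using h by (simp add: k_def[abs_def] set_integrable_def)
  have keq: "(LINT y:{s..t}|lborel. k y) = (LINT y:{s..t}|lborel. h y)" if "a \<le> s" "t \<le> b" for s t
    using that unfolding k_def set_lebesgue_integral_def 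
    by (intro Bochner_Integration.integral_cong) (auto simp: indicator_def)
  note 1 = averages_eventually_le[OF k]
  have "integrable lborel (\<lambda>x. - k x)" using k by auto
  note 2 = averages_eventually_le[OF this]
  show ?thesis using 1 2
  proof eventually_elim
    case (elim x)
    show ?case
    proof
      assume x: "x \<in> {a<..<b}"
      have hx: "k x = h x" using x by (simp add: k_def)
      show "(\<phi> has_real_derivative h x) (at x)"
        unfolding has_field_derivative_iff LIM_eq
      proof (intro allI impI)
        fix e :: real assume e: "e > 0"
        then have e2: "e/2 > 0" by simp
        obtain \<delta>1 where d1: "\<delta>1 > 0" "\<And>s t. s \<le> x \<Longrightarrow> x \<le> t \<Longrightarrow> s < t \<Longrightarrow> t - s < \<delta>1 \<Longrightarrow>
           (LINT y:{s..t}|lborel. k y) \<le> (k x + e/2) * (t - s)"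
          using elim(1) e2 by meson
        obtain \<delta>2 where d2: "\<delta>2 > 0" "\<And>s t. s \<le> x \<Longrightarrow> x \<le> t \<Longrightarrow> s < t \<Longrightarrow> t - s < \<delta>2 \<Longrightarrow>
           (LINT y:{s..t}|lborel. - k y) \<le> (- k x + e/2) * (t - s)"
          using elim(2) e2 by meson
        define \<delta> where "\<delta> = min (min \<delta>1 \<delta>2) (min (x - a) (b - x))"
        have key: "\<bar>\<phi> t - \<phi> s - h x * (t - s)\<bar> \<le> e/2 * (t - s)"
          if "s \<le> x" "x \<le> t" "s < t" "t - s < \<delta>" for s t
        proof -
          have "a \<le> s" "t \<le> b" using that by (auto simp: \<delta>_def)
          then have "\<phi> t - \<phi> s = (LINT y:{s..t}|lborel. k y)" using \<phi> keq that by simp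
          moreover have "(LINT y:{s..t}|lborel. - k y) = - (LINT y:{s..t}|lborel. k y)"
            unfolding set_lebesgue_integral_def by simp
          moreover have "(LINT y:{s..t}|lborel. k y) \<le> h x * (t - s) + e/2 * (t - s)"
            using d1(2)[of s t] that hx by (simp add: \<delta>_def distrib_right)
          moreover have "(LINT y:{s..t}|lborel. - k y) \<le> - (h x * (t - s)) + e/2 * (t - s)"
            using d2(2)[of s t] that hx distrib_right[of "- h x" "e/2" "t - s"] unfolding \<delta>_def mult_minus_left
            by (metis (no_types, lifting) min_less_iff_conj)
          ultimately show ?thesis by linarith
        qed
        show "\<exists>s>0. \<forall>z. z \<noteq> x \<and> norm (z - x) < s \<longrightarrow> norm ((\<phi> z - \<phi> x) / (z - x) - h x) < e"
        proof (intro exI[of _ \<delta>] conjI allI impI)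
          show "\<delta> > 0" using d1 d2 x by (auto simp: \<delta>_def)
          fix z assume z: "z \<noteq> x \<and> norm (z - x) < \<delta>"
          have "\<bar>\<phi> z - \<phi> x - h x * (z - x)\<bar> \<le> e/2 * \<bar>z - x\<bar>"
          proof (cases "z < x")
            case True
            have "\<bar>\<phi> x - \<phi> z - h x * (x - z)\<bar> \<le> e/2 * (x - z)" using True z by (intro key) auto
            moreover have "\<phi> z - \<phi> x - h x * (z - x) = - (\<phi> x - \<phi> z - h x * (x - z))" by (simp add: algebra_simps)
            ultimately show ?thesis using True by (simp only: abs_minus_cancel) (simp add: abs_if)
          next
            case False
            have "\<bar>\<phi> z - \<phi> x - h x * (z - x)\<bar> \<le> e/2 * (z - x)" using False z by (intro key) auto
            then show ?thesis using False by simp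
          qed
          moreover have "(\<phi> z - \<phi> x) / (z - x) - h x = (\<phi> z - \<phi> x - h x * (z - x)) / (z - x)"
            using z by (simp add: field_simps)
          ultimately have "norm ((\<phi> z - \<phi> x) / (z - x) - h x) \<le> e/2"
            using z by (simp add: abs_divide divide_le_eq)
          then show "norm ((\<phi> z - \<phi> x) / (z - x) - h x) < e" using e by simp
        qed
      qed
    qed
  qed
qed

lemma set_integral_abs_le:
  fixes g :: "real \<Rightarrow> real"
  assumes "set_integrable lborel A g"
  shows "(LINT u:A|lborel. g u) \<le> (LINT u:A|lborel. \<bar>g u\<bar>)"
  using assms by (intro set_integral_mono set_integrable_abs) auto

text \<open>With \<open>G\<close> a primitive of |g|, both \<open>\<phi> + G\<close> and
  \<open>G - \<phi>\<close> are nondecreasing, and their Stieltjes measures add up to the measure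
  with density 2|g|. So the first one is absolutely continuous and has a Radon-Nikodym density;
  subtracting |g| from it gives \<open>h\<close>.\<close>

lemma dominated_increments_density:
  fixes \<phi> g :: "real \<Rightarrow> real"
  assumes ab: "a \<le> b" and g: "set_integrable lborel {a..b} g"
    and le: "\<And>s t. a \<le> s \<Longrightarrow> s \<le> t \<Longrightarrow> t \<le> b \<Longrightarrow> \<bar>\<phi> t - \<phi> s\<bar> \<le> (LINT u:{s..t}|lborel. g u)"
  obtains h where "set_integrable lborel {a..b} h"
    "\<And>s t. a \<le> s \<Longrightarrow> s \<le> t \<Longrightarrow> t \<le> b \<Longrightarrow> \<phi> t - \<phi> s = (LINT u:{s..t}|lborel. h u)"
proof -
  define gg where "gg x = indicator {a..b} x * \<bar>g x\<bar>" for x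
  \<comment> \<open>Clamping to \<open>{a..b}\<close> extends the functions by constants, as
    \<open>interval_measure\<close> expects functions on the whole line.\<close>
  define c where "c t = max a (min b t)" for t
  define G where "G t = (LINT u:{a..c t}|lborel. gg u)" for t
  define F where "F t = \<phi> (c t) + G t" for t
  have gi: "integrable lborel gg"
    using set_integrable_abs[OF g] by (simp add: gg_def[abs_def] set_integrable_def)
  then have gm [measurable]: "gg \<in> borel_measurable borel" by auto
  have gsi: "set_integrable lborel {s..t} gg" for s t
    using gi unfolding set_integrable_def by (intro integrable_mult_indicator) auto
  have c_mem: "a \<le> c t" "c t \<le> b" and c_mono: "s \<le> t \<Longrightarrow> c s \<le> c t" for s t
    using ab by (auto simp: c_def)
  have c_id: "c t = t" if "a \<le> t" "t \<le> b" for t using that by (auto simp: c_def)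
  have G_diff: "G t - G s = (LINT u:{c s..c t}|lborel. gg u)" if "s \<le> t" for s t
    using set_integral_split_at[OF gsi[of a "c t"] c_mem(1)[of s] c_mono[OF that] order_refl]
    unfolding G_def by linarith
  have gg0: "0 \<le> gg x" for x by (simp add: gg_def)
  have G_mono: "G s \<le> G t" if "s \<le> t" for s t
    using G_diff[OF that] gg0 Bochner_Integration.integral_nonneg[of lborel "\<lambda>x. indicator {c s..c t} x *\<^sub>R gg x"]
    unfolding set_lebesgue_integral_def by fastforce
  have phi_le: "\<bar>\<phi> (c t) - \<phi> (c s)\<bar> \<le> G t - G s" if "s \<le> t" for s t
  proof -
    have "\<bar>\<phi> (c t) - \<phi> (c s)\<bar> \<le> (LINT u:{c s..c t}|lborel. g u)"
      using c_mem c_mono that by (intro le) auto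
    also have "\<dots> \<le> (LINT u:{c s..c t}|lborel. \<bar>g u\<bar>)"
      using c_mem by (intro set_integral_abs_le set_integrable_subset[OF g]) auto
    also have "\<dots> = (LINT u:{c s..c t}|lborel. gg u)"
      using c_mem[of s] c_mem[of t] unfolding set_lebesgue_integral_def gg_def
      by (intro Bochner_Integration.integral_cong) (auto simp: indicator_def)
    finally show ?thesis using G_diff[OF that] by simp
  qed
  have F_mono: "F s \<le> F t" and F_le: "F t - F s \<le> 2 * G t - 2 * G s" if "s \<le> t" for s t
    using phi_le[OF that] unfolding F_def by linarith+
  have G_cont: "continuous_on UNIV G"
  proof -
    have "continuous_on {a..b} (\<lambda>t. integral {a..t} gg)"
      using set_borel_integral_eq_integral(1)[OF gsi] by (intro indefinite_integral_continuous_1) 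
    then have "continuous_on UNIV (\<lambda>t. integral {a..c t} gg)"
      by (rule continuous_on_compose2) (use c_mem in \<open>auto simp: c_def intro!: continuous_intros\<close>)
    then show ?thesis unfolding G_def using set_borel_integral_eq_integral(2)[OF gsi] by simp
  qed
  have F_cont: "continuous_on UNIV F"
    unfolding continuous_on_iff
  proof (intro ballI allI impI)
    fix x e :: real assume e: "e > 0"
    then have "e/2 > 0" by simp
    then obtain d where d: "d > 0" "\<And>y. dist y x < d \<Longrightarrow> dist (G y) (G x) < e/2"
      using G_cont unfolding continuous_on_iff by (metis UNIV_I)
    have *: "dist (F y) (F x) \<le> 2 * dist (G y) (G x)" for y
      using F_mono[of x y] F_le[of x y] F_mono[of y x] F_le[of y x] by (cases "x \<le> y") (auto simp: dist_real_def)
    show "\<exists>d>0. \<forall>x'\<in>UNIV. dist x' x < d \<longrightarrow> dist (F x') (F x) < e"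
      using d le_less_trans[OF *] by (intro exI[of _ d]) fastforce
  qed
  define F' where "F' t = 2 * G t - F t" for t
  have F'_mono: "F' s \<le> F' t" if "s \<le> t" for s t using F_le[OF that] by (simp add: F'_def)
  have F'_cont: "continuous_on UNIV F'" unfolding F'_def by (intro continuous_intros G_cont F_cont)
  define \<mu> where "\<mu> = interval_measure F"
  define \<mu>' where "\<mu>' = interval_measure F'"
  define \<nu> where "\<nu> = density lborel (\<lambda>x. ennreal (2 * gg x))"
  have mu: "emeasure \<mu> {s<..t} = F t - F s" if "s \<le> t" for s t
    unfolding \<mu>_def using that F_mono F_cont
    by (intro emeasure_interval_measure_Ioc) (auto intro: continuous_on_imp_continuous_within)
  have mu': "emeasure \<mu>' {s<..t} = F' t - F' s" if "s \<le> t" for s t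
    unfolding \<mu>'_def using that F'_mono F'_cont
    by (intro emeasure_interval_measure_Ioc) (auto intro: continuous_on_imp_continuous_within)
  have nu: "emeasure \<nu> {s<..t} = 2 * (G t - G s)" if "s \<le> t" for s t
  proof -
    have "emeasure \<nu> {s<..t} = (\<integral>\<^sup>+ x. ennreal (indicator {c s<..c t} x * (2 * gg x)) \<partial>lborel)"
      unfolding \<nu>_def
    proof (subst emeasure_density; (intro nn_integral_cong_AE)?)
      have "AE x in lborel. x \<noteq> a" by (rule AE_lborel_singleton)
      then show "AE x in lborel. ennreal (2 * gg x) * indicator {s<..t} x = ennreal (indicat_real {c s<..c t} x * (2 * gg x))"
        by eventually_elim (auto simp: indicator_def c_def gg_def)
    qed auto
    also have "\<dots> = ennreal (LINT x|lborel. indicator {c s<..c t} x * (2 * gg x))"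
      using gi gg0 integrable_mult_indicator[of "{c s<..c t}" lborel "\<lambda>x. 2 * gg x"]
      by (intro nn_integral_eq_integral) auto
    also have "(LINT x|lborel. indicator {c s<..c t} x * (2 * gg x)) = 2 * (LINT u:{c s<..c t}|lborel. gg u)"
      unfolding set_lebesgue_integral_def by (simp add: mult.left_commute)
    also have "(LINT u:{c s<..c t}|lborel. gg u) = (LINT u:{c s..c t}|lborel. gg u)"
      by (rule set_integral_discrete_difference[where X="{c s}"]) auto
    finally show ?thesis using G_diff[OF that] by simp
  qed
  define \<eta> where "\<eta> = measure_of UNIV (sets borel) (\<lambda>A. emeasure \<mu> A + emeasure \<mu>' A)"
  have sets_mu: "sets \<mu> = sets borel" "sets \<mu>' = sets borel" by (auto simp: \<mu>_def \<mu>'_def)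
  have eta: "emeasure \<eta> A = emeasure \<mu> A + emeasure \<mu>' A" if "A \<in> sets borel" for A
    unfolding \<eta>_def
  proof (rule emeasure_measure_of_sigma)
    show "sigma_algebra UNIV (sets (borel :: real measure))"
      using sets.sigma_algebra_axioms[of borel] by simp
    show "positive (sets borel) (\<lambda>A. emeasure \<mu> A + emeasure \<mu>' A)" by (simp add: positive_def)
    show "countably_additive (sets borel) (\<lambda>A. emeasure \<mu> A + emeasure \<mu>' A)"
      by (auto simp: countably_additive_def suminf_add[symmetric] suminf_emeasure sets_mu)
  qed (use that in simp)
  have "\<nu> = \<eta>"
  proof (rule measure_eqI_generator_eq[where E="range (\<lambda>(s, t). {s<..t::real})" and A="\<lambda>n. {-real n<..real n}" and \<Omega>=UNIV])
    show "Int_stable (range (\<lambda>(s, t). {s<..t::real}))"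
    proof (rule Int_stableI_image)
      fix i j :: "real \<times> real"
      show "\<exists>k\<in>UNIV. (case i of (s, t) \<Rightarrow> {s<..t}) \<inter> (case j of (s, t) \<Rightarrow> {s<..t}) = (case k of (s, t) \<Rightarrow> {s<..t})"
        by (intro bexI[of _ "(max (fst i) (fst j), min (snd i) (snd j))"]) (auto simp: case_prod_beta)
    qed
    show "emeasure \<nu> X = emeasure \<eta> X" if X: "X \<in> range (\<lambda>(s, t). {s<..t})" for X
    proof -
      obtain s t where st: "X = {s<..t}" using X by auto
      show ?thesis
      proof (cases "s \<le> t")
        case True
        then have "emeasure \<eta> X = ennreal (F t - F s) + ennreal (F' t - F' s)"
          using mu mu' by (simp add: st eta)
        also have "\<dots> = ennreal (2 * (G t - G s))"
          using True F_mono[of s t] F'_mono[of s t]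
          by (subst ennreal_plus[symmetric]) (auto simp: F'_def algebra_simps)
        finally show ?thesis using nu True by (simp add: st)
      qed (simp add: st)
    qed
    show "(\<Union>i. {- real i<..real i}) = (UNIV :: real set)"
    proof (intro equalityI subsetI UN_I UNIV_I)
      fix x :: real
      have "\<bar>x\<bar> + 1 \<le> real (nat \<lceil>\<bar>x\<bar> + 1\<rceil>)" by linarith
      then show "x \<in> {- real (nat \<lceil>\<bar>x\<bar> + 1\<rceil>)<..real (nat \<lceil>\<bar>x\<bar> + 1\<rceil>)}"
        unfolding greaterThanAtMost_iff by linarith
    qed
    have "sets (borel :: real measure) = sigma_sets UNIV (range (\<lambda>(s, t). {s<..t::real}))"
      by (subst borel_sigma_sets_Ioc) (simp add: sets_measure_of)
    then show "sets \<nu> = sigma_sets UNIV (range (\<lambda>(s, t). {s<..t::real}))"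
      "sets \<eta> = sigma_sets UNIV (range (\<lambda>(s, t). {s<..t::real}))"
      using sets.sigma_sets_eq[of "borel :: real measure"] by (simp_all add: \<nu>_def \<eta>_def)
  qed (auto simp: nu)
  then have mu_le: "emeasure \<mu> A \<le> emeasure \<nu> A" if "A \<in> sets borel" for A
    using eta[OF that] by simp
  have ac: "absolutely_continuous lborel \<mu>"
  proof -
    have "absolutely_continuous lborel \<nu>" unfolding \<nu>_def by (intro absolutely_continuousI_density) auto
    then have *: "A \<in> sets borel \<Longrightarrow> emeasure lborel A = 0 \<Longrightarrow> emeasure \<nu> A = 0" for A
      by (auto dest: absolutely_continuousD)
    show ?thesis unfolding absolutely_continuous_def
    proof
      fix A :: "real set" assume "A \<in> null_sets lborel"
      then have A: "A \<in> sets borel" "emeasure lborel A = 0" by auto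
      then have "emeasure \<mu> A \<le> 0" using *[OF A] mu_le[OF A(1)] by simp
      then show "A \<in> null_sets \<mu>" using A by (simp add: null_sets_def sets_mu)
    qed
  qed
  then obtain f where f [measurable]: "f \<in> borel_measurable borel" and fd: "density lborel f = \<mu>"
    using sigma_finite_measure.Radon_Nikodym[OF sigma_finite_lborel ac] sets_mu by auto
  have nu_fin: "emeasure \<nu> UNIV < \<infinity>"
    using gi gg0 unfolding \<nu>_def
    by (subst emeasure_density) (auto simp: integrable_iff_bounded ennreal_mult nn_integral_cmult ennreal_mult_less_top)
  then have f_fin: "(\<integral>\<^sup>+ x. f x \<partial>lborel) < \<infinity>"
    using mu_le[of UNIV] by (simp add: fd[symmetric] emeasure_density)
  have f_AE: "AE x in lborel. f x \<noteq> \<infinity>" using f_fin by (intro nn_integral_PInf_AE) auto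
  have fr: "integrable lborel (\<lambda>x. enn2real (f x))"
  proof (rule integrableI_nonneg)
    have "(\<integral>\<^sup>+ x. ennreal (enn2real (f x)) \<partial>lborel) = (\<integral>\<^sup>+ x. f x \<partial>lborel)"
      by (rule nn_integral_cong_AE) (use f_AE in \<open>eventually_elim, auto simp: less_top\<close>)
    then show "(\<integral>\<^sup>+ x. ennreal (enn2real (f x)) \<partial>lborel) < \<infinity>" using f_fin by simp
  qed auto
  have frs: "set_integrable lborel {s..t} (\<lambda>x. enn2real (f x))" for s t
    using fr unfolding set_integrable_def by (intro integrable_mult_indicator) auto
  have F_int: "F t - F s = (LINT u:{s..t}|lborel. enn2real (f u))" if "s \<le> t" for s t
  proof -
    have "ennreal (F t - F s) = emeasure \<mu> {s<..t}" using mu that by simp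
    also have "\<dots> = (\<integral>\<^sup>+ x. f x * indicator {s<..t} x \<partial>lborel)"
      by (simp add: fd[symmetric] emeasure_density)
    also have "\<dots> = (\<integral>\<^sup>+ x. ennreal (indicator {s<..t} x * enn2real (f x)) \<partial>lborel)"
      by (rule nn_integral_cong_AE) (use f_AE in \<open>eventually_elim, auto simp: less_top indicator_def\<close>)
    also have "\<dots> = ennreal (LINT x|lborel. indicator {s<..t} x * enn2real (f x))"
      using fr integrable_mult_indicator[of "{s<..t}" lborel "\<lambda>x. enn2real (f x)"]
      by (intro nn_integral_eq_integral) auto
    also have "(LINT x|lborel. indicator {s<..t} x * enn2real (f x)) = (LINT u:{s<..t}|lborel. enn2real (f u))"
      unfolding set_lebesgue_integral_def by simp
    also have "\<dots> = (LINT u:{s..t}|lborel. enn2real (f u))"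
      by (rule set_integral_discrete_difference[where X="{s}"]) auto
    finally have "ennreal (F t - F s) = ennreal (LINT u:{s..t}|lborel. enn2real (f u))" .
    then show ?thesis using F_mono[OF that]
      by (subst (asm) ennreal_inj) (auto simp: set_lebesgue_integral_def intro!: Bochner_Integration.integral_nonneg)
  qed
  show ?thesis
  proof
    show "set_integrable lborel {a..b} (\<lambda>x. enn2real (f x) - gg x)"
      by (intro set_integral_diff frs gsi)
    fix s t assume st: "a \<le> s" "s \<le> t" "t \<le> b"
    then have "c s = s" "c t = t" by (auto intro: c_id)
    then have "\<phi> t - \<phi> s = (F t - F s) - (G t - G s)" by (simp add: F_def)
    also have "\<dots> = (LINT u:{s..t}|lborel. enn2real (f u) - gg u)"
      using F_int[OF st(2)] G_diff[OF st(2)] \<open>c s = s\<close> \<open>c t = t\<close>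
      by (simp add: set_integral_diff(2)[OF frs gsi])
    finally show "\<phi> t - \<phi> s = (LINT u:{s..t}|lborel. enn2real (f u) - gg u)" .
  qed
qed

section \<open>Metric derivatives and lengths of causal curves\<close>

lemma difference_quotient_abs_tendsto:
  fixes \<phi> :: "real \<Rightarrow> real"
  assumes "(\<phi> has_real_derivative D) (at t)"
  shows "((\<lambda>s. \<bar>\<phi> s - \<phi> t\<bar> / \<bar>s - t\<bar>) \<longlongrightarrow> \<bar>D\<bar>) (at t)"
  using tendsto_rabs[OF assms[unfolded has_field_derivative_iff]] by (simp add: abs_divide)

lemma mdist_triangle_diff:
  assumes "x \<in> mspace Y" "y \<in> mspace Y" "z \<in> mspace Y"
  shows "\<bar>mdist Y x z - mdist Y y z\<bar> \<le> mdist Y x y"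
proof -
  interpret Metric_space "mspace Y" "mdist Y" by simp
  show ?thesis using mdist_reverse_triangle[of x z y] assms by (simp add: commute)
qed

text \<open>The metric derivative is the supremum of the absolute derivatives of the distances to
  the points of a countable dense set. These distances are 1-Lipschitz, which bounds the quotients
  from below; a dense point close to \<open>\<beta> s\<close> recovers the whole distance, which
  bounds them from above.\<close>

lemma ac_curve_metric_derivative:
  fixes \<beta> :: "real \<Rightarrow> 'y"
  assumes ab: "a < b" and \<beta>: "\<And>t. a \<le> t \<Longrightarrow> t \<le> b \<Longrightarrow> \<beta> t \<in> mspace Y"
    and g: "set_integrable lborel {a..b} g"
    and le: "\<And>s t. a \<le> s \<Longrightarrow> s \<le> t \<Longrightarrow> t \<le> b \<Longrightarrow> mdist Y (\<beta> s) (\<beta> t) \<le> (LINT u:{s..t}|lborel. g u)"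
    and D: "countable D" "D \<subseteq> mspace Y" "\<And>x e. x \<in> mspace Y \<Longrightarrow> 0 < e \<Longrightarrow> \<exists>z\<in>D. mdist Y x z < e"
  shows "AE t in lborel. t \<in> {a<..<b} \<longrightarrow>
    ((\<lambda>s. mdist Y (\<beta> s) (\<beta> t) / \<bar>s - t\<bar>) \<longlongrightarrow> metric_deriv Y \<beta> t) (at t)"
proof -
  interpret Metric_space "mspace Y" "mdist Y" by simp
  have D0: "D \<noteq> {}" using D(3)[of "\<beta> a" 1] \<beta>[of a] ab by auto
  define \<phi> where "\<phi> z t = mdist Y (\<beta> t) z" for z t
  have phi_le: "\<bar>\<phi> z t - \<phi> z s\<bar> \<le> mdist Y (\<beta> s) (\<beta> t)"
    if "z \<in> D" "a \<le> s" "s \<le> b" "a \<le> t" "t \<le> b" for z s t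
    using mdist_triangle_diff[of "\<beta> t" Y "\<beta> s" z] that \<beta> D(2) by (auto simp: \<phi>_def commute)
  have "\<exists>h. set_integrable lborel {a..b} h \<and>
      (\<forall>s t. a \<le> s \<longrightarrow> s \<le> t \<longrightarrow> t \<le> b \<longrightarrow> \<phi> z t - \<phi> z s = (LINT u:{s..t}|lborel. h u))" if "z \<in> D" for z
  proof (rule dominated_increments_density[of a b g "\<phi> z"])
    fix s t assume "a \<le> s" "s \<le> t" "t \<le> b"
    then show "\<bar>\<phi> z t - \<phi> z s\<bar> \<le> (LINT u:{s..t}|lborel. g u)"
      using phi_le[OF that, of s t] le[of s t] by linarith
  qed (use ab g in auto)
  then obtain h where h: "\<And>z. z \<in> D \<Longrightarrow> set_integrable lborel {a..b} (h z)"
    "\<And>z s t. z \<in> D \<Longrightarrow> a \<le> s \<Longrightarrow> s \<le> t \<Longrightarrow> t \<le> b \<Longrightarrow> \<phi> z t - \<phi> z s = (LINT u:{s..t}|lborel. h z u)"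
    by metis
  define I where "I t = (indicator {a..b} t :: real)" for t
  \<comment> \<open>The minimum with |g| makes the supremum finite at every parameter. It changes
    nothing almost everywhere, because |h z| is at most |g| there.\<close>
  define m where "m t = (SUP z\<in>D. min \<bar>I t * h z t\<bar> \<bar>I t * g t\<bar>)" for t
  have gI [measurable]: "(\<lambda>t. I t * g t) \<in> borel_measurable borel" and gInt: "integrable lborel (\<lambda>t. I t * g t)"
    using g by (auto simp: set_integrable_def I_def)
  have hI [measurable]: "(\<lambda>t. I t * h z t) \<in> borel_measurable borel" if "z \<in> D" for z
    using h(1)[OF that] by (auto simp: set_integrable_def I_def)
  have bdd: "bdd_above ((\<lambda>z. min \<bar>I t * h z t\<bar> \<bar>I t * g t\<bar>) ` D)" for t
    by (rule bdd_aboveI[where M="\<bar>I t * g t\<bar>"]) auto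
  have m_meas [measurable]: "m \<in> borel_measurable borel"
    unfolding m_def[abs_def] using bdd D(1) hI gI by (intro borel_measurable_cSUP) measurable
  have m_ge: "min \<bar>I t * h z t\<bar> \<bar>I t * g t\<bar> \<le> m t" if "z \<in> D" for z t
    unfolding m_def using that bdd by (intro cSUP_upper) auto
  have m_le: "m t \<le> \<bar>I t * g t\<bar>" for t
    unfolding m_def using D0 by (intro cSUP_least) auto
  have m_pos: "0 \<le> m t" for t
    using m_ge D0 by (metis abs_ge_zero ex_in_conv min_def order_trans)
  have m_int: "integrable lborel m"
    using gInt by (rule Bochner_Integration.integrable_bound) (use m_le m_pos in auto)
  have msi: "set_integrable lborel {s..t} m" for s t
    using m_int unfolding set_integrable_def by (intro integrable_mult_indicator) auto
  define Gg where "Gg t = (LINT u:{a..t}|lborel. g u)" for t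
  define Gm where "Gm t = (LINT u:{a..t}|lborel. m u)" for t
  have Gg: "Gg t - Gg s = (LINT u:{s..t}|lborel. g u)" if "a \<le> s" "s \<le> t" "t \<le> b" for s t
    using set_integral_split_at[of a t g s t] that set_integrable_subset[OF g, of "{a..t}"] by (simp add: Gg_def)
  have Gm: "Gm t - Gm s = (LINT u:{s..t}|lborel. m u)" if "a \<le> s" "s \<le> t" for s t
    using set_integral_split_at[of a t m s t] that msi by (simp add: Gm_def)
  have AE1: "AE t in lborel. \<forall>z\<in>D. t \<in> {a<..<b} \<longrightarrow> (\<phi> z has_real_derivative h z t) (at t)"
    unfolding AE_ball_countable[OF D(1)]
    using h by (intro ballI lebesgue_differentiation_interval) auto
  have AE2: "AE t in lborel. t \<in> {a<..<b} \<longrightarrow> (Gg has_real_derivative g t) (at t)"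
    by (rule lebesgue_differentiation_interval[OF g Gg])
  have AE3: "AE t in lborel. t \<in> {a<..<b} \<longrightarrow> (Gm has_real_derivative m t) (at t)"
    by (rule lebesgue_differentiation_interval[OF msi Gm])
  have near: "eventually (\<lambda>s. s \<in> {a<..<b}) (at t)" if "t \<in> {a<..<b}" for t
    using that by (intro eventually_at_in_open') auto
  have AE4: "AE t in lborel. t \<in> {a<..<b} \<longrightarrow> (\<forall>z\<in>D. \<bar>h z t\<bar> \<le> \<bar>g t\<bar>)"
    using AE1 AE2
  proof eventually_elim
    case (elim t)
    show ?case
    proof (intro impI ballI)
      fix z assume t: "t \<in> {a<..<b}" and z: "z \<in> D"
      have "((\<lambda>s. \<bar>\<phi> z s - \<phi> z t\<bar> / \<bar>s - t\<bar>) \<longlongrightarrow> \<bar>h z t\<bar>) (at t)"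
        using elim t z by (intro difference_quotient_abs_tendsto) auto
      moreover have "((\<lambda>s. \<bar>Gg s - Gg t\<bar> / \<bar>s - t\<bar>) \<longlongrightarrow> \<bar>g t\<bar>) (at t)"
        using elim t by (intro difference_quotient_abs_tendsto) auto
      moreover have "eventually (\<lambda>s. \<bar>\<phi> z s - \<phi> z t\<bar> / \<bar>s - t\<bar> \<le> \<bar>Gg s - Gg t\<bar> / \<bar>s - t\<bar>) (at t)"
        using near[OF t]
      proof eventually_elim
        case (elim s)
        have "\<bar>\<phi> z s - \<phi> z t\<bar> \<le> \<bar>Gg s - Gg t\<bar>"
        proof (cases "s \<le> t")
          case True
          then show ?thesis using phi_le[OF z, of s t] le[of s t] Gg[of s t] elim t by auto
        next
          case False
          then show ?thesis using phi_le[OF z, of t s] le[of t s] Gg[of t s] elim t by auto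
        qed
        then show ?case by (intro divide_right_mono) auto
      qed
      ultimately show "\<bar>h z t\<bar> \<le> \<bar>g t\<bar>"
        by (intro tendsto_le[OF trivial_limit_at]) 
    qed
  qed
  have m_h: "AE t in lborel. t \<in> {a<..<b} \<longrightarrow> (\<forall>z\<in>D. \<bar>h z t\<bar> \<le> m t)"
    using AE4
  proof eventually_elim
    case (elim t)
    show ?case using elim m_ge[of _ t] by (fastforce simp: I_def)
  qed
  have AEab: "AE t in lborel. t \<noteq> a \<and> t \<noteq> b"
    using AE_lborel_singleton[of a] AE_lborel_singleton[of b] by eventually_elim auto
  have dist_le: "mdist Y (\<beta> s) (\<beta> t) \<le> Gm t - Gm s" if st: "a \<le> s" "s \<le> t" "t \<le> b" for s t
  proof (rule field_le_epsilon)
    fix e :: real assume e: "e > 0"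
    have bs: "\<beta> s \<in> mspace Y" "\<beta> t \<in> mspace Y" using \<beta> st by auto
    then obtain z where z: "z \<in> D" "mdist Y (\<beta> s) z < e/2" using D(3)[of "\<beta> s" "e/2"] e by auto
    have "mdist Y (\<beta> s) (\<beta> t) \<le> mdist Y (\<beta> s) z + mdist Y (\<beta> t) z"
      using triangle[of "\<beta> s" z "\<beta> t"] bs z D(2) commute[of z "\<beta> t"] by auto
    also have "\<dots> \<le> (\<phi> z t - \<phi> z s) + e" using z by (simp add: \<phi>_def)
    also have "\<phi> z t - \<phi> z s = (LINT u:{s..t}|lborel. h z u)" using h z st by auto
    also have "\<dots> \<le> (LINT u:{s..t}|lborel. m u)"
    proof (rule set_integral_mono_AE[OF _ msi])
      show "set_integrable lborel {s..t} (h z)" using st by (intro set_integrable_subset[OF h(1)[OF z(1)]]) auto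
      show "AE u\<in>{s..t} in lborel. h z u \<le> m u"
        using m_h AEab by eventually_elim (use z st in \<open>auto simp: abs_le_iff\<close>)
    qed
    also have "\<dots> = Gm t - Gm s" using Gm st by auto
    finally show "mdist Y (\<beta> s) (\<beta> t) \<le> Gm t - Gm s + e" by simp
  qed
  show ?thesis using AE1 AE3 m_h
  proof eventually_elim
    case (elim t)
    show ?case
    proof
      assume t: "t \<in> {a<..<b}"
      let ?q = "\<lambda>s. mdist Y (\<beta> s) (\<beta> t) / \<bar>s - t\<bar>"
      have "(?q \<longlongrightarrow> m t) (at t)"
      proof (rule order_tendstoI)
        fix c assume c: "m t < c"
        have "((\<lambda>s. \<bar>Gm s - Gm t\<bar> / \<bar>s - t\<bar>) \<longlongrightarrow> \<bar>m t\<bar>) (at t)"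
          using elim t by (intro difference_quotient_abs_tendsto) auto
        then have "eventually (\<lambda>s. \<bar>Gm s - Gm t\<bar> / \<bar>s - t\<bar> < c) (at t)"
          using c m_pos by (intro order_tendstoD) auto
        then show "eventually (\<lambda>s. ?q s < c) (at t)" using near[OF t]
        proof eventually_elim
          case (elim s)
          have "mdist Y (\<beta> s) (\<beta> t) \<le> \<bar>Gm s - Gm t\<bar>"
            using dist_le[of s t] dist_le[of t s] elim t by (cases "s \<le> t") (auto simp: commute)
          then have "?q s \<le> \<bar>Gm s - Gm t\<bar> / \<bar>s - t\<bar>" by (intro divide_right_mono) auto
          then show ?case using elim by simp
        qed
      next
        fix c assume c: "c < m t"
        obtain z where z: "z \<in> D" "c < min \<bar>I t * h z t\<bar> \<bar>I t * g t\<bar>"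
          using c less_cSUP_iff[OF D0 bdd[of t]] unfolding m_def by blast
        then have "c < \<bar>h z t\<bar>" using t by (auto simp: I_def)
        moreover have "((\<lambda>s. \<bar>\<phi> z s - \<phi> z t\<bar> / \<bar>s - t\<bar>) \<longlongrightarrow> \<bar>h z t\<bar>) (at t)"
          using elim t z by (intro difference_quotient_abs_tendsto) auto
        ultimately have "eventually (\<lambda>s. c < \<bar>\<phi> z s - \<phi> z t\<bar> / \<bar>s - t\<bar>) (at t)"
          by (intro order_tendstoD) auto
        then show "eventually (\<lambda>s. c < ?q s) (at t)" using near[OF t]
        proof eventually_elim
          case (elim s)
          have "\<bar>\<phi> z s - \<phi> z t\<bar> \<le> mdist Y (\<beta> s) (\<beta> t)"
            using phi_le[OF z(1), of t s] elim t by (auto simp: commute)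
          then have "\<bar>\<phi> z s - \<phi> z t\<bar> / \<bar>s - t\<bar> \<le> ?q s" by (intro divide_right_mono) auto
          then show ?case using elim by simp
        qed
      qed
      moreover from this have "metric_deriv Y \<beta> t = m t"
        unfolding metric_deriv_def by (intro tendsto_Lim) auto
      ultimately show "(?q \<longlongrightarrow> metric_deriv Y \<beta> t) (at t)" by simp
    qed
  qed
qed

section \<open>Lengths of causal curves are bounded by potentials\<close>

lemma mspace_cone_metric [simp]: "mspace (cone_metric J Y) = J \<times> mspace Y"
  and mdist_cone_metric [simp]: "mdist (cone_metric J Y) (t, y) (t', y') = \<bar>t - t'\<bar> + mdist Y y y'"
  using Metric_space.mspace_metric[OF Metric_space_cone[of J Y]]
    Metric_space.mdist_metric[OF Metric_space_cone[of J Y]] by (auto simp: cone_metric_def)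

text \<open>A calibration argument: wherever the derivatives exist, that of \<open>P\<close>
  dominates the integrand of the length. The Lipschitz condition makes \<open>P\<close> absolutely
  continuous along the curve, so its derivative integrates to \<open>P b - P a\<close>. The last
  hypothesis already supplies the derivatives, so that applications reduce to a pointwise
  inequality.\<close>

lemma cone_length_le_potential:
  assumes c: "fd_causal J f Y x x' a b \<alpha> \<beta>" and f0: "\<And>t. t \<in> J \<Longrightarrow> 0 < f t"
    and D: "countable D" "D \<subseteq> mspace Y" "\<And>x e. x \<in> mspace Y \<Longrightarrow> 0 < e \<Longrightarrow> \<exists>z\<in>D. mdist Y x z < e"
    and \<kappa>: "\<kappa> > 0" "\<And>s t. a \<le> s \<Longrightarrow> s \<le> t \<Longrightarrow> t \<le> b \<Longrightarrow>
       \<bar>P t - P s\<bar> \<le> \<kappa> * (\<bar>\<alpha> s - \<alpha> t\<bar> + mdist Y (\<beta> s) (\<beta> t))"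
    and P: "\<And>u \<alpha>' P' v. u \<in> {a<..<b} \<Longrightarrow> (\<alpha> has_real_derivative \<alpha>') (at u) \<Longrightarrow>
       (P has_real_derivative P') (at u) \<Longrightarrow>
       ((\<lambda>s. mdist Y (\<beta> s) (\<beta> u) / \<bar>s - u\<bar>) \<longlongrightarrow> v) (at u) \<Longrightarrow> 0 \<le> \<alpha>' \<Longrightarrow> 0 \<le> v \<Longrightarrow>
       f (\<alpha> u) * v \<le> \<alpha>' \<Longrightarrow> sqrt (\<alpha>'\<^sup>2 - (f (\<alpha> u))\<^sup>2 * v\<^sup>2) \<le> P'"
  shows "cone_length f Y a b \<alpha> \<beta> \<le> ennreal (P b - P a)"
proof -
  interpret Metric_space "mspace Y" "mdist Y" by simp
  have fc: "fd_curve J Y x x' a b \<alpha> \<beta>"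
    and norm: "AE t in lborel. t \<in> {a<..<b} \<longrightarrow> cone_norm_sq f Y \<alpha> \<beta> t \<le> 0"
    using c by (auto simp: fd_causal_def)
  then have ab: "a < b" and mono: "strict_mono_on {a..b} \<alpha>" 
    and ac: "ac_curve (cone_metric J Y) a b (\<lambda>t. (\<alpha> t, \<beta> t))" by (auto simp: fd_curve_def)
  obtain g where g: "set_integrable lborel {a..b} g"
    "\<And>s t. a \<le> s \<Longrightarrow> s \<le> t \<Longrightarrow> t \<le> b \<Longrightarrow> \<bar>\<alpha> s - \<alpha> t\<bar> + mdist Y (\<beta> s) (\<beta> t) \<le> (LINT u:{s..t}|lborel. g u)"
    using ac unfolding ac_curve_def by auto
  have mem: "\<alpha> t \<in> J" "\<beta> t \<in> mspace Y" if "a \<le> t" "t \<le> b" for t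
    using ac that by (auto simp: ac_curve_def Pi_iff)
  have AEm: "AE t in lborel. t \<in> {a<..<b} \<longrightarrow>
    ((\<lambda>s. mdist Y (\<beta> s) (\<beta> t) / \<bar>s - t\<bar>) \<longlongrightarrow> metric_deriv Y \<beta> t) (at t)"
  proof (rule ac_curve_metric_derivative[OF ab _ g(1) _ D])
    fix s t assume "a \<le> s" "s \<le> t" "t \<le> b"
    then show "mdist Y (\<beta> s) (\<beta> t) \<le> (LINT u:{s..t}|lborel. g u)" using g(2)[of s t] by linarith
  qed (use mem in auto)
  obtain h\<alpha> where ha: "set_integrable lborel {a..b} h\<alpha>"
    "\<And>s t. a \<le> s \<Longrightarrow> s \<le> t \<Longrightarrow> t \<le> b \<Longrightarrow> \<alpha> t - \<alpha> s = (LINT u:{s..t}|lborel. h\<alpha> u)"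
  proof (rule dominated_increments_density[of a b g \<alpha>])
    fix s t assume "a \<le> s" "s \<le> t" "t \<le> b"
    then show "\<bar>\<alpha> t - \<alpha> s\<bar> \<le> (LINT u:{s..t}|lborel. g u)"
      using g(2)[of s t] nonneg[of "\<beta> s" "\<beta> t"] by linarith
  qed (use ab g in auto)
  obtain hP where hP: "set_integrable lborel {a..b} hP"
    "\<And>s t. a \<le> s \<Longrightarrow> s \<le> t \<Longrightarrow> t \<le> b \<Longrightarrow> P t - P s = (LINT u:{s..t}|lborel. hP u)"
  proof (rule dominated_increments_density[of a b "\<lambda>u. \<kappa> * g u" P])
    fix s t assume st: "a \<le> s" "s \<le> t" "t \<le> b"
    have "\<bar>P t - P s\<bar> \<le> \<kappa> * (\<bar>\<alpha> s - \<alpha> t\<bar> + mdist Y (\<beta> s) (\<beta> t))" using \<kappa>(2) st by auto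
    also have "\<dots> \<le> \<kappa> * (LINT u:{s..t}|lborel. g u)" using \<kappa>(1) g(2)[OF st] by (intro mult_left_mono) auto
    finally show "\<bar>P t - P s\<bar> \<le> (LINT u:{s..t}|lborel. \<kappa> * g u)" by simp
  qed (use ab g in auto)
  have AEa: "AE t in lborel. t \<in> {a<..<b} \<longrightarrow> (\<alpha> has_real_derivative h\<alpha> t) (at t)"
    by (rule lebesgue_differentiation_interval[OF ha])
  have AEP: "AE t in lborel. t \<in> {a<..<b} \<longrightarrow> (P has_real_derivative hP t) (at t)"
    by (rule lebesgue_differentiation_interval[OF hP])
  have bound: "AE t in lborel. t \<in> {a<..<b} \<longrightarrow> 0 \<le> hP t \<and> sqrt (- cone_norm_sq f Y \<alpha> \<beta> t) \<le> hP t"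
    using AEm AEa AEP norm
  proof eventually_elim
    case (elim t)
    show ?case
    proof
      assume t: "t \<in> {a<..<b}"
      have near: "eventually (\<lambda>s. s \<in> {a<..<b}) (at t)"
        using t by (intro eventually_at_in_open') auto
      let ?v = "metric_deriv Y \<beta> t"
      have v: "((\<lambda>s. mdist Y (\<beta> s) (\<beta> t) / \<bar>s - t\<bar>) \<longlongrightarrow> ?v) (at t)" using elim t by auto
      have v0: "0 \<le> ?v"
        by (rule tendsto_lowerbound[OF v]) (auto intro!: always_eventually divide_nonneg_nonneg)
      have da: "(\<alpha> has_real_derivative h\<alpha> t) (at t)" using elim t by auto
      have "((\<lambda>s. (\<alpha> s - \<alpha> t) / (s - t)) \<longlongrightarrow> h\<alpha> t) (at t)"
        using da by (simp add: has_field_derivative_iff)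
      moreover have "eventually (\<lambda>s. 0 \<le> (\<alpha> s - \<alpha> t) / (s - t)) (at t)"
        using near
      proof eventually_elim
        case (elim s)
        then show ?case using strict_mono_onD[OF mono, of s t] strict_mono_onD[OF mono, of t s] t
          by (cases s t rule: linorder_cases) (auto intro: divide_nonneg_nonneg divide_nonpos_nonpos)
      qed
      ultimately have a0: "0 \<le> h\<alpha> t" by (rule tendsto_lowerbound) auto
      have nsq: "cone_norm_sq f Y \<alpha> \<beta> t = - (h\<alpha> t)\<^sup>2 + (f (\<alpha> t))\<^sup>2 * ?v\<^sup>2"
        using DERIV_imp_deriv[OF da] by (simp add: cone_norm_sq_def)
      have ft: "0 < f (\<alpha> t)" using f0 mem t by auto
      have "(f (\<alpha> t) * ?v)\<^sup>2 \<le> (h\<alpha> t)\<^sup>2" using elim t nsq by (simp add: power_mult_distrib)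
      then have fv: "f (\<alpha> t) * ?v \<le> h\<alpha> t" using a0 by (rule power2_le_imp_le)
      have "sqrt ((h\<alpha> t)\<^sup>2 - (f (\<alpha> t))\<^sup>2 * ?v\<^sup>2) \<le> hP t"
        using elim t by (intro P[OF t da _ v a0 v0 fv]) auto
      moreover from _ this have "0 \<le> hP t"
        by (rule order_trans) (use elim t nsq in auto)
      ultimately show "0 \<le> hP t \<and> sqrt (- cone_norm_sq f Y \<alpha> \<beta> t) \<le> hP t" by (simp add: nsq)
    qed
  qed
  let ?h = "\<lambda>t. indicator {a..b} t * hP t"
  have hm [measurable]: "?h \<in> borel_measurable borel" and hi: "integrable lborel ?h"
    using hP(1) by (auto simp: set_integrable_def)
  have AEab: "AE t in lborel. t \<noteq> a \<and> t \<noteq> b"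
    using AE_lborel_singleton[of a] AE_lborel_singleton[of b] by eventually_elim auto
  have hpos: "AE t in lborel. 0 \<le> ?h t"
    using bound AEab by eventually_elim (auto simp: indicator_def)
  have "cone_length f Y a b \<alpha> \<beta> =
     (\<integral>\<^sup>+ t. ennreal (sqrt (- cone_norm_sq f Y \<alpha> \<beta> t)) * indicator {a<..<b} t \<partial>lebesgue)"
    unfolding cone_length_def by (subst nn_integral_restrict_space) auto
  also have "\<dots> \<le> (\<integral>\<^sup>+ t. ennreal (?h t) \<partial>lebesgue)"
  proof (rule nn_integral_mono_AE)
    have "AE t in lborel. ennreal (sqrt (- cone_norm_sq f Y \<alpha> \<beta> t)) * indicator {a<..<b} t \<le> ennreal (?h t)"
      using bound by eventually_elim (auto simp: indicator_def intro!: ennreal_leI)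
    then show "AE t in lebesgue. ennreal (sqrt (- cone_norm_sq f Y \<alpha> \<beta> t)) * indicator {a<..<b} t \<le> ennreal (?h t)"
      by (simp only: AE_completion_iff)
  qed
  also have "\<dots> = (\<integral>\<^sup>+ t. ennreal (?h t) \<partial>lborel)"
    by (rule nn_integral_completion) 
  also have "\<dots> = ennreal (LINT t|lborel. ?h t)"
    by (rule nn_integral_eq_integral[OF hi hpos])
  also have "(LINT t|lborel. ?h t) = P b - P a"
    using hP(2)[of a b] ab by (simp add: set_lebesgue_integral_def)
  finally show ?thesis .
qed

section \<open>Causality of generalized cones\<close>

text \<open>Only the existence of a minimising path between two points matters, so the path is
  quantified away. In contrast to \<open>geo\<close>, its values outside \<open>{0..1}\<close> are
  arbitrary.\<close>

definition geodesic :: "'y metric \<Rightarrow> 'y \<Rightarrow> 'y \<Rightarrow> bool" where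
  "geodesic Y x y \<longleftrightarrow> (\<exists>\<gamma>. \<gamma> 0 = x \<and> \<gamma> 1 = y \<and> (\<forall>s\<in>{0..1::real}. \<gamma> s \<in> mspace Y) \<and>
     (\<forall>s\<in>{0..1}. \<forall>t\<in>{0..1}. mdist Y (\<gamma> s) (\<gamma> t) = \<bar>s - t\<bar> * mdist Y x y))"

lemma geodesic_sym: assumes g: "geodesic Y x y" shows "geodesic Y y x"
proof -
  obtain \<gamma> where \<gamma>: "\<gamma> 0 = x" "\<gamma> 1 = y" "\<And>s. s \<in> {0..1::real} \<Longrightarrow> \<gamma> s \<in> mspace Y"
     "\<And>s t. s \<in> {0..1} \<Longrightarrow> t \<in> {0..1} \<Longrightarrow> mdist Y (\<gamma> s) (\<gamma> t) = \<bar>s - t\<bar> * mdist Y x y"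
    using g unfolding geodesic_def by blast
  have "mdist Y x y = mdist Y y x" by (simp add: mdist_commute)
  then show ?thesis unfolding geodesic_def using \<gamma>
    by (intro exI[of _ "\<lambda>s. \<gamma> (1 - s)"]) (auto simp: abs_minus_commute)
qed

lemma geodesic_mspace: "geodesic Y x y \<Longrightarrow> x \<in> mspace Y \<and> y \<in> mspace Y"
  unfolding geodesic_def by force

text \<open>\<open>H\<close> is a conformal time on the window.\<close>

locale cone_window =
  fixes J :: "real set" and f :: "real \<Rightarrow> real" and Y :: "'y metric" and X :: "(real \<times> 'y) lspace"
    and A B M R :: real and H :: "real \<Rightarrow> real"
  assumes X_cone: "X = cone J f Y" and lpls: "lorentzian_pre_length_space X"
    and window: "{A<..<B} \<subseteq> J" and f_cont: "continuous_on J f" and f_pos: "\<And>t. t \<in> J \<Longrightarrow> 0 < f t"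
    and f_le: "\<And>t. A < t \<Longrightarrow> t < B \<Longrightarrow> f t \<le> M" and M_pos: "0 < M"
    and H_deriv: "\<And>t. A < t \<Longrightarrow> t < B \<Longrightarrow> (H has_real_derivative 1 / f t) (at t)"
    and separable: "\<exists>D. countable D \<and> D \<subseteq> mspace Y \<and> (\<forall>x\<in>mspace Y. \<forall>e>0. \<exists>z\<in>D. mdist Y x z < e)"
    and R_pos: "0 < R"
    and geodesics_dense: "\<And>y z e. y \<in> mspace Y \<Longrightarrow> z \<in> mspace Y \<Longrightarrow> mdist Y y z < R \<Longrightarrow> 0 < e \<Longrightarrow>
      \<exists>x. geodesic Y y x \<and> mdist Y z x < e"
begin

sublocale YM: Metric_space "mspace Y" "mdist Y" by simp

section \<open>Monotonicity and continuity of the conformal time\<close>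

lemma f_window_pos: "A < t \<Longrightarrow> t < B \<Longrightarrow> 0 < f t"
  using window f_pos by auto

text \<open>The bound \<open>f \<le> M\<close> gives \<open>H\<close> the slope \<open>1 / M\<close>
  at least. This converts between time and conformal time with a constant that depends on
  \<open>M\<close> alone.\<close>

lemma H_diff_ge: assumes "A < s" "s \<le> t" "t < B" shows "(t - s) / M \<le> H t - H s"
proof (cases "s = t")
  case False
  with assms have "s < t" by simp
  then obtain u where u: "s < u" "u < t" "H t - H s = (t - s) * (1 / f u)"
    using MVT2[of s t H "\<lambda>u. 1 / f u"] H_deriv assms by force
  have "1 / M \<le> 1 / f u" using f_window_pos[of u] f_le[of u] assms u by (intro divide_left_mono) auto
  then have "(t - s) * (1 / M) \<le> (t - s) * (1 / f u)" using \<open>s < t\<close> by (intro mult_left_mono) auto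
  then show ?thesis using u(3) by simp
qed simp

lemma H_less: assumes "A < s" "s < t" "t < B" shows "H s < H t"
  using H_diff_ge[of s t] assms M_pos divide_pos_pos[of "t - s" M] by linarith

lemma H_le: assumes "A < s" "s \<le> t" "t < B" shows "H s \<le> H t"
  using H_less[of s t] assms by (cases "s = t") auto

lemma H_less_iff: assumes "A < s" "s < B" "A < t" "t < B" shows "H s < H t \<longleftrightarrow> s < t"
  using H_less[of s t] H_le[of t s] assms by (cases "s < t") auto

lemma H_cont: "A < s \<Longrightarrow> t < B \<Longrightarrow> continuous_on {s..t} H"
  by (intro continuous_at_imp_continuous_on ballI DERIV_isCont[OF H_deriv]) auto

lemma H_ivt: assumes "A < s" "s \<le> t" "t < B" "H s \<le> c" "c \<le> H t"
  obtains u where "s \<le> u" "u \<le> t" "H u = c"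
  using IVT'[of H s c t] assms H_cont by auto

text \<open>The constant depends on the compact interval, since \<open>f\<close> may tend to 0 at
  the ends of the window. It only serves to obtain absolute continuity and enters no bound on the
  time separation.\<close>

lemma H_lipschitz: assumes "A < s" "s \<le> t" "t < B"
  obtains C where "C > 0" "\<And>u v. s \<le> u \<Longrightarrow> u \<le> t \<Longrightarrow> s \<le> v \<Longrightarrow> v \<le> t \<Longrightarrow> \<bar>H u - H v\<bar> \<le> C * \<bar>u - v\<bar>"
proof -
  have sub: "{s..t} \<subseteq> J" using window assms by auto
  have "compact ((\<lambda>u. 1 / f u) ` {s..t})"
    using sub f_pos continuous_on_subset[OF f_cont sub]
    by (intro compact_continuous_image continuous_intros) (auto, force)
  then obtain C where C: "\<And>u. s \<le> u \<Longrightarrow> u \<le> t \<Longrightarrow> 1 / f u \<le> C"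
    using compact_imp_bounded[THEN bounded_imp_bdd_above] unfolding bdd_above_def by (metis atLeastAtMost_iff imageI)
  have key: "\<bar>H v - H u\<bar> \<le> max 1 C * \<bar>v - u\<bar>" if uv: "s \<le> u" "u < v" "v \<le> t" for u v
  proof -
    obtain w where w: "u < w" "w < v" "H v - H u = (v - u) * (1 / f w)"
      using MVT2[of u v H "\<lambda>u. 1 / f u"] H_deriv assms uv by force
    have "1 / f w \<le> max 1 C" using C[of w] uv w by auto
    then have "(v - u) * (1 / f w) \<le> (v - u) * max 1 C" using uv by (intro mult_left_mono) auto
    moreover have "0 \<le> H v - H u" using H_le[of u v] uv assms by auto
    ultimately show ?thesis using uv w(3) by (simp add: mult.commute)
  qed
  show ?thesis
  proof
    fix u v assume "s \<le> u" "u \<le> t" "s \<le> v" "v \<le> t"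
    then show "\<bar>H u - H v\<bar> \<le> max 1 C * \<bar>u - v\<bar>"
      using key[of u v] key[of v u] by (cases u v rule: linorder_cases) (auto simp: abs_minus_commute)
  qed simp
qed

section \<open>Causal relations over geodesics of the base\<close>

lemma lcarrier_eq [simp]: "lcarrier X = J \<times> mspace Y"
  by (simp add: X_cone cone_def)

lemma caus_iff: "caus X p q \<longleftrightarrow> p = q \<or> (\<exists>a b \<alpha> \<beta>. fd_causal J f Y p q a b \<alpha> \<beta>)"
  and chron_iff: "chron X p q \<longleftrightarrow> (\<exists>a b \<alpha> \<beta>. fd_timelike J f Y p q a b \<alpha> \<beta>)"
  and tsep_eq: "tsep X p q = Sup {cone_length f Y a b \<alpha> \<beta> | a b \<alpha> \<beta>. fd_causal J f Y p q a b \<alpha> \<beta>}"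
  by (simp_all add: X_cone cone_def)

lemma in_carrier: "A < t \<Longrightarrow> t < B \<Longrightarrow> y \<in> mspace Y \<Longrightarrow> (t, y) \<in> lcarrier X"
  using window by auto

text \<open>If a geodesic of the base is run through in proportion to conformal time, then
  \<open>f\<close> times its speed is constantly \<open>mdist Y x y / (H t - H s)\<close>, because
  \<open>H\<close> has derivative \<open>1 / f\<close>. The causal character of the curve is that of
  this one ratio.\<close>

lemma geodesic_curve:
  assumes st: "A < s" "s < t" "t < B" and geo: "geodesic Y x y" and d: "mdist Y x y \<le> H t - H s"
  obtains \<beta> where "fd_curve J Y (s, x) (t, y) s t (\<lambda>u. u) \<beta>"
    "\<And>u. s < u \<Longrightarrow> u < t \<Longrightarrow> cone_norm_sq f Y (\<lambda>u. u) \<beta> u = (mdist Y x y / (H t - H s))\<^sup>2 - 1"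
proof -
  obtain \<gamma> where \<gamma>: "\<gamma> 0 = x" "\<gamma> 1 = y" "\<And>s. s \<in> {0..1::real} \<Longrightarrow> \<gamma> s \<in> mspace Y"
     "\<And>s t. s \<in> {0..1} \<Longrightarrow> t \<in> {0..1} \<Longrightarrow> mdist Y (\<gamma> s) (\<gamma> t) = \<bar>s - t\<bar> * mdist Y x y"
    using geo unfolding geodesic_def by blast
  define h where "h = H t - H s"
  have h: "h > 0" using H_less st by (simp add: h_def)
  define r where "r u = (H u - H s) / h" for u
  have r: "r u \<in> {0..1}" if "s \<le> u" "u \<le> t" for u
    using H_le[of s u] H_le[of u t] that st h by (auto simp: r_def h_def)
  define \<beta> where "\<beta> u = \<gamma> (r u)" for u
  have dist: "mdist Y (\<beta> u) (\<beta> v) = \<bar>H u - H v\<bar> * (mdist Y x y / h)" if "s \<le> u" "u \<le> t" "s \<le> v" "v \<le> t" for u v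
  proof -
    have "\<bar>r u - r v\<bar> = \<bar>H u - H v\<bar> / h" using h
      by (simp add: r_def diff_divide_distrib[symmetric] abs_divide)
    then show ?thesis using \<gamma>(4)[OF r r] that by (simp add: \<beta>_def)
  qed
  have dh: "mdist Y x y / h \<le> 1" using d h by (simp add: h_def)
  obtain C where C: "C > 0" "\<And>u v. s \<le> u \<Longrightarrow> u \<le> t \<Longrightarrow> s \<le> v \<Longrightarrow> v \<le> t \<Longrightarrow> \<bar>H u - H v\<bar> \<le> C * \<bar>u - v\<bar>"
    using H_lipschitz[of s t] st by auto
  have "ac_curve (cone_metric J Y) s t (\<lambda>t. (t, \<beta> t))"
    unfolding ac_curve_def
  proof (intro conjI exI[of _ "\<lambda>_. 1 + C"] allI impI)
    show "(\<lambda>t. (t, \<beta> t)) \<in> {s..t} \<rightarrow> mspace (cone_metric J Y)"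
      using window st r by (auto simp: \<beta>_def intro!: \<gamma>(3))
    show "set_integrable lborel {s..t} (\<lambda>_. 1 + C)"
      unfolding set_integrable_def
      by (intro integrable_scaleR_left integrable_real_indicator) (auto simp: emeasure_lborel_Icc_eq)
    fix u v assume uv: "s \<le> u \<and> u \<le> v \<and> v \<le> t"
    have "mdist Y (\<beta> u) (\<beta> v) \<le> \<bar>H u - H v\<bar> * 1"
      unfolding dist[OF uv[THEN conjunct1] order_trans[OF uv[THEN conjunct2, THEN conjunct1] uv[THEN conjunct2, THEN conjunct2]]
        order_trans[OF uv[THEN conjunct1] uv[THEN conjunct2, THEN conjunct1]] uv[THEN conjunct2, THEN conjunct2]]
      by (intro mult_left_mono dh) auto
    also have "\<dots> \<le> C * (v - u)" using C(2)[of u v] uv by auto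
    finally have "mdist Y (\<beta> u) (\<beta> v) \<le> C * (v - u)" .
    moreover have "(LINT u:{u..v}|lborel. 1 + C) = (v - u) + C * (v - u)"
      using uv by (subst set_integral_const) (auto simp: algebra_simps)
    ultimately show "mdist (cone_metric J Y) (u, \<beta> u) (v, \<beta> v) \<le> (LINT u:{u..v}|lborel. 1 + C)"
      using uv by simp
  qed
  moreover have "r s = 0" "r t = 1" using h by (auto simp: r_def h_def)
  ultimately have fd: "fd_curve J Y (s, x) (t, y) s t (\<lambda>u. u) \<beta>"
    using st \<gamma>(1,2) by (auto simp: fd_curve_def \<beta>_def strict_mono_on_def)
  have norm: "cone_norm_sq f Y (\<lambda>u. u) \<beta> u = (mdist Y x y / (H t - H s))\<^sup>2 - 1" if u: "s < u" "u < t" for u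
  proof -
    have fu: "f u > 0" using f_window_pos[of u] u st by auto
    have "((\<lambda>w. \<bar>H w - H u\<bar> / \<bar>w - u\<bar>) \<longlongrightarrow> \<bar>1 / f u\<bar>) (at u)"
      using u st by (intro difference_quotient_abs_tendsto H_deriv) auto
    then have "((\<lambda>w. \<bar>H w - H u\<bar> / \<bar>w - u\<bar> * (mdist Y x y / h)) \<longlongrightarrow> \<bar>1 / f u\<bar> * (mdist Y x y / h)) (at u)"
      by (intro tendsto_intros)
    moreover have "eventually (\<lambda>w. \<bar>H w - H u\<bar> / \<bar>w - u\<bar> * (mdist Y x y / h) = mdist Y (\<beta> w) (\<beta> u) / \<bar>w - u\<bar>) (at u)"
    proof -
      have "eventually (\<lambda>w. w \<in> {s<..<t}) (at u)" using u by (intro eventually_at_in_open') auto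
      then show ?thesis by eventually_elim (use dist u in auto)
    qed
    ultimately have "((\<lambda>w. mdist Y (\<beta> w) (\<beta> u) / \<bar>w - u\<bar>) \<longlongrightarrow> \<bar>1 / f u\<bar> * (mdist Y x y / h)) (at u)"
      by (rule Lim_transform_eventually)
    then have "metric_deriv Y \<beta> u = \<bar>1 / f u\<bar> * (mdist Y x y / h)"
      unfolding metric_deriv_def by (intro tendsto_Lim) auto
    then have "f u * metric_deriv Y \<beta> u = mdist Y x y / h" using fu by simp
    then show ?thesis by (simp add: cone_norm_sq_def h_def power_mult_distrib[symmetric])
  qed
  show ?thesis by (rule that[OF fd norm])
qed

lemma caus_geodesic:
  assumes st: "A < s" "s < t" "t < B" and geo: "geodesic Y x y" and d: "mdist Y x y \<le> H t - H s"
  shows "caus X (s, x) (t, y)"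
proof -
  obtain \<beta> where \<beta>: "fd_curve J Y (s, x) (t, y) s t (\<lambda>u. u) \<beta>"
    "\<And>u. s < u \<Longrightarrow> u < t \<Longrightarrow> cone_norm_sq f Y (\<lambda>u. u) \<beta> u = (mdist Y x y / (H t - H s))\<^sup>2 - 1"
    using geodesic_curve[OF assms] by blast
  have "(mdist Y x y / (H t - H s))\<^sup>2 \<le> 1"
    using d H_less[of s t] st by (intro power_le_one) auto
  then have "fd_causal J f Y (s, x) (t, y) s t (\<lambda>u. u) \<beta>"
    using \<beta> by (auto simp: fd_causal_def)
  then show ?thesis unfolding caus_iff by blast
qed

lemma chron_geodesic:
  assumes st: "A < s" "s < t" "t < B" and geo: "geodesic Y x y" and d: "mdist Y x y < H t - H s"
  shows "chron X (s, x) (t, y)"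
proof -
  obtain \<beta> where \<beta>: "fd_curve J Y (s, x) (t, y) s t (\<lambda>u. u) \<beta>"
    "\<And>u. s < u \<Longrightarrow> u < t \<Longrightarrow> cone_norm_sq f Y (\<lambda>u. u) \<beta> u = (mdist Y x y / (H t - H s))\<^sup>2 - 1"
    using geodesic_curve[OF st geo less_imp_le[OF d]] by blast
  have "(mdist Y x y / (H t - H s))\<^sup>2 < 1"
    using d H_less[of s t] st by (subst power_less_one_iff) auto
  then have "fd_timelike J f Y (s, x) (t, y) s t (\<lambda>u. u) \<beta>"
    using \<beta> by (auto simp: fd_timelike_def)
  then show ?thesis unfolding chron_iff by blast
qed

lemma caus_refl: "p \<in> lcarrier X \<Longrightarrow> caus X p p"
  by (auto simp: caus_iff)

lemma caus_trans: "p \<in> lcarrier X \<Longrightarrow> q \<in> lcarrier X \<Longrightarrow> r \<in> lcarrier X \<Longrightarrow> caus X p q \<Longrightarrow> caus X q r \<Longrightarrow> caus X p r"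
  using lpls unfolding lorentzian_pre_length_space_def by blast

text \<open>\<open>chron\<close> holds exactly where \<open>tsep\<close> is positive, which is an
  open condition by lower semicontinuity. Only the base point is moved here.\<close>

lemma past_open:
  assumes "chron X (s, x) q" "(s, x) \<in> lcarrier X" "q \<in> lcarrier X"
  obtains e where "e > 0" "\<And>x'. x' \<in> mspace Y \<Longrightarrow> mdist Y x x' < e \<Longrightarrow> chron X (s, x') q"
proof -
  interpret XM: Metric_space "lcarrier X" "mdist (lmetric X)" by (rule Metric_space_mspace_mdist)
  have lm: "lmetric X = cone_metric J Y" by (simp add: X_cone cone_def)
  have top: "mtopology_of (lmetric X) = XM.mtopology" by (simp add: mtopology_of_def)
  define S where "S = {(p, q) \<in> lcarrier X \<times> lcarrier X. 0 < tsep X p q}"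
  have oS: "openin (prod_topology XM.mtopology XM.mtopology) S"
    using lpls unfolding lorentzian_pre_length_space_def top S_def by blast
  have mS: "((s, x), q) \<in> S"
    using lpls assms unfolding lorentzian_pre_length_space_def S_def by blast
  obtain U V where UV: "openin XM.mtopology U" "(s, x) \<in> U" "q \<in> V" "U \<times> V \<subseteq> S"
    using oS[unfolded openin_prod_topology_alt, rule_format, OF mS] by metis
  obtain e where e: "e > 0" "XM.mball (s, x) e \<subseteq> U"
    using UV(1,2) unfolding XM.openin_mtopology by blast
  show ?thesis
  proof
    fix x' assume x': "x' \<in> mspace Y" "mdist Y x x' < e"
    then have "(s, x') \<in> XM.mball (s, x) e"
      using assms(2) unfolding XM.in_mball by (simp add: lm)
    then have "((s, x'), q) \<in> U \<times> V" using e UV by auto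
    then have "0 < tsep X (s, x') q" "(s, x') \<in> lcarrier X" "q \<in> lcarrier X" using UV(4) by (auto simp: S_def)
    then show "chron X (s, x') q" using lpls unfolding lorentzian_pre_length_space_def by blast
  qed fact
qed

text \<open>A point with a geodesic to \<open>y\<close> need not have one to \<open>z\<close>, but both kinds of points are dense,
  and openness of the chronological past allows to pass from one to the other.\<close>

lemma caus_of_mdist_less:
  assumes st: "A < s" "s < t" "t < B" and yz: "y \<in> mspace Y" "z \<in> mspace Y"
    and d: "mdist Y y z < H t - H s" "mdist Y y z < R"
  shows "caus X (s, y) (t, z)"
proof -
  \<comment> \<open>\<open>\<kappa>\<close> is the room left in both strict inequalities. One half
    is spent on the conformal time of the last leg and two quarters on moving the intermediate point
    from \<open>z\<close> to \<open>x\<close> and on to \<open>x'\<close>.\<close>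
  define \<kappa> where "\<kappa> = min (H t - H s - mdist Y y z) (R - mdist Y y z)"
  have \<kappa>: "\<kappa> > 0" "\<kappa> \<le> H t - H s - mdist Y y z" "\<kappa> \<le> R - mdist Y y z" using d by (auto simp: \<kappa>_def)
  have d0: "0 \<le> mdist Y y z" by simp
  obtain u where u: "s \<le> u" "u \<le> t" "H u = H t - \<kappa>/2"
    using H_ivt[of s t "H t - \<kappa>/2"] st \<kappa> d0 by auto
  have "s \<noteq> u"
  proof
    assume "s = u"
    then have "H s = H u" by simp
    then show False using u(3) \<kappa> d0 by linarith
  qed
  then have u': "s < u" "u < t" using u \<kappa> by (auto simp: less_le)
  obtain x where x: "geodesic Y z x" "mdist Y z x < \<kappa>/4"
    using geodesics_dense[of z z "\<kappa>/4"] yz \<kappa> R_pos by auto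
  have xm: "x \<in> mspace Y" using geodesic_mspace[OF x(1)] by simp
  have uB: "A < u" "u < B" using u' st by auto
  have ch: "chron X (u, x) (t, z)"
    using x u \<kappa> uB u' st YM.commute[of x z] by (intro chron_geodesic[OF _ _ _ geodesic_sym[OF x(1)]]) auto
  have car: "(u, x) \<in> lcarrier X" "(t, z) \<in> lcarrier X" "(s, y) \<in> lcarrier X"
    using in_carrier[OF uB xm] in_carrier[of t z] in_carrier[of s y] st yz by auto
  obtain e where e: "e > 0" "\<And>x'. x' \<in> mspace Y \<Longrightarrow> mdist Y x x' < e \<Longrightarrow> chron X (u, x') (t, z)"
    using past_open[OF ch car(1,2)] by blast
  have yx: "mdist Y y x < mdist Y y z + \<kappa>/4" using YM.triangle[of y z x] yz xm x by auto
  then obtain x' where x': "geodesic Y y x'" "mdist Y x x' < min e (\<kappa>/4)"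
    using geodesics_dense[of y x "min e (\<kappa>/4)"] yz xm \<kappa> e by auto
  have x'm: "x' \<in> mspace Y" using geodesic_mspace[OF x'(1)] by simp
  have "mdist Y y x' \<le> H u - H s" using YM.triangle[of y x x'] yz xm x'm x' yx u \<kappa> by auto
  then have "caus X (s, y) (u, x')"
    using x' u' st by (intro caus_geodesic) auto
  moreover have "(u, x') \<in> lcarrier X" using in_carrier[OF uB x'm] .
  moreover have "caus X (u, x') (t, z)"
    using e(2)[OF x'm] x' lpls car \<open>(u, x') \<in> lcarrier X\<close> unfolding lorentzian_pre_length_space_def by auto
  ultimately show ?thesis using car caus_trans by blast
qed

section \<open>Upper bounds for the time separation\<close>

lemma tsep_le_potential:
  assumes le: "\<And>a b \<alpha> \<beta>. fd_causal J f Y (s, x) (t, y) a b \<alpha> \<beta> \<Longrightarrow> a < b \<Longrightarrow>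
      (\<And>u. a \<le> u \<Longrightarrow> u \<le> b \<Longrightarrow> s \<le> \<alpha> u \<and> \<alpha> u \<le> t \<and> \<beta> u \<in> mspace Y) \<Longrightarrow>
      \<alpha> a = s \<Longrightarrow> \<alpha> b = t \<Longrightarrow> \<beta> a = x \<Longrightarrow> \<beta> b = y \<Longrightarrow> s < t \<Longrightarrow>
      cone_length f Y a b \<alpha> \<beta> \<le> c"
  shows "tsep X (s, x) (t, y) \<le> c"
  unfolding tsep_eq
proof (rule Sup_least)
  fix L assume "L \<in> {cone_length f Y a b \<alpha> \<beta> | a b \<alpha> \<beta>. fd_causal J f Y (s, x) (t, y) a b \<alpha> \<beta>}"
  then obtain a b \<alpha> \<beta> where L: "L = cone_length f Y a b \<alpha> \<beta>" and c: "fd_causal J f Y (s, x) (t, y) a b \<alpha> \<beta>"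
    by auto
  then have fc: "a < b" "strict_mono_on {a..b} \<alpha>" "\<alpha> a = s" "\<alpha> b = t" "\<beta> a = x" "\<beta> b = y"
    "ac_curve (cone_metric J Y) a b (\<lambda>t. (\<alpha> t, \<beta> t))"
    by (auto simp: fd_causal_def fd_curve_def)
  show "L \<le> c" unfolding L
  proof (rule le[OF c fc(1)])
    fix u assume u: "a \<le> u" "u \<le> b"
    have "s \<le> \<alpha> u" "\<alpha> u \<le> t"
      using strict_mono_onD[OF fc(2), of a u] strict_mono_onD[OF fc(2), of u b] fc u
      by (cases "a = u"; cases "u = b"; auto)+
    moreover have "\<beta> u \<in> mspace Y" using fc(7) u by (auto simp: ac_curve_def Pi_iff)
    ultimately show "s \<le> \<alpha> u \<and> \<alpha> u \<le> t \<and> \<beta> u \<in> mspace Y" by simp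
  next
    show "s < t" using strict_mono_onD[OF fc(2), of a b] fc by auto
  qed fact+
qed

text \<open>The time coordinate is itself a potential, as the integrand is at most its
  derivative.\<close>

lemma tsep_le_time: "tsep X (s, x) (t, y) \<le> ennreal (t - s)"
proof (rule tsep_le_potential)
  fix a b \<alpha> \<beta> assume c: "fd_causal J f Y (s, x) (t, y) a b \<alpha> \<beta>" and ab: "\<alpha> a = s" "\<alpha> b = t"
  obtain D where D: "countable D" "D \<subseteq> mspace Y" "\<And>x e. x \<in> mspace Y \<Longrightarrow> 0 < e \<Longrightarrow> \<exists>z\<in>D. mdist Y x z < e"
    using separable by auto
  have "cone_length f Y a b \<alpha> \<beta> \<le> ennreal (\<alpha> b - \<alpha> a)"
  proof (rule cone_length_le_potential[OF c f_pos D, where \<kappa>=1])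
    fix u \<alpha>' P' v assume "(\<alpha> has_real_derivative \<alpha>') (at u)" "(\<alpha> has_real_derivative P') (at u)"
      and a0: "0 \<le> \<alpha>'"
    then have "P' = \<alpha>'" by (blast intro: DERIV_unique)
    moreover have "sqrt (\<alpha>'\<^sup>2 - (f (\<alpha> u))\<^sup>2 * v\<^sup>2) \<le> sqrt (\<alpha>'\<^sup>2)" by (intro real_sqrt_le_mono) auto
    ultimately show "sqrt (\<alpha>'\<^sup>2 - (f (\<alpha> u))\<^sup>2 * v\<^sup>2) \<le> P'" using a0 by simp
  qed (auto simp: abs_minus_commute)
  then show "cone_length f Y a b \<alpha> \<beta> \<le> ennreal (t - s)" using ab by simp
qed

text \<open>The integrand of the length is the geometric mean of \<open>\<alpha>' - f v\<close> and \<open>\<alpha>' + f v\<close>.  An arithmetic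
  mean weighted with a large \<open>\<mu>\<close> charges mostly the first factor, whose integral is at most
  \<open>M (H t - H s - d(x, y))\<close>.\<close>

lemma tsep_le_slack:
  assumes st: "A < s" "t < B" and \<mu>: "\<mu> > 0" and y: "y \<in> mspace Y"
  shows "tsep X (s, x) (t, y) \<le> ennreal (\<mu> * M / 2 * (H t - H s - mdist Y x y) + (t - s) / \<mu>)"
proof (rule tsep_le_potential)
  fix a b \<alpha> \<beta> assume c: "fd_causal J f Y (s, x) (t, y) a b \<alpha> \<beta>" and ab: "a < b"
    and mem: "\<And>u. a \<le> u \<Longrightarrow> u \<le> b \<Longrightarrow> s \<le> \<alpha> u \<and> \<alpha> u \<le> t \<and> \<beta> u \<in> mspace Y"
    and ends: "\<alpha> a = s" "\<alpha> b = t" "\<beta> a = x" "\<beta> b = y" and "s < t"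
  have x: "x \<in> mspace Y" using mem[of a] ends ab by auto
  obtain D where D: "countable D" "D \<subseteq> mspace Y" "\<And>x e. x \<in> mspace Y \<Longrightarrow> 0 < e \<Longrightarrow> \<exists>z\<in>D. mdist Y x z < e"
    using separable by auto
  obtain C where C: "C > 0" "\<And>u v. s \<le> u \<Longrightarrow> u \<le> t \<Longrightarrow> s \<le> v \<Longrightarrow> v \<le> t \<Longrightarrow> \<bar>H u - H v\<bar> \<le> C * \<bar>u - v\<bar>"
    using H_lipschitz[of s t] st \<open>s < t\<close> by auto
  \<comment> \<open>The distance from the start replaces the arc length of \<open>\<beta>\<close>:
    its slope is at most the speed, and its total increment is the distance in the claim.\<close>
  define \<phi> where "\<phi> u = mdist Y (\<beta> u) x" for u
  define P where "P u = \<mu> * M / 2 * (H (\<alpha> u) - \<phi> u) + \<alpha> u / \<mu>" for u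
  have lin: "(c * x + y / \<mu>) - (c * x' + y' / \<mu>) = c * (x - x') + 1 / \<mu> * (y - y')" for c x y x' y' :: real
    by (simp add: algebra_simps diff_divide_distrib)
  have phi_le: "\<bar>\<phi> u - \<phi> v\<bar> \<le> mdist Y (\<beta> u) (\<beta> v)" if "a \<le> u" "u \<le> b" "a \<le> v" "v \<le> b" for u v
    using mdist_triangle_diff[of "\<beta> u" Y "\<beta> v" x] mem that x by (auto simp: \<phi>_def)
  have "cone_length f Y a b \<alpha> \<beta> \<le> ennreal (P b - P a)"
  proof (rule cone_length_le_potential[OF c f_pos D, where \<kappa>="\<mu> * M / 2 * (C + 1) + 1 / \<mu>"])
    show "0 < \<mu> * M / 2 * (C + 1) + 1 / \<mu>" using \<mu> M_pos C by (intro add_pos_pos) auto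
    fix u v assume uv: "a \<le> u" "u \<le> v" "v \<le> b"
    let ?d = "\<bar>\<alpha> u - \<alpha> v\<bar> + mdist Y (\<beta> u) (\<beta> v)"
    have "\<bar>H (\<alpha> v) - H (\<alpha> u)\<bar> \<le> C * \<bar>\<alpha> u - \<alpha> v\<bar>"
      using C(2)[of "\<alpha> v" "\<alpha> u"] mem[of u] mem[of v] uv by (auto simp: abs_minus_commute)
    also have "\<dots> \<le> C * ?d" using C(1) by (intro mult_left_mono) auto
    finally have 1: "\<bar>H (\<alpha> v) - H (\<alpha> u)\<bar> \<le> C * ?d" .
    have 2: "\<bar>\<phi> v - \<phi> u\<bar> \<le> ?d" using phi_le[of u v] uv by (auto simp: abs_minus_commute)
    have "\<bar>(H (\<alpha> v) - \<phi> v) - (H (\<alpha> u) - \<phi> u)\<bar> \<le> (C + 1) * ?d"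
      unfolding distrib_right mult_1 using 1 2 by linarith
    then have 3: "\<mu> * M / 2 * \<bar>(H (\<alpha> v) - \<phi> v) - (H (\<alpha> u) - \<phi> u)\<bar> \<le> \<mu> * M / 2 * ((C + 1) * ?d)"
      using \<mu> M_pos by (intro mult_left_mono) auto
    have 4: "1 / \<mu> * \<bar>\<alpha> v - \<alpha> u\<bar> \<le> 1 / \<mu> * ?d" using \<mu> by (intro mult_left_mono) (auto simp: abs_minus_commute)
    have "P v - P u = \<mu> * M / 2 * ((H (\<alpha> v) - \<phi> v) - (H (\<alpha> u) - \<phi> u)) + 1 / \<mu> * (\<alpha> v - \<alpha> u)"
      unfolding P_def by (rule lin)
    then have "\<bar>P v - P u\<bar> \<le> \<bar>\<mu> * M / 2 * ((H (\<alpha> v) - \<phi> v) - (H (\<alpha> u) - \<phi> u))\<bar> + \<bar>1 / \<mu> * (\<alpha> v - \<alpha> u)\<bar>"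
      by (metis abs_triangle_ineq)
    also have "\<dots> = \<mu> * M / 2 * \<bar>(H (\<alpha> v) - \<phi> v) - (H (\<alpha> u) - \<phi> u)\<bar> + 1 / \<mu> * \<bar>\<alpha> v - \<alpha> u\<bar>"
      using \<mu> M_pos by (simp add: abs_mult)
    also have "\<dots> \<le> \<mu> * M / 2 * ((C + 1) * ?d) + 1 / \<mu> * ?d" using 3 4 by (rule add_mono)
    finally show "\<bar>P v - P u\<bar> \<le> (\<mu> * M / 2 * (C + 1) + 1 / \<mu>) * ?d" by (simp only: distrib_right mult.assoc)
  next
    fix u \<alpha>' P' v
    assume u: "u \<in> {a<..<b}" and da: "(\<alpha> has_real_derivative \<alpha>') (at u)" and dP: "(P has_real_derivative P') (at u)"
      and v: "((\<lambda>s. mdist Y (\<beta> s) (\<beta> u) / \<bar>s - u\<bar>) \<longlongrightarrow> v) (at u)" and a0: "0 \<le> \<alpha>'" and v0: "0 \<le> v"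
      and fv: "f (\<alpha> u) * v \<le> \<alpha>'"
    have w: "A < \<alpha> u" "\<alpha> u < B" using mem[of u] u st by auto
    have fu: "0 < f (\<alpha> u)" "f (\<alpha> u) \<le> M" using f_window_pos f_le w by auto
    have dH: "((\<lambda>u. H (\<alpha> u)) has_real_derivative (1 / f (\<alpha> u)) * \<alpha>') (at u)"
      by (rule DERIV_chain2[OF H_deriv[OF w] da])
    \<comment> \<open>Only \<open>P\<close> and \<open>\<alpha>\<close> are given as differentiable
      at \<open>u\<close>. Solving the definition of \<open>P\<close> for \<open>\<phi>\<close>
      yields the derivative of \<open>\<phi>\<close>.\<close>
    define \<phi>' where "\<phi>' = \<alpha>' / f (\<alpha> u) - (P' - \<alpha>' / \<mu>) / (\<mu> * M / 2)"
    have phi_eq: "\<phi> = (\<lambda>u. H (\<alpha> u) - (P u - \<alpha> u / \<mu>) / (\<mu> * M / 2))"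
      using \<mu> M_pos by (auto simp: P_def fun_eq_iff)
    have dphi: "(\<phi> has_real_derivative \<phi>') (at u)"
      unfolding phi_eq \<phi>'_def using \<mu> M_pos by (auto intro!: derivative_eq_intros da dP dH)
    have P'_eq: "P' = \<mu> * M / 2 * (\<alpha>' / f (\<alpha> u) - \<phi>') + \<alpha>' / \<mu>"
    proof -
      have "c * ((P' - \<alpha>' / \<mu>) / c) = P' - \<alpha>' / \<mu>" if "c \<noteq> 0" for c using that by simp
      moreover have "\<mu> * M / 2 \<noteq> 0" using \<mu> M_pos by simp
      ultimately have "\<mu> * M / 2 * ((P' - \<alpha>' / \<mu>) / (\<mu> * M / 2)) = P' - \<alpha>' / \<mu>" by blast
      moreover have "\<alpha>' / f (\<alpha> u) - \<phi>' = (P' - \<alpha>' / \<mu>) / (\<mu> * M / 2)" by (simp only: \<phi>'_def diff_diff_eq2 add_diff_cancel_left')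
      ultimately show ?thesis by (simp only: diff_add_cancel)
    qed
    have "\<bar>\<phi>'\<bar> \<le> v"
    proof (rule tendsto_le[OF trivial_limit_at v difference_quotient_abs_tendsto[OF dphi]])
      have "eventually (\<lambda>s. s \<in> {a<..<b}) (at u)" using u by (intro eventually_at_in_open') auto
      then show "eventually (\<lambda>s. \<bar>\<phi> s - \<phi> u\<bar> / \<bar>s - u\<bar> \<le> mdist Y (\<beta> s) (\<beta> u) / \<bar>s - u\<bar>) (at u)"
        by eventually_elim (use phi_le u in \<open>auto intro!: divide_right_mono\<close>)
    qed
    define k where "k = f (\<alpha> u)"
    have k: "0 < k" "k \<le> M" using fu by (auto simp: k_def)
    have "k * \<bar>\<phi>'\<bar> \<le> k * v" using \<open>\<bar>\<phi>'\<bar> \<le> v\<close> k by (intro mult_left_mono) auto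
    then have kp: "\<bar>k * \<phi>'\<bar> \<le> k * v" "k * v \<le> \<alpha>'" using fv k by (auto simp: abs_mult k_def)
    have "(k * \<phi>')\<^sup>2 \<le> (k * v)\<^sup>2" using kp(1) by (simp add: abs_le_square_iff[symmetric])
    then have "\<alpha>'\<^sup>2 - k\<^sup>2 * v\<^sup>2 \<le> \<alpha>'\<^sup>2 - (k * \<phi>')\<^sup>2" by (simp add: power_mult_distrib)
    also have "\<dots> = (\<alpha>' - k * \<phi>') * (\<alpha>' + k * \<phi>')" by (simp add: power2_eq_square algebra_simps)
    \<comment> \<open>The second factor is at most \<open>2 * \<alpha>'\<close>. The weights
      \<open>\<mu>\<close> and \<open>1 / \<mu>\<close> are then attached to the factors before the
      means are compared.\<close>
    also have "\<dots> \<le> (\<alpha>' - k * \<phi>') * (2 * \<alpha>')" using kp by (intro mult_left_mono) auto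
    also have "\<dots> = (\<mu> * (\<alpha>' - k * \<phi>')) * (2 * \<alpha>' / \<mu>)" using \<mu> by simp
    finally have "sqrt (\<alpha>'\<^sup>2 - k\<^sup>2 * v\<^sup>2) \<le> sqrt ((\<mu> * (\<alpha>' - k * \<phi>')) * (2 * \<alpha>' / \<mu>))"
      by (rule real_sqrt_le_mono)
    also have "\<dots> \<le> (\<mu> * (\<alpha>' - k * \<phi>') + 2 * \<alpha>' / \<mu>) / 2"
      using kp \<mu> a0 by (intro arith_geo_mean_sqrt) auto
    also have "\<dots> = \<mu> / 2 * (\<alpha>' - k * \<phi>') + \<alpha>' / \<mu>" by simp
    also have "\<alpha>' - k * \<phi>' \<le> M * (\<alpha>' / k - \<phi>')"
    proof -
      have "\<alpha>' - k * \<phi>' = k * (\<alpha>' / k - \<phi>')" using k by (simp add: field_simps)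
      moreover have "0 \<le> \<alpha>' / k - \<phi>'" using kp k by (simp add: field_simps)
      ultimately show ?thesis using k(2) by (simp add: mult_right_mono)
    qed
    then have "\<mu> / 2 * (\<alpha>' - k * \<phi>') + \<alpha>' / \<mu> \<le> \<mu> / 2 * (M * (\<alpha>' / k - \<phi>')) + \<alpha>' / \<mu>"
      using \<mu> by (intro add_right_mono mult_left_mono) auto
    also have "\<dots> = P'" by (simp add: P'_eq k_def)
    finally show "sqrt (\<alpha>'\<^sup>2 - (f (\<alpha> u))\<^sup>2 * v\<^sup>2) \<le> P'" by (simp add: k_def)
  qed
  also have "P b - P a = \<mu> * M / 2 * (H t - H s - mdist Y x y) + (t - s) / \<mu>"
    unfolding P_def lin using ends x y by (simp add: \<phi>_def YM.commute[of y x])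
  finally show "cone_length f Y a b \<alpha> \<beta> \<le> ennreal (\<mu> * M / 2 * (H t - H s - mdist Y x y) + (t - s) / \<mu>)" .
qed

text \<open>The slack is not positive, so only the term \<open>(t - s) / \<mu>\<close> remains, and
  a large \<open>\<mu>\<close> makes it arbitrarily small.\<close>

lemma tsep_null:
  assumes st: "A < s" "t < B" and y: "y \<in> mspace Y" and d: "H t - H s \<le> mdist Y x y"
  shows "tsep X (s, x) (t, y) = 0"
proof -
  have *: "tsep X (s, x) (t, y) \<le> ennreal (0 + e)" if e: "e > 0" for e :: real
  proof -
    define \<mu> where "\<mu> = max 1 ((t - s) / e)"
    have \<mu>: "\<mu> > 0" "(t - s) / \<mu> \<le> e" using e
      by (auto simp: \<mu>_def divide_le_eq max_def field_simps split: if_splits)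
    have "\<mu> * M / 2 * (H t - H s - mdist Y x y) \<le> 0"
      using d \<mu> M_pos by (intro mult_nonneg_nonpos) auto
    then have "ennreal (\<mu> * M / 2 * (H t - H s - mdist Y x y) + (t - s) / \<mu>) \<le> ennreal (0 + e)"
      using \<mu> by (intro ennreal_leI) auto
    then show ?thesis using tsep_le_slack[OF st \<mu>(1) y, of x] by (rule order_trans[rotated])
  qed
  have "tsep X (s, x) (t, y) \<le> 0"
  proof (rule ennreal_le_epsilon)
    fix e :: real assume "0 < e"
    then show "tsep X (s, x) (t, y) \<le> 0 + ennreal e" using *[of e] by simp
  qed
  then show ?thesis by simp
qed

end

section \<open>Consequences of the measure contraction property\<close>

lemma sin_ge_half: fixes y :: real assumes "0 \<le> y" "y \<le> 1" shows "y / 2 \<le> sin y"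
proof -
  have "sin 0 - 0 / 2 \<le> sin y - y / 2"
  proof (rule DERIV_nonneg_imp_nondecreasing[where f="\<lambda>y. sin y - y / 2"])
    fix x assume x: "0 \<le> x" "x \<le> y"
    have "x \<le> pi / 3" using x assms pi_gt3 by linarith
    then have "cos (pi / 3) \<le> cos x" using x pi_gt3 by (intro cos_monotone_0_pi_le) auto
    then have "1 / 2 \<le> cos x" by (simp add: cos_60)
    moreover have "((\<lambda>y. sin y - y / 2) has_real_derivative cos x - 1 / 2) (at x)"
      by (auto intro!: derivative_eq_intros)
    ultimately show "\<exists>z. ((\<lambda>y. sin y - y / 2) has_real_derivative z) (at x) \<and> 0 \<le> z"
      by (intro exI[of _ "cos x - 1 / 2"]) auto
  qed fact
  then show ?thesis by simp
qed

lemma sinh_ge_self: fixes y :: real assumes "0 \<le> y" shows "y \<le> sinh y"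
proof -
  have "sinh 0 - 0 \<le> sinh y - y"
  proof (rule DERIV_nonneg_imp_nondecreasing[where f="\<lambda>y. sinh y - y"])
    fix x :: real
    have "((\<lambda>y. sinh y - y) has_real_derivative cosh x - 1) (at x)"
      by (auto intro!: derivative_eq_intros)
    then show "\<exists>z. ((\<lambda>y. sinh y - y) has_real_derivative z) (at x) \<and> 0 \<le> z"
      using cosh_real_ge_1[of x] by (intro exI[of _ "cosh x - 1"]) auto
  qed fact
  then show ?thesis by simp
qed

lemma sinh_le_double: fixes y :: real assumes "0 \<le> y" "y \<le> 1" shows "sinh y \<le> 2 * y"
proof -
  have "2 * 0 - sinh 0 \<le> 2 * y - sinh y"
  proof (rule DERIV_nonneg_imp_nondecreasing[where f="\<lambda>y. 2 * y - sinh y"])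
    fix x :: real assume x: "0 \<le> x" "x \<le> y"
    have "exp x \<le> exp 1" using x assms by simp
    also have "\<dots> \<le> (3::real)" by (rule exp_le)
    finally have "exp x \<le> 3" .
    moreover have "exp (- x) \<le> 1" using x by simp
    moreover have "cosh x = (exp x + exp (- x)) / 2" by (simp add: cosh_def)
    moreover have "u \<le> 3 \<Longrightarrow> v \<le> 1 \<Longrightarrow> (u + v) / 2 \<le> 2" for u v :: real by simp
    ultimately have "cosh x \<le> 2" by metis
    moreover have "((\<lambda>y. 2 * y - sinh y) has_real_derivative 2 - cosh x) (at x)"
      by (auto intro!: derivative_eq_intros)
    ultimately show "\<exists>z. ((\<lambda>y. 2 * y - sinh y) has_real_derivative z) (at x) \<and> 0 \<le> z"
      by (intro exI[of _ "2 - cosh x"]) auto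
  qed fact
  then show ?thesis by simp
qed

text \<open>Up to this radius all contraction coefficients are comparable with those for \<open>K = 0\<close>, and the
  radius restriction in \<open>MCP\<close> holds for \<open>K > 0\<close>; larger balls are reached by chaining, which
  avoids the Bonnet--Myers theorem.\<close>

definition mcp_radius :: "real \<Rightarrow> real \<Rightarrow> real" where
  "mcp_radius K N = 1 / (1 + sqrt (\<bar>K\<bar> / (N - 1)))"

text \<open>For \<open>K = 0\<close> the volume factor is \<open>t powr N\<close>: one power of
  \<open>t\<close> comes from \<open>t powr (1 / N)\<close>, the other \<open>N - 1\<close> from
  \<open>sigma_coeff\<close>. The halves account for the lower bound \<open>t / 2\<close> of
  \<open>sigma_coeff\<close> when \<open>K\<close> does not vanish.\<close>

definition contraction_coeff :: "real \<Rightarrow> real \<Rightarrow> real" where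
  "contraction_coeff N t = t * (t / 2) powr (N - 1)"

lemma mcp_radius_pos: "N > 1 \<Longrightarrow> 0 < mcp_radius K N"
  by (auto simp: mcp_radius_def intro!: divide_pos_pos add_pos_nonneg)

lemma contraction_coeff_pos: "0 < t \<Longrightarrow> 0 < contraction_coeff N t"
  by (simp add: contraction_coeff_def)

text \<open>Below \<open>mcp_radius\<close> the arguments of sine and hyperbolic sine are at most 1,
  where both functions agree with the identity up to a factor 2.\<close>

lemma sigma_coeff_ge:
  assumes N: "N > 1" and t: "0 < t" "t \<le> 1" and \<theta>: "0 \<le> \<theta>" "\<theta> < mcp_radius K N"
  shows "t / 2 \<le> sigma_coeff (K / (N - 1)) t \<theta>"
proof -
  define q where "q = sqrt (\<bar>K\<bar> / (N - 1))"
  have q0: "0 \<le> q" using N by (simp add: q_def)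
  have "q * \<theta> \<le> q * (1 / (1 + q))" using \<theta> q0 by (intro mult_left_mono) (auto simp: mcp_radius_def q_def)
  also have "\<dots> \<le> 1" using q0 by simp
  finally have x1: "q * \<theta> \<le> 1" .
  consider "\<theta> = 0 \<or> K = 0" | "\<theta> > 0" "K > 0" | "\<theta> > 0" "K < 0" using \<theta> by linarith
  then show ?thesis
  proof cases
    case 1
    then show ?thesis using t by (auto simp: sigma_coeff_def)
  next
    case 2
    then have q: "sqrt (K / (N - 1)) = q" "q > 0" using N by (auto simp: q_def)
    define x where "x = q * \<theta>"
    have x: "0 < x" "x \<le> 1" using q 2 x1 by (auto simp: x_def)
    have tx: "0 \<le> t * x" "t * x \<le> 1" using t x by (auto intro: mult_le_one)
    have sx: "0 < sin x" using x pi_gt3 by (intro sin_gt_zero) auto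
    have "t / 2 = (t * x / 2) / x" using x by simp
    also have "\<dots> \<le> (t * x / 2) / sin x" using sx x tx sin_x_le_x[of x] by (intro divide_left_mono) auto
    also have "\<dots> \<le> sin (t * x) / sin x" using sin_ge_half[OF tx] sx by (intro divide_right_mono) auto
    also have "\<dots> = sigma_coeff (K / (N - 1)) t \<theta>"
      using 2 N q by (simp add: sigma_coeff_def x_def mult.assoc)
    finally show ?thesis .
  next
    case 3
    then have KN: "K / (N - 1) < 0" using N by (simp add: divide_less_0_iff)
    have "\<bar>K\<bar> / (N - 1) = - (K / (N - 1))" using 3 by simp
    then have q: "sqrt (- (K / (N - 1))) = q" "q > 0" using KN by (auto simp: q_def)
    define x where "x = q * \<theta>"
    have x: "0 < x" "x \<le> 1" using q 3 x1 by (auto simp: x_def)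
    have tx: "0 \<le> t * x" using t x by auto
    have sx: "0 < sinh x" "sinh x \<le> 2 * x" using x sinh_le_double[of x] by auto
    have "t / 2 = (t * x) / (2 * x)" using x by simp
    also have "\<dots> \<le> (t * x) / sinh x" using sx x tx by (intro divide_left_mono) auto
    also have "\<dots> \<le> sinh (t * x) / sinh x" using sinh_ge_self[OF tx] sx by (intro divide_right_mono) auto
    also have "\<dots> = sigma_coeff (K / (N - 1)) t \<theta>"
    proof -
      show ?thesis using 3 q KN N by (simp add: sigma_coeff_def x_def mult.assoc)
    qed
    finally show ?thesis .
  qed
qed

lemma tau_coeff_powr_ge:
  assumes N: "N > 1" and t: "0 < t" "t \<le> 1" and \<theta>: "0 \<le> \<theta>" "\<theta> < mcp_radius K N"
  shows "contraction_coeff N t \<le> tau_coeff K N t \<theta> powr N"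
proof -
  let ?\<sigma> = "sigma_coeff (K / (N - 1)) t \<theta>"
  have \<sigma>: "t / 2 \<le> ?\<sigma>" by (rule sigma_coeff_ge[OF assms])
  have "tau_coeff K N t \<theta> powr N = t powr (1 / N * N) * ?\<sigma> powr ((1 - 1 / N) * N)"
    unfolding tau_coeff_def by (subst powr_mult) (auto simp: powr_powr)
  also have "(1 - 1 / N) * N = N - 1" using N by (simp add: field_simps)
  also have "t powr (1 / N * N) = t" using N t by simp
  finally have "tau_coeff K N t \<theta> powr N = t * ?\<sigma> powr (N - 1)" .
  moreover have "(t / 2) powr (N - 1) \<le> ?\<sigma> powr (N - 1)" using \<sigma> t N by (intro powr_mono2) auto
  ultimately show ?thesis using t by (simp add: contraction_coeff_def)
qed

lemma sigma_coeff_measurable [measurable]: "sigma_coeff \<kappa> t \<in> borel_measurable borel"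
  unfolding sigma_coeff_def sinh_def by measurable

lemma tau_coeff_measurable [measurable]: "tau_coeff K N t \<in> borel_measurable borel"
  unfolding tau_coeff_def by measurable

section \<open>Borel sets and evaluation of geodesics\<close>

lemma space_borel_of [simp]: "space (borel_of X) = mspace X"
  and sets_borel_of: "sets (borel_of X) = sigma_sets (mspace X) {U. openin (mtopology_of X) U}"
proof -
  have "{U. openin (mtopology_of X) U} \<subseteq> Pow (mspace X)" using openin_subset by fastforce
  then show "space (borel_of X) = mspace X" "sets (borel_of X) = sigma_sets (mspace X) {U. openin (mtopology_of X) U}"
    by (auto simp: borel_of_def)
qed

lemma openin_borel_of: "openin (mtopology_of X) U \<Longrightarrow> U \<in> sets (borel_of X)"
  by (auto simp: sets_borel_of)

lemma mball_of_borel: "mball_of X x r \<in> sets (borel_of X)"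
proof (rule openin_borel_of)
  interpret Metric_space "mspace X" "mdist X" by simp
  show "openin (mtopology_of X) (mball_of X x r)" by (simp add: mtopology_of_def mball_of_def)
qed

lemma singleton_borel_of: assumes "x \<in> mspace X" shows "{x} \<in> sets (borel_of X)"
proof -
  interpret Metric_space "mspace X" "mdist X" by simp
  have "openin (mtopology_of X) (mspace X - {x})"
    unfolding mtopology_of_def openin_mtopology
  proof (intro conjI allI impI)
    fix y assume "y \<in> mspace X - {x}"
    then show "\<exists>r>0. mball y r \<subseteq> mspace X - {x}"
      using assms by (intro exI[of _ "mdist X y x"]) auto
  qed auto
  then have "mspace X - (mspace X - {x}) \<in> sets (borel_of X)"
    using sets.compl_sets[OF openin_borel_of] by force
  moreover have "mspace X - (mspace X - {x}) = {x}" using assms by auto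
  ultimately show ?thesis by simp
qed

lemma continuous_map_measurable_borel_of:
  assumes "continuous_map (mtopology_of X) (mtopology_of Y) f"
  shows "f \<in> measurable (borel_of X) (borel_of Y)"
  unfolding borel_of_def[of Y]
proof (rule measurable_measure_of)
  show "{U. openin (mtopology_of Y) U} \<subseteq> Pow (mspace Y)" using openin_subset by fastforce
  show "f \<in> space (borel_of X) \<rightarrow> mspace Y"
    using continuous_map_image_subset_topspace[OF assms] by auto
  fix U assume "U \<in> {U. openin (mtopology_of Y) U}"
  then have "openin (mtopology_of X) {x \<in> topspace (mtopology_of X). f x \<in> U}"
    using assms openin_continuous_map_preimage by blast
  then show "f -` U \<inter> space (borel_of X) \<in> sets (borel_of X)"
    by (auto dest!: openin_borel_of simp: vimage_def Int_def conj_commute)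
qed

lemma continuous_map_borel_measurable:
  assumes "continuous_map (mtopology_of X) euclidean (f :: _ \<Rightarrow> real)"
  shows "f \<in> borel_measurable (borel_of X)"
proof (rule borel_measurableI)
  fix S :: "real set" assume "open S"
  then have "openin (mtopology_of X) {x \<in> topspace (mtopology_of X). f x \<in> S}"
    using assms openin_continuous_map_preimage by (metis open_openin)
  then show "f -` S \<inter> space (borel_of X) \<in> sets (borel_of X)"
    by (auto dest!: openin_borel_of simp: vimage_def Int_def conj_commute)
qed

text \<open>Evaluation is 1-Lipschitz for the uniform distance. This yields the measurability needed
  to pass from a plan to its marginals.\<close>

lemma geo_eval_continuous:
  assumes t: "t \<in> {0..1}"
  shows "continuous_map (mtopology_of (geo Y)) (mtopology_of Y) (\<lambda>\<gamma>. \<gamma> t)"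
proof (rule Lipschitz_continuous_imp_continuous_map)
  have sub: "mspace (geo Y) \<subseteq> mspace (cfunspace (top_of_set {0..1}) Y)" by (simp add: geo_def)
  have d: "mdist (geo Y) = mdist (cfunspace (top_of_set {0..1}) Y)" by (simp add: geo_def)
  show "Lipschitz_continuous_map (geo Y) Y (\<lambda>\<gamma>. \<gamma> t)"
    unfolding Lipschitz_continuous_map_def
  proof (intro conjI exI[of _ 1] ballI)
    have D: "\<gamma> \<in> mspace (cfunspace (top_of_set {0..1}) Y)" if "\<gamma> \<in> mspace (geo Y)" for \<gamma>
      using sub that by blast
    show "(\<lambda>\<gamma>. \<gamma> t) \<in> mspace (geo Y) \<rightarrow> mspace Y"
    proof
      fix \<gamma> assume "\<gamma> \<in> mspace (geo Y)"
      then show "\<gamma> t \<in> mspace Y" using D[of \<gamma>] t by (auto simp: Pi_iff)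
    qed
    fix \<gamma> \<eta> assume "\<gamma> \<in> mspace (geo Y)" "\<eta> \<in> mspace (geo Y)"
    then show "mdist Y (\<gamma> t) (\<eta> t) \<le> 1 * mdist (geo Y) \<gamma> \<eta>"
      using t cfunspace_mdist_le[OF D D, of \<gamma> \<eta> "mdist (geo Y) \<gamma> \<eta>"] unfolding d by auto
  qed
qed

lemma geo_mspaceD:
  assumes "\<gamma> \<in> mspace (geo Y)"
  shows "t \<in> {0..1} \<Longrightarrow> \<gamma> t \<in> mspace Y"
    and "s \<in> {0..1} \<Longrightarrow> t \<in> {0..1} \<Longrightarrow> mdist Y (\<gamma> s) (\<gamma> t) = \<bar>s - t\<bar> * mdist Y (\<gamma> 0) (\<gamma> 1)"
proof -
  have c: "\<gamma> \<in> mspace (cfunspace (top_of_set {0..1}) Y)"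
    and g: "\<forall>s\<in>{0..1}. \<forall>t\<in>{0..1}. mdist Y (\<gamma> s) (\<gamma> t) = \<bar>s - t\<bar> * mdist Y (\<gamma> 0) (\<gamma> 1)"
    using assms unfolding geo_def mspace_submetric by blast+
  show "\<gamma> t \<in> mspace Y" if "t \<in> {0..1}" using c that by (auto simp: Pi_iff)
  show "mdist Y (\<gamma> s) (\<gamma> t) = \<bar>s - t\<bar> * mdist Y (\<gamma> 0) (\<gamma> 1)" if "s \<in> {0..1}" "t \<in> {0..1}"
    using g that by blast
qed

lemma geodesic_of_geo: "\<gamma> \<in> mspace (geo Y) \<Longrightarrow> geodesic Y (\<gamma> 0) (\<gamma> 1)"
  unfolding geodesic_def using geo_mspaceD[of \<gamma> Y] by (intro exI[of _ \<gamma>]) blast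

section \<open>Paths in length spaces\<close>

lemma length_space_path:
  assumes Y: "length_space Y" and xz: "x \<in> mspace Y" "z \<in> mspace Y" and L: "mdist Y x z < L"
  obtains c where "pathin (mtopology_of Y) c" "c 0 = x" "c 1 = z"
    "\<And>s. s \<in> {0..1} \<Longrightarrow> c s \<in> mspace Y"
    "\<And>s. s \<in> {0..1} \<Longrightarrow> mdist Y x (c s) + mdist Y (c s) z < L"
proof -
  have L0: "0 \<le> L" using L mdist_nonneg[of Y x z] by linarith
  have "ennreal (mdist Y x z) < ennreal L" using L L0 by (subst ennreal_less_iff) auto
  then have "Inf {curve_length Y c | c. pathin (mtopology_of Y) c \<and> c 0 = x \<and> c 1 = z} < ennreal L"
    using Y xz unfolding length_space_def by auto
  then obtain l where "l \<in> {curve_length Y c | c. pathin (mtopology_of Y) c \<and> c 0 = x \<and> c 1 = z}" "l < ennreal L"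
    by (meson Inf_less_iff)
  then obtain c where c: "pathin (mtopology_of Y) c" "c 0 = x" "c 1 = z" "curve_length Y c < ennreal L"
    by blast
  show ?thesis
  proof (rule that[OF c(1-3)])
    fix s :: real assume s: "s \<in> {0..1}"
    show "c s \<in> mspace Y" using continuous_map_image_subset_topspace[OF c(1)[unfolded pathin_def]] s by auto
    \<comment> \<open>The partition \<open>[0, s, 1]\<close> bounds the two distances from
      \<open>c s\<close> by the length of the whole path.\<close>
    have "(\<Sum>i<length [0,s,1] - 1. ennreal (mdist Y (c ([0,s,1] ! i)) (c ([0,s,1] ! Suc i)))) \<le> curve_length Y c"
      unfolding curve_length_def using s by (intro Sup_upper) (auto intro!: exI[of _ "[0,s,1]"])
    also have "(\<Sum>i<length [0,s,1] - 1. ennreal (mdist Y (c ([0,s,1] ! i)) (c ([0,s,1] ! Suc i)))) =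
       ennreal (mdist Y x (c s) + mdist Y (c s) z)"
      using c by (simp add: lessThan_Suc add.commute ennreal_plus[symmetric] del: ennreal_plus)
    finally have "ennreal (mdist Y x (c s) + mdist Y (c s) z) < ennreal L" using c(4) by simp
    then show "mdist Y x (c s) + mdist Y (c s) z < L" by (subst (asm) ennreal_less_iff) auto
  qed
qed

lemma path_mdist_attains:
  assumes c: "pathin (mtopology_of Y) c" and y: "y \<in> mspace Y"
    and v: "mdist Y y (c 0) \<le> v \<and> v \<le> mdist Y y (c 1) \<or> mdist Y y (c 1) \<le> v \<and> v \<le> mdist Y y (c 0)"
  obtains s where "s \<in> {0..1}" "mdist Y y (c s) = v"
proof -
  have "continuous_map (top_of_set {0..1}) euclidean (\<lambda>s. mdist Y y (c s))"
    using c y unfolding pathin_def by (intro continuous_map_mdist) auto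
  then have "continuous_on {0..1} (\<lambda>s. mdist Y y (c s))" by simp
  then show ?thesis
    using IVT'[of "\<lambda>s. mdist Y y (c s)" 0 v 1] IVT2'[of "\<lambda>s. mdist Y y (c s)" 1 v 0] v that by auto
qed

section \<open>Volume, packing and covering under measure contraction\<close>

locale mcp_space =
  fixes K N :: real and Y :: "'y metric" and m :: "'y measure"
  assumes N: "N > 1" and mms: "metric_measure_space Y m" and mcp: "MCP K N Y m" and len: "length_space Y"
begin

sublocale YM: Metric_space "mspace Y" "mdist Y" by simp

lemma sets_m: "sets m = sets (borel_of Y)" and separable: "separable_space (mtopology_of Y)"
  and locally_finite: "y \<in> mspace Y \<Longrightarrow> \<exists>r>0. emeasure m (mball_of Y y r) < \<infinity>"
  and support: "msupport Y m = mspace Y"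
  using mms by (auto simp: metric_measure_space_def)

lemma ball_sets: "mball_of Y y r \<in> sets m"
  by (simp add: sets_m mball_of_borel)

lemma ball_pos: "y \<in> mspace Y \<Longrightarrow> 0 < r \<Longrightarrow> 0 < emeasure m (mball_of Y y r)"
  using support by (auto simp: msupport_def)

lemma ball_mono: "r \<le> s \<Longrightarrow> mball_of Y y r \<subseteq> mball_of Y y s"
  by auto

lemma dense_sequence:
  "\<exists>D. countable D \<and> D \<subseteq> mspace Y \<and> (\<forall>x\<in>mspace Y. \<forall>e>0. \<exists>z\<in>D. mdist Y x z < e)"
proof -
  obtain D where D: "countable D" "D \<subseteq> mspace Y" "YM.mtopology closure_of D = mspace Y"
    using separable by (auto simp: separable_space_def mtopology_of_def)
  show ?thesis
  proof (intro exI conjI ballI allI impI)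
    fix x e assume "x \<in> mspace Y" "e > (0::real)"
    then show "\<exists>z\<in>D. mdist Y x z < e" using D(3) unfolding YM.metric_closure_of by auto
  qed fact+
qed

text \<open>The balls of finite mass and radius \<open>1 / Suc n\<close> about a countable dense set
  exhaust the space. Sigma-finiteness is used to find subsets of large finite mass in a ball of
  infinite mass.\<close>

lemma sigma_finite: "sigma_finite_measure m"
proof -
  obtain D where D: "countable D" "D \<subseteq> mspace Y" "\<And>x e. x \<in> mspace Y \<Longrightarrow> 0 < e \<Longrightarrow> \<exists>z\<in>D. mdist Y x z < e"
    using dense_sequence by auto
  define \<A> where "\<A> = {A \<in> (\<lambda>(z, n). mball_of Y z (1 / Suc n)) ` (D \<times> UNIV). emeasure m A < \<infinity>}"
  show ?thesis
  proof
    show "\<exists>A. countable A \<and> A \<subseteq> sets m \<and> \<Union> A = space m \<and> (\<forall>a\<in>A. emeasure m a \<noteq> \<infinity>)"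
    proof (intro exI[of _ \<A>] conjI)
      have "countable ((\<lambda>(z, n). mball_of Y z (1 / Suc n)) ` (D \<times> (UNIV :: nat set)))" using D(1) by auto
      then show "countable \<A>" unfolding \<A>_def by (rule countable_subset[rotated]) auto
      show "\<A> \<subseteq> sets m" by (auto simp: \<A>_def ball_sets)
      have sp: "space m = mspace Y" using sets_eq_imp_space_eq[OF sets_m] by simp
      show "\<Union> \<A> = space m"
      proof
        show "\<Union> \<A> \<subseteq> space m" by (auto simp: \<A>_def sp)
        show "space m \<subseteq> \<Union> \<A>"
        proof
          fix x assume "x \<in> space m"
          then have x: "x \<in> mspace Y" by (simp add: sp)
          obtain r where r: "r > 0" "emeasure m (mball_of Y x r) < \<infinity>" using locally_finite[OF x] by auto
          obtain n where n: "1 / Suc n < r / 2" using r nat_approx_posE[of "r / 2"] by auto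
          obtain z where z: "z \<in> D" "mdist Y x z < 1 / Suc n" using D(3)[OF x, of "1 / Suc n"] by auto
          have "mball_of Y z (1 / Suc n) \<subseteq> mball_of Y x r"
          proof
            fix w assume w: "w \<in> mball_of Y z (1 / Suc n)"
            then show "w \<in> mball_of Y x r" using YM.triangle[of x z w] x z n by auto
          qed
          then have "emeasure m (mball_of Y z (1 / Suc n)) \<le> emeasure m (mball_of Y x r)"
            by (intro emeasure_mono ball_sets)
          then have "mball_of Y z (1 / Suc n) \<in> \<A>" using z r by (auto simp: \<A>_def)
          moreover have "x \<in> mball_of Y z (1 / Suc n)" using z x D(2) by (auto simp: YM.commute)
          ultimately show "x \<in> \<Union> \<A>" by blast
        qed
      qed
      show "\<forall>a\<in>\<A>. emeasure m a \<noteq> \<infinity>" by (auto simp: \<A>_def)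
    qed
  qed
qed

text \<open>Inside \<open>mcp_radius\<close> the property is available for every sign of
  \<open>K\<close>. Its marginal conditions are restated for almost every geodesic, and the
  comparison of measures as an integral over the plan.\<close>

lemma mcp_plan:
  assumes y: "y \<in> mspace Y" and A: "A \<in> sets m" "A \<subseteq> mball_of Y y (mcp_radius K N)"
    and mA: "0 < emeasure m A" "emeasure m A < \<infinity>"
  obtains \<pi> where "prob_space \<pi>" "sets \<pi> = sets (borel_of (geo Y))" "AE \<gamma> in \<pi>. \<gamma> 0 = y" "AE \<gamma> in \<pi>. \<gamma> 1 \<in> A"
    "\<And>t B. t \<in> {0..1} \<Longrightarrow> B \<in> sets m \<Longrightarrow> 
       (\<integral>\<^sup>+ \<gamma>. ennreal (tau_coeff K N t (mdist Y (\<gamma> 0) (\<gamma> 1)) powr N) * emeasure m A * indicator B (\<gamma> t) \<partial>\<pi>)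
        \<le> emeasure m B"
proof -
  have q0: "0 \<le> sqrt (\<bar>K\<bar> / (N - 1))" using N by simp
  have bd: "YM.mbounded A" unfolding YM.mbounded_def
    using A(2) by (intro exI[of _ y] exI[of _ "mcp_radius K N"]) (force simp: YM.in_mcball)
  \<comment> \<open>With \<open>q = sqrt (K / (N - 1))\<close> the admissible radius is
    \<open>pi / q\<close>, whereas \<open>mcp_radius\<close> is \<open>1 / (1 + q)\<close>.\<close>
  have rad: "A \<subseteq> mball_of Y y (pi * sqrt ((N - 1) / K))" if "K > 0"
  proof -
    define q where "q = sqrt (K / (N - 1))"
    have q: "q > 0" using that N by (simp add: q_def)
    have "mcp_radius K N = 1 / (1 + q)" using that by (simp add: mcp_radius_def q_def)
    also have "\<dots> \<le> 1 / q" using q by (intro divide_left_mono) auto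
    also have "\<dots> \<le> pi / q" using q pi_gt3 by (intro divide_right_mono) auto
    also have "\<dots> = pi * sqrt ((N - 1) / K)" by (simp add: q_def real_sqrt_divide)
    finally show ?thesis using A(2) by (auto intro: less_le_trans)
  qed
  have ys: "y \<in> msupport Y m" using y support by simp
  have pre: "YM.mbounded A \<and> 0 < emeasure m A \<and> emeasure m A < \<infinity> \<and>
      (0 < K \<longrightarrow> A \<subseteq> mball_of Y y (pi * sqrt ((N - 1) / K)))"
    using bd rad mA by blast
  from mcp[unfolded MCP_def, THEN bspec, OF ys, THEN bspec, OF A(1), THEN mp, OF pre]
  obtain \<pi> where \<pi>: "optimal_dynamical_plan Y (return (borel_of Y) y) (uniform_measure m A) \<pi>"
    and con: "\<And>t B. t \<in> {0..1} \<Longrightarrow> B \<in> sets m \<Longrightarrow> emeasure (distr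
                (density \<pi> (\<lambda>\<gamma>. ennreal (tau_coeff K N t (mdist Y (\<gamma> 0) (\<gamma> 1)) powr N) * emeasure m A))
                (borel_of Y) (\<lambda>\<gamma>. \<gamma> t)) B \<le> emeasure m B"
    by (elim exE conjE) blast
  have prob: "prob_space \<pi>" and s\<pi>: "sets \<pi> = sets (borel_of (geo Y))"
    and d0: "distr \<pi> (borel_of Y) (\<lambda>\<gamma>. \<gamma> 0) = return (borel_of Y) y"
    and d1: "distr \<pi> (borel_of Y) (\<lambda>\<gamma>. \<gamma> 1) = uniform_measure m A"
    using \<pi> by (auto simp: optimal_dynamical_plan_def prob_on_def)
  interpret prob_space \<pi> by fact
  have ev: "(\<lambda>\<gamma>. \<gamma> t) \<in> measurable \<pi> (borel_of Y)" if "t \<in> {0..1}" for t :: real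
    unfolding measurable_cong_sets[OF s\<pi> refl]
    by (rule continuous_map_measurable_borel_of[OF geo_eval_continuous[OF that]])
  have Ab: "A \<in> sets (borel_of Y)" using A sets_m by simp
  have AE0: "AE \<gamma> in \<pi>. \<gamma> 0 = y"
  proof -
    have set: "{x \<in> space (borel_of Y). x = y} \<in> sets (borel_of Y)"
    proof -
      have "{x \<in> space (borel_of Y). x = y} = {y}" using y by auto
      then show ?thesis using singleton_borel_of[OF y] by simp
    qed
    have "AE x in distr \<pi> (borel_of Y) (\<lambda>\<gamma>. \<gamma> 0). x = y"
      unfolding d0 using y set by (subst AE_return) (auto simp: pred_def)
    then show ?thesis using AE_distr_iff[OF ev set] by simp
  qed
  have AE1: "AE \<gamma> in \<pi>. \<gamma> 1 \<in> A"
  proof -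
    have set: "{x \<in> space (borel_of Y). x \<in> A} \<in> sets (borel_of Y)"
    proof -
      have "{x \<in> space (borel_of Y). x \<in> A} = A" using sets.sets_into_space[OF Ab] by auto
      then show ?thesis using Ab by simp
    qed
    have "AE x in distr \<pi> (borel_of Y) (\<lambda>\<gamma>. \<gamma> 1). x \<in> A"
      unfolding d1 using A mA by (intro AE_uniform_measureI) auto
    then show ?thesis using AE_distr_iff[OF ev set] by simp
  qed
  show ?thesis
  proof (rule that[OF prob s\<pi> AE0 AE1])
    fix t :: real and B assume t: "t \<in> {0..1}" and B: "B \<in> sets m"
    have cm: "continuous_map (mtopology_of (geo Y)) euclidean (\<lambda>\<gamma>. mdist Y (\<gamma> 0) (\<gamma> 1))"
      by (intro continuous_map_mdist geo_eval_continuous) auto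
    have [measurable]: "(\<lambda>\<gamma>. mdist Y (\<gamma> 0) (\<gamma> 1)) \<in> borel_measurable \<pi>"
      unfolding measurable_cong_sets[OF s\<pi> refl] by (rule continuous_map_borel_measurable[OF cm])
    let ?w = "\<lambda>\<gamma>. ennreal (tau_coeff K N t (mdist Y (\<gamma> 0) (\<gamma> 1)) powr N) * emeasure m A"
    have w [measurable]: "?w \<in> borel_measurable \<pi>" by measurable
    have Bb: "B \<in> sets (borel_of Y)" using B sets_m by simp
    have "(\<integral>\<^sup>+ \<gamma>. ?w \<gamma> * indicator B (\<gamma> t) \<partial>\<pi>) = (\<integral>\<^sup>+ \<gamma>. ?w \<gamma> * indicator ((\<lambda>\<gamma>. \<gamma> t) -` B \<inter> space \<pi>) \<gamma> \<partial>\<pi>)"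
      by (intro nn_integral_cong) (auto simp: indicator_def)
    also have "\<dots> = emeasure (density \<pi> ?w) ((\<lambda>\<gamma>. \<gamma> t) -` B \<inter> space \<pi>)"
      using ev[OF t] Bb by (subst emeasure_density) auto
    also have "\<dots> = emeasure (distr (density \<pi> ?w) (borel_of Y) (\<lambda>\<gamma>. \<gamma> t)) B"
      using ev[OF t] Bb by (subst emeasure_distr) auto
    also have "\<dots> \<le> emeasure m B" by (rule con[OF t B])
    finally show "(\<integral>\<^sup>+ \<gamma>. ?w \<gamma> * indicator B (\<gamma> t) \<partial>\<pi>) \<le> emeasure m B" .
  qed
qed

text \<open>A local inequality of Bishop-Gromov type. At time \<open>t\<close> almost all geodesics
  of the plan are in the ball of radius \<open>t * \<rho>\<close>, and the mass transported there is
  at least the stated fraction of that of \<open>A\<close>.\<close>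

lemma contraction:
  assumes y: "y \<in> mspace Y" and A: "A \<in> sets m" "A \<subseteq> mball_of Y y \<rho>" and \<rho>: "\<rho> \<le> mcp_radius K N"
    and mA: "emeasure m A < \<infinity>" and t: "0 < t" "t \<le> 1"
  shows "ennreal (contraction_coeff N t) * emeasure m A \<le> emeasure m (mball_of Y y (t * \<rho>))"
proof (cases "emeasure m A = 0")
  case False
  have "A \<subseteq> mball_of Y y (mcp_radius K N)" using A(2) \<rho> by auto
  moreover have "0 < emeasure m A" using False by (simp add: zero_less_iff_neq_zero)
  ultimately obtain \<pi> where \<pi>: "prob_space \<pi>" "sets \<pi> = sets (borel_of (geo Y))"
    "AE \<gamma> in \<pi>. \<gamma> 0 = y" "AE \<gamma> in \<pi>. \<gamma> 1 \<in> A"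
    "\<And>t B. t \<in> {0..1} \<Longrightarrow> B \<in> sets m \<Longrightarrow> 
       (\<integral>\<^sup>+ \<gamma>. ennreal (tau_coeff K N t (mdist Y (\<gamma> 0) (\<gamma> 1)) powr N) * emeasure m A * indicator B (\<gamma> t) \<partial>\<pi>)
        \<le> emeasure m B"
    using mcp_plan[OF y A(1) _ _ mA] by blast
  interpret prob_space \<pi> by fact
  have sp: "space \<pi> = mspace (geo Y)" using sets_eq_imp_space_eq[OF \<pi>(2)] by simp
  have "AE \<gamma> in \<pi>. \<gamma> \<in> mspace (geo Y)" using AE_space[of \<pi>] by (simp add: sp)
  then have *: "AE \<gamma> in \<pi>. ennreal (contraction_coeff N t) * emeasure m A \<le>
     ennreal (tau_coeff K N t (mdist Y (\<gamma> 0) (\<gamma> 1)) powr N) * emeasure m A * indicator (mball_of Y y (t * \<rho>)) (\<gamma> t)"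
    using \<pi>(3,4)
  proof eventually_elim
    case (elim \<gamma>)
    have d: "mdist Y (\<gamma> 0) (\<gamma> 1) < \<rho>" using elim A(2) by auto
    have "mdist Y (\<gamma> 0) (\<gamma> t) = t * mdist Y (\<gamma> 0) (\<gamma> 1)"
      using geo_mspaceD(2)[OF elim(1), of 0 t] t by auto
    also have "\<dots> < t * \<rho>" using d t by simp
    finally have "\<gamma> t \<in> mball_of Y y (t * \<rho>)"
      using elim y geo_mspaceD(1)[OF elim(1), of t] t by auto
    moreover have "contraction_coeff N t \<le> tau_coeff K N t (mdist Y (\<gamma> 0) (\<gamma> 1)) powr N"
      using d \<rho> by (intro tau_coeff_powr_ge N t) auto
    ultimately show ?case by (auto intro!: mult_right_mono ennreal_leI)
  qed
  have "ennreal (contraction_coeff N t) * emeasure m A = (\<integral>\<^sup>+ \<gamma>. ennreal (contraction_coeff N t) * emeasure m A \<partial>\<pi>)"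
    by (simp add: emeasure_space_1)
  also have "\<dots> \<le> (\<integral>\<^sup>+ \<gamma>. ennreal (tau_coeff K N t (mdist Y (\<gamma> 0) (\<gamma> 1)) powr N) * emeasure m A *
     indicator (mball_of Y y (t * \<rho>)) (\<gamma> t) \<partial>\<pi>)"
    by (rule nn_integral_mono_AE[OF *])
  also have "\<dots> \<le> emeasure m (mball_of Y y (t * \<rho>))"
    using t by (intro \<pi>(5) ball_sets) auto
  finally show ?thesis .
qed simp

text \<open>A plan from \<open>y\<close> to the normalised measure on a small ball around
  \<open>z\<close> is a probability measure on geodesics, so some geodesic from \<open>y\<close>
  ends in that ball.\<close>

lemma dense_geodesics:
  assumes yz: "y \<in> mspace Y" "z \<in> mspace Y" "mdist Y y z < mcp_radius K N" and e: "0 < e"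
  obtains x where "geodesic Y y x" "mdist Y z x < e"
proof -
  obtain r where r: "r > 0" "emeasure m (mball_of Y z r) < \<infinity>" using locally_finite yz by blast
  \<comment> \<open>The three bounds provide the accuracy, the finite mass of the target and its
    inclusion in the ball where \<open>mcp_plan\<close> applies.\<close>
  define q where "q = min (min e r) (mcp_radius K N - mdist Y y z)"
  have q: "q > 0" "q \<le> e" "q \<le> r" "q \<le> mcp_radius K N - mdist Y y z" using e r yz by (auto simp: q_def)
  have "mball_of Y z q \<subseteq> mball_of Y y (mcp_radius K N)"
  proof
    fix w assume "w \<in> mball_of Y z q"
    then show "w \<in> mball_of Y y (mcp_radius K N)" using YM.triangle[of y z w] yz q by auto
  qed
  then have sub: "mball_of Y z q \<subseteq> mball_of Y y (mcp_radius K N)" .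
  have fin: "emeasure m (mball_of Y z q) < \<infinity>"
    using emeasure_mono[OF ball_mono[OF q(3)] ball_sets, of z] r(2) by (rule le_less_trans)
  show ?thesis
  proof (rule mcp_plan[OF yz(1) ball_sets sub ball_pos[OF yz(2) q(1)] fin])
    fix \<pi>
    assume \<pi>: "prob_space \<pi>" "sets \<pi> = sets (borel_of (geo Y))"
      "AE \<gamma> in \<pi>. \<gamma> 0 = y" "AE \<gamma> in \<pi>. \<gamma> 1 \<in> mball_of Y z q"
  interpret prob_space \<pi> by fact
  have sp: "space \<pi> = mspace (geo Y)" using sets_eq_imp_space_eq[OF \<pi>(2)] by simp
  have ae: "AE \<gamma> in \<pi>. \<gamma> \<in> mspace (geo Y) \<and> \<gamma> 0 = y \<and> \<gamma> 1 \<in> mball_of Y z q"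
    using AE_space[of \<pi>] \<pi>(3,4) by eventually_elim (auto simp: sp)
  have "ae_filter \<pi> \<noteq> bot" by (simp add: ae_filter_eq_bot_iff emeasure_space_1)
  from eventually_happens'[OF this ae] obtain \<gamma>
    where "\<gamma> \<in> mspace (geo Y)" "\<gamma> 0 = y" "\<gamma> 1 \<in> mball_of Y z q" by blast
  then show ?thesis using geodesic_of_geo q by (intro that[of "\<gamma> 1"]) auto
  qed
qed

text \<open>Some ball about \<open>y\<close> has finite mass by local finiteness. Contraction into
  it bounds the mass of every subset of finite mass, whereas a ball of infinite mass would have such
  subsets of arbitrarily large mass.\<close>

lemma finite_ball:
  assumes y: "y \<in> mspace Y" and \<rho>: "\<rho> \<le> mcp_radius K N"
  shows "emeasure m (mball_of Y y \<rho>) < \<infinity>"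
proof (rule ccontr)
  assume "\<not> ?thesis"
  then have inf: "emeasure m (mball_of Y y \<rho>) = \<infinity>"
    using top.not_eq_extremum by (metis infinity_ennreal_def)
  obtain r where r: "r > 0" "emeasure m (mball_of Y y r) < \<infinity>" using locally_finite y by blast
  have r\<rho>: "r < \<rho>"
  proof (rule ccontr)
    assume "\<not> r < \<rho>"
    then have "emeasure m (mball_of Y y \<rho>) \<le> emeasure m (mball_of Y y r)"
      by (intro emeasure_mono ball_sets ball_mono) auto
    then show False using inf r by auto
  qed
  define c where "c = contraction_coeff N (r / \<rho>)"
  have c: "c > 0" using r r\<rho> by (simp add: c_def contraction_coeff_pos)
  obtain b where b: "emeasure m (mball_of Y y r) = ennreal b" "0 \<le> b"
    using r(2) by (cases "emeasure m (mball_of Y y r)") auto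
  interpret sigma_finite_measure m by (rule sigma_finite)
  obtain Z where Z: "Z \<in> sets m" "Z \<subseteq> mball_of Y y \<rho>" "emeasure m Z < \<infinity>" "ennreal (b / c) < emeasure m Z"
    using approx_PInf_emeasure_with_finite[OF ball_sets inf, of "b / c"] by blast
  have "ennreal c * emeasure m Z \<le> emeasure m (mball_of Y y (r / \<rho> * \<rho>))"
    unfolding c_def using r r\<rho> by (intro contraction[OF y Z(1,2) \<rho> Z(3)]) auto
  also have "\<dots> = ennreal b" using r r\<rho> b by simp
  finally have "ennreal c * emeasure m Z \<le> ennreal b" .
  obtain z where z: "emeasure m Z = ennreal z" "0 \<le> z" using Z(3) by (cases "emeasure m Z") auto
  have "c * z \<le> b" using \<open>ennreal c * emeasure m Z \<le> ennreal b\<close> z b c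
    by (simp add: ennreal_mult[symmetric])
  moreover have "b / c < z" using Z(4) z b c by (simp add: ennreal_less_iff)
  ultimately show False using c by (simp add: field_simps)
qed

text \<open>The ball of radius \<open>2 * R\<close> about \<open>y\<close> lies in the ball of
  radius \<open>3 * R\<close> about each point of \<open>F\<close>. Contraction by the factor
  \<open>r / (6 * R)\<close> gives each of the disjoint balls of radius \<open>r / 2\<close> a fixed
  fraction of its mass. Only the ratio of \<open>r\<close> to \<open>R\<close> enters.\<close>

lemma separated_card:
  assumes y: "y \<in> mspace Y" and r: "0 < r" "r \<le> R" "4 * R \<le> mcp_radius K N"
    and F: "finite F" "F \<subseteq> mball_of Y y R" "\<And>x x'. x \<in> F \<Longrightarrow> x' \<in> F \<Longrightarrow> x \<noteq> x' \<Longrightarrow> r \<le> mdist Y x x'"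
  shows "real (card F) * contraction_coeff N (r / (6 * R)) \<le> 1"
proof -
  let ?A = "mball_of Y y (2 * R)" and ?c = "contraction_coeff N (r / (6 * R))"
  have R: "R > 0" using r by simp
  have c: "?c > 0" using r R by (intro contraction_coeff_pos) auto
  have A_fin: "emeasure m ?A < \<infinity>" using r R by (intro finite_ball[OF y]) auto
  have A_pos: "0 < emeasure m ?A" using R by (intro ball_pos[OF y]) auto
  obtain a where a: "emeasure m ?A = ennreal a" "0 < a"
    using A_fin A_pos by (cases "emeasure m ?A") auto
  have each: "ennreal ?c * emeasure m ?A \<le> emeasure m (mball_of Y x (r / 2))" if x: "x \<in> F" for x
  proof -
    have "?A \<subseteq> mball_of Y x (3 * R)"
    proof
      fix w assume "w \<in> ?A"
      then show "w \<in> mball_of Y x (3 * R)"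
        using YM.triangle[of x y w] x F(2) y YM.commute[of x y] by auto
    qed
    then have "ennreal ?c * emeasure m ?A \<le> emeasure m (mball_of Y x (r / (6 * R) * (3 * R)))"
      using x F(2) r R A_fin by (intro contraction ball_sets) auto
    then show ?thesis using R by simp
  qed
  have disj: "disjoint_family_on (\<lambda>x. mball_of Y x (r / 2)) F"
  proof (unfold disjoint_family_on_def, intro ballI impI equals0I)
    fix x x' w assume "x \<in> F" "x' \<in> F" "x \<noteq> x'" "w \<in> mball_of Y x (r / 2) \<inter> mball_of Y x' (r / 2)"
    then show False using F(3)[of x x'] YM.triangle[of x w x'] YM.commute[of x' w] by auto
  qed
  have "ennreal (real (card F) * ?c * a) = (\<Sum>x\<in>F. ennreal ?c * emeasure m ?A)"
    using a c by (simp add: ennreal_mult ennreal_of_nat_eq_real_of_nat mult.assoc)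
  also have "\<dots> \<le> (\<Sum>x\<in>F. emeasure m (mball_of Y x (r / 2)))" by (intro sum_mono each)
  also have "\<dots> = emeasure m (\<Union>x\<in>F. mball_of Y x (r / 2))"
    using F(1) disj ball_sets by (intro sum_emeasure) auto
  also have "\<dots> \<le> emeasure m ?A"
  proof (intro emeasure_mono ball_sets UN_least subsetI)
    fix x w assume "x \<in> F" "w \<in> mball_of Y x (r / 2)"
    then show "w \<in> ?A" using F(2) r YM.triangle[of y x w] y by auto
  qed
  finally have "real (card F) * ?c * a \<le> a" using a by (simp add: ennreal_le_iff)
  then show ?thesis using a by (simp add: mult_le_cancel_right2)
qed

text \<open>A separated subset of \<open>S\<close> with the greatest possible number of points is a
  net of \<open>S\<close>. The packing bound guarantees that such a subset exists.\<close>

lemma local_cover: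
  assumes y: "y \<in> mspace Y" and r: "0 < r" "r \<le> R" "4 * R \<le> mcp_radius K N" and S: "S \<subseteq> mball_of Y y R"
    and c: "0 < c" "c \<le> contraction_coeff N (r / (6 * R))"
  obtains F where "finite F" "F \<subseteq> S" "real (card F) \<le> 1 / c" "\<And>z. z \<in> S \<Longrightarrow> \<exists>x\<in>F. mdist Y x z < r"
proof -
  define P where "P F \<longleftrightarrow> finite F \<and> F \<subseteq> S \<and> (\<forall>x\<in>F. \<forall>x'\<in>F. x \<noteq> x' \<longrightarrow> r \<le> mdist Y x x')" for F
  have card: "real (card F) \<le> 1 / c" if "P F" for F
  proof -
    have "real (card F) * c \<le> real (card F) * contraction_coeff N (r / (6 * R))"
      using c by (intro mult_left_mono) auto
    also have "\<dots> \<le> 1" using that S by (intro separated_card[OF y r]) (auto simp: P_def)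
    finally show ?thesis using c by (simp add: field_simps)
  qed
  have "\<exists>F. P F \<and> (\<forall>G. P G \<longrightarrow> card G \<le> card F)"
  proof (rule ex_has_greatest_nat[of P "{}" card "Suc (nat \<lceil>1 / c\<rceil>)"])
    show "P {}" by (simp add: P_def)
    show "\<forall>F. P F \<longrightarrow> card F < Suc (nat \<lceil>1 / c\<rceil>)"
    proof (intro allI impI)
      fix F assume "P F"
      then show "card F < Suc (nat \<lceil>1 / c\<rceil>)" using card[of F] by linarith
    qed
  qed
  then obtain F where F: "P F" "\<And>G. P G \<Longrightarrow> card G \<le> card F" by blast
  show ?thesis
  proof (rule that[of F])
    fix z assume z: "z \<in> S"
    show "\<exists>x\<in>F. mdist Y x z < r"
    proof (rule ccontr)
      assume "\<not> ?thesis"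
      then have far: "\<And>x. x \<in> F \<Longrightarrow> r \<le> mdist Y x z" by force
      have zY: "z \<in> mspace Y" using z S by auto
      have "z \<notin> F" using far[of z] r zY by auto
      moreover have "P (insert z F)"
        unfolding P_def
      proof (intro conjI ballI impI)
        fix x x' assume "x \<in> insert z F" "x' \<in> insert z F" "x \<noteq> x'"
        then show "r \<le> mdist Y x x'" using F(1) far[of x] far[of x'] YM.commute[of z x'] by (auto simp: P_def)
      qed (use F(1) z in \<open>auto simp: P_def\<close>)
      ultimately show False using F(2)[of "insert z F"] F(1) by (auto simp: P_def)
    qed
  qed (use F(1) card in \<open>auto simp: P_def\<close>)
qed

text \<open>Larger balls are reached by chaining: in a length space each point of the ball of radius
  \<open>(n + 2) * \<rho>\<close> is within \<open>\<rho>\<close> of the ball of radius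
  \<open>(n + 1) * \<rho>\<close>, so it suffices to cover the ball of radius
  \<open>2 * \<rho>\<close> about each old centre. The ratio \<open>1 / 12\<close> is
  \<open>\<rho> / (6 * (2 * \<rho>))\<close>.\<close>

lemma global_cover:
  assumes y: "y \<in> mspace Y" and \<rho>: "0 < \<rho>" "8 * \<rho> \<le> mcp_radius K N"
  shows "\<exists>F. finite F \<and> F \<subseteq> mspace Y \<and> real (card F) \<le> (1 / contraction_coeff N (1 / 12)) ^ n \<and>
     (\<forall>z\<in>mball_of Y y (real (Suc n) * \<rho>). \<exists>x\<in>F. mdist Y x z < \<rho>)"
proof (induction n)
  case 0
  then show ?case using y by (intro exI[of _ "{y}"]) auto
next
  case (Suc n)
  let ?c = "contraction_coeff N (1 / 12)"
  have c: "?c > 0" by (rule contraction_coeff_pos) simp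
  obtain F where F: "finite F" "F \<subseteq> mspace Y" "real (card F) \<le> (1 / ?c) ^ n"
    "\<And>z. z \<in> mball_of Y y (real (Suc n) * \<rho>) \<Longrightarrow> \<exists>x\<in>F. mdist Y x z < \<rho>" using Suc by blast
  have "\<exists>G. finite G \<and> G \<subseteq> mball_of Y x (2 * \<rho>) \<and> real (card G) \<le> 1 / ?c \<and>
     (\<forall>z\<in>mball_of Y x (2 * \<rho>). \<exists>x'\<in>G. mdist Y x' z < \<rho>)" if x: "x \<in> F" for x
  proof -
    have "x \<in> mspace Y" "\<rho> \<le> 2 * \<rho>" "4 * (2 * \<rho>) \<le> mcp_radius K N" using x F(2) \<rho> by auto
    moreover have "?c \<le> contraction_coeff N (\<rho> / (6 * (2 * \<rho>)))" using \<rho> by simp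
    ultimately obtain G where "finite G" "G \<subseteq> mball_of Y x (2 * \<rho>)" "real (card G) \<le> 1 / ?c"
      "\<And>z. z \<in> mball_of Y x (2 * \<rho>) \<Longrightarrow> \<exists>x'\<in>G. mdist Y x' z < \<rho>"
      using local_cover[OF _ \<rho>(1) _ _ order_refl c, of x] by metis
    then show ?thesis by blast
  qed
  then obtain G where G: "\<And>x. x \<in> F \<Longrightarrow> finite (G x)" "\<And>x. x \<in> F \<Longrightarrow> G x \<subseteq> mball_of Y x (2 * \<rho>)"
    "\<And>x. x \<in> F \<Longrightarrow> real (card (G x)) \<le> 1 / ?c"
    "\<And>x z. x \<in> F \<Longrightarrow> z \<in> mball_of Y x (2 * \<rho>) \<Longrightarrow> \<exists>x'\<in>G x. mdist Y x' z < \<rho>"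
    by metis
  show ?case
  proof (intro exI[of _ "\<Union>x\<in>F. G x"] conjI ballI)
    show "finite (\<Union>x\<in>F. G x)" using F G by auto
    show "(\<Union>x\<in>F. G x) \<subseteq> mspace Y" using G(2) by fastforce
    have "real (card (\<Union>x\<in>F. G x)) \<le> (\<Sum>x\<in>F. real (card (G x)))"
      using card_UN_le[OF F(1), of G] by (metis of_nat_le_iff of_nat_sum)
    also have "\<dots> \<le> real (card F) * (1 / ?c)" using G(3) by (intro sum_bounded_above) auto
    also have "\<dots> \<le> (1 / ?c) ^ n * (1 / ?c)" using F(3) c by (intro mult_right_mono) auto
    finally show "real (card (\<Union>x\<in>F. G x)) \<le> (1 / ?c) ^ Suc n" by (simp add: mult.commute)
    fix z assume z: "z \<in> mball_of Y y (real (Suc (Suc n)) * \<rho>)"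
    have "\<exists>w\<in>mball_of Y y (real (Suc n) * \<rho>). mdist Y w z \<le> \<rho>"
    proof (cases "mdist Y y z < real (Suc n) * \<rho>")
      case True
      then show ?thesis using z \<rho> by (intro bexI[of _ z]) auto
    next
      case False
      \<comment> \<open>On a path of length below \<open>(n + 2) * \<rho>\<close> from
        \<open>y\<close> to \<open>z\<close>, the point at distance exactly \<open>\<rho>\<close>
        from \<open>z\<close> is in the smaller ball.\<close>
      obtain c where c: "pathin (mtopology_of Y) c" "c 0 = y" "c 1 = z" "\<And>s. s \<in> {0..1} \<Longrightarrow> c s \<in> mspace Y"
        "\<And>s. s \<in> {0..1} \<Longrightarrow> mdist Y y (c s) + mdist Y (c s) z < real (Suc (Suc n)) * \<rho>"
        using length_space_path[OF len y, of z "real (Suc (Suc n)) * \<rho>"] z by auto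
      have "\<rho> \<le> real (Suc n) * \<rho>" using \<rho> by simp
      then have "\<rho> \<le> mdist Y z (c 0)" using False c YM.commute[of y z] by auto
      moreover have "mdist Y z (c 1) \<le> \<rho>" using c z \<rho> by auto
      ultimately obtain s where s: "s \<in> {0..1}" "mdist Y z (c s) = \<rho>"
        using path_mdist_attains[OF c(1), of z \<rho>] z by auto
      have "mdist Y y (c s) < real (Suc n) * \<rho>"
        using c(5)[OF s(1)] s(2) YM.commute[of z "c s"] by (simp add: algebra_simps)
      then show ?thesis using s c(4)[OF s(1)] y YM.commute[of z "c s"] by (intro bexI[of _ "c s"]) auto
    qed
    then obtain w where w: "w \<in> mball_of Y y (real (Suc n) * \<rho>)" "mdist Y w z \<le> \<rho>" by blast
    obtain x where x: "x \<in> F" "mdist Y x w < \<rho>" using F(4)[OF w(1)] by blast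
    have "z \<in> mball_of Y x (2 * \<rho>)" using x w z F(2) YM.triangle[of x w z] by auto
    then show "\<exists>x\<in>\<Union>x\<in>F. G x. mdist Y x z < \<rho>" using G(4)[OF x(1)] x(1) by blast
  qed
qed

end

text \<open>\<open>C\<close> is fixed before the space, its measure and the set \<open>S\<close>;
  this uniformity is what precompactness rests on. A cover at a scale where contraction is available
  is refined inside each of its balls, with centres in \<open>S\<close>.\<close>

lemma uniform_cover:
  assumes N: "N > 1" and r: "r > 0"
  obtains C :: nat where "\<And>(Y :: 'y metric) m y S. mcp_space K N Y m \<Longrightarrow> y \<in> mspace Y \<Longrightarrow> S \<subseteq> mball_of Y y k \<Longrightarrow>
    \<exists>F. finite F \<and> F \<subseteq> S \<and> card F \<le> C \<and> (\<forall>z\<in>S. \<exists>x\<in>F. mdist Y x z < r)"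
proof -
  define \<rho> where "\<rho> = mcp_radius K N / 8"
  have \<rho>: "\<rho> > 0" "8 * \<rho> \<le> mcp_radius K N" using mcp_radius_pos[OF N] by (auto simp: \<rho>_def)
  obtain n :: nat where "k / \<rho> < n" using reals_Archimedean2 by blast
  then have n: "k \<le> real (Suc n) * \<rho>" using \<rho> by (simp add: divide_less_eq algebra_simps)
  \<comment> \<open>\<open>local_cover\<close> asks for a mesh not larger than the radius of the
    ball.\<close>
  define r' where "r' = min r \<rho>"
  have r': "0 < r'" "r' \<le> \<rho>" "r' \<le> r" using r \<rho> by (auto simp: r'_def)
  let ?c = "contraction_coeff N (r' / (6 * \<rho>))" and ?e = "contraction_coeff N (1 / 12)"
  have c: "?c > 0" using r' \<rho> by (intro contraction_coeff_pos) auto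
  have c0: "?e > 0" by (intro contraction_coeff_pos) auto
  define C where "C = nat \<lceil>(1 / ?e) ^ n * (1 / ?c)\<rceil>"
  show ?thesis
  proof (rule that[of C])
    fix Y :: "'y metric" and m y S
    assume m: "mcp_space K N Y m" and y: "y \<in> mspace Y" and S: "S \<subseteq> mball_of Y y k"
    interpret mcp_space K N Y m by fact
    obtain F where F: "finite F" "F \<subseteq> mspace Y" "real (card F) \<le> (1 / ?e) ^ n"
      "\<And>z. z \<in> mball_of Y y (real (Suc n) * \<rho>) \<Longrightarrow> \<exists>x\<in>F. mdist Y x z < \<rho>"
      using global_cover[OF y \<rho>, of n] by blast
    have "\<exists>G. finite G \<and> G \<subseteq> S \<inter> mball_of Y x \<rho> \<and> real (card G) \<le> 1 / ?c \<and>
       (\<forall>z\<in>S \<inter> mball_of Y x \<rho>. \<exists>x'\<in>G. mdist Y x' z < r')" if x: "x \<in> F" for x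
    proof -
      have "x \<in> mspace Y" "4 * \<rho> \<le> mcp_radius K N" using x F(2) \<rho> by auto
      from local_cover[OF this(1) r'(1,2) this(2) Int_lower2 c order_refl, of S]
      show ?thesis by metis
    qed
    then obtain G where G: "\<And>x. x \<in> F \<Longrightarrow> finite (G x)" "\<And>x. x \<in> F \<Longrightarrow> G x \<subseteq> S \<inter> mball_of Y x \<rho>"
      "\<And>x. x \<in> F \<Longrightarrow> real (card (G x)) \<le> 1 / ?c"
      "\<And>x z. x \<in> F \<Longrightarrow> z \<in> S \<inter> mball_of Y x \<rho> \<Longrightarrow> \<exists>x'\<in>G x. mdist Y x' z < r'"
      by metis
    show "\<exists>F. finite F \<and> F \<subseteq> S \<and> card F \<le> C \<and> (\<forall>z\<in>S. \<exists>x\<in>F. mdist Y x z < r)"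
    proof (intro exI[of _ "\<Union>x\<in>F. G x"] conjI ballI)
      show "finite (\<Union>x\<in>F. G x)" using F G by auto
      show "(\<Union>x\<in>F. G x) \<subseteq> S" using G(2) by fastforce
      have "real (card (\<Union>x\<in>F. G x)) \<le> (\<Sum>x\<in>F. real (card (G x)))"
        using card_UN_le[OF F(1), of G] by (metis of_nat_le_iff of_nat_sum)
      also have "\<dots> \<le> real (card F) * (1 / ?c)" using G(3) by (intro sum_bounded_above) auto
      also have "\<dots> \<le> (1 / ?e) ^ n * (1 / ?c)" using F(3) c by (intro mult_right_mono) auto
      finally show "card (\<Union>x\<in>F. G x) \<le> C" unfolding C_def by linarith
      fix z assume z: "z \<in> S"
      have "z \<in> mball_of Y y (real (Suc n) * \<rho>)" using z S n by auto
      then obtain x where x: "x \<in> F" "mdist Y x z < \<rho>" using F(4) by blast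
      have "z \<in> S \<inter> mball_of Y x \<rho>" using x z F(2) S by auto
      then show "\<exists>x\<in>\<Union>x\<in>F. G x. mdist Y x z < r" using G(4)[OF x(1)] x(1) r'(3) by force
    qed
  qed
qed

section \<open>Limits of nets\<close>

lemma diagonal_convergent_subsequence:
  fixes g :: "nat \<Rightarrow> 'i::countable \<Rightarrow> real"
  assumes bd: "\<And>n i. \<bar>g n i\<bar> \<le> B i"
  obtains r :: "nat \<Rightarrow> nat" where "strict_mono r" "\<And>i. convergent (\<lambda>n. g (r n) i)"
proof -
  interpret subseqs "\<lambda>m s. convergent (\<lambda>n. g (s n) (from_nat m :: 'i))"
  proof
    fix m and s :: "nat \<Rightarrow> nat"
    have "bounded (range (\<lambda>n. g (s n) (from_nat m :: 'i)))"
      using bd by (intro boundedI[where B="B (from_nat m)"]) auto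
    then obtain l r where "strict_mono (r :: nat \<Rightarrow> nat)" "((\<lambda>n. g (s n) (from_nat m :: 'i)) \<circ> r) \<longlonglongrightarrow> l"
      using bounded_imp_convergent_subsequence by blast
    then show "\<exists>r'. strict_mono r' \<and> convergent (\<lambda>n. g ((s \<circ> r') n) (from_nat m :: 'i))"
      by (auto simp: convergent_def o_def)
  qed
  show ?thesis
  proof
    show "strict_mono diagseq" by (rule subseq_diagseq)
    fix i :: 'i
    \<comment> \<open>The diagonal sequence is a subsequence of the one selected for
      \<open>i\<close> only from index \<open>Suc (to_nat i)\<close> on; the initial segment does
      not affect convergence.\<close>
    have "convergent (\<lambda>n. g ((diagseq \<circ> (+) (Suc (to_nat i))) n) (from_nat (to_nat i) :: 'i))"
      by (rule diagseq_holds) (auto simp: o_def intro: convergent_subseq_convergent[unfolded o_def])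
    then have "convergent (\<lambda>n. g (diagseq (n + Suc (to_nat i))) i)" by (simp add: o_def add.commute)
    then show "convergent (\<lambda>n. g (diagseq n) i)"
      by (simp only: convergent_ignore_initial_segment[of "\<lambda>n. g (diagseq n) i" "Suc (to_nat i)"])
  qed
qed

lemma convergent_nat_eventually_const:
  assumes "convergent (\<lambda>n. real (a n))"
  obtains c :: nat where "\<forall>\<^sub>F n in sequentially. a n = c"
proof -
  have "Cauchy (\<lambda>n. real (a n))" using assms by (rule convergent_Cauchy)
  then obtain n0 where n0: "\<And>m n. m \<ge> n0 \<Longrightarrow> n \<ge> n0 \<Longrightarrow> dist (real (a m)) (real (a n)) < 1"
    using zero_less_one unfolding Cauchy_def by metis
  show ?thesis
  proof (rule that[of "a n0"])
    show "\<forall>\<^sub>F n in sequentially. a n = a n0"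
      unfolding eventually_sequentially
    proof (intro exI[of _ n0] allI impI)
      fix n assume "n0 \<le> n"
      then have "\<bar>real (a n) - real (a n0)\<bar> < 1" using n0[of n n0] by (simp add: dist_real_def)
      then show "a n = a n0" by linarith
    qed
  qed
qed

text \<open>A finite disjunction that holds eventually could switch between its members. As each
  member is eventually decided, this is excluded.\<close>

lemma eventually_const_pigeonhole:
  assumes fin: "finite A" and ev: "\<forall>\<^sub>F n in sequentially. \<exists>j\<in>A. P j n"
    and const: "\<And>j. j \<in> A \<Longrightarrow> (\<forall>\<^sub>F n in sequentially. P j n) \<or> (\<forall>\<^sub>F n in sequentially. \<not> P j n)"
  obtains j where "j \<in> A" "\<forall>\<^sub>F n in sequentially. P j n"
proof (rule ccontr)
  assume neg: "\<not> thesis"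
  have "\<forall>j\<in>A. \<forall>\<^sub>F n in sequentially. \<not> P j n" using const neg that by blast
  then have "\<forall>\<^sub>F n in sequentially. \<forall>j\<in>A. \<not> P j n" by (rule eventually_ball_finite[OF fin])
  with ev have "\<forall>\<^sub>F n in sequentially. False" by eventually_elim auto
  then show False by simp
qed

text \<open>The limit has to be finite: a finite number has infinite \<open>ennreal_absdiff\<close>
  from infinity, however large it is.\<close>

lemma ennreal_absdiff_tendsto_0:
  assumes f: "f \<longlonglongrightarrow> ennreal T" and T: "0 \<le> T"
  shows "(\<lambda>n. ennreal_absdiff (f n) (ennreal T)) \<longlonglongrightarrow> 0"
proof -
  have "\<forall>\<^sub>F n in sequentially. f n < \<infinity>" using order_tendstoD(2)[OF f, of \<infinity>] by simp
  then have le: "\<forall>\<^sub>F n in sequentially. ennreal_absdiff (f n) (ennreal T) \<le> ennreal \<bar>enn2real (f n) - T\<bar>"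
  proof eventually_elim
    case (elim n)
    then obtain x where x: "f n = ennreal x" "0 \<le> x" by (cases "f n") auto
    show ?case using x T
      by (auto simp: ennreal_absdiff_def ennreal_minus max_def intro!: ennreal_leI)
  qed
  have "(\<lambda>n. enn2real (f n)) \<longlonglongrightarrow> T" using tendsto_enn2real[OF f T] .
  then have "(\<lambda>n. \<bar>enn2real (f n) - T\<bar>) \<longlonglongrightarrow> \<bar>T - T\<bar>" by (intro tendsto_rabs tendsto_diff tendsto_const)
  then have "(\<lambda>n. ennreal \<bar>enn2real (f n) - T\<bar>) \<longlonglongrightarrow> ennreal 0"
    by (intro tendsto_ennrealI) simp
  then show ?thesis
    by (intro tendsto_sandwich[OF _ le tendsto_const]) auto
qed

lemma lpls_trans:
  assumes "lorentzian_pre_length_space X" "caus X p q" "caus X q r" "p \<in> lcarrier X" "q \<in> lcarrier X" "r \<in> lcarrier X"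
  shows "caus X p r" "tsep X p q + tsep X q r \<le> tsep X p r"
  using assms unfolding lorentzian_pre_length_space_def by blast+

lemma lpls_refl: "lorentzian_pre_length_space X \<Longrightarrow> p \<in> lcarrier X \<Longrightarrow> caus X p p"
  unfolding lorentzian_pre_length_space_def by blast

lemma lpls_caus_of_tsep:
  assumes X: "lorentzian_pre_length_space X" and pq: "0 < tsep X p q" "p \<in> lcarrier X" "q \<in> lcarrier X"
  shows "caus X p q"
proof -
  have 1: "\<forall>p\<in>lcarrier X. \<forall>q\<in>lcarrier X. chron X p q \<longrightarrow> caus X p q"
    using X unfolding lorentzian_pre_length_space_def by (elim conjE)
  have 2: "\<forall>p\<in>lcarrier X. \<forall>q\<in>lcarrier X. 0 < tsep X p q \<longleftrightarrow> chron X p q"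
    using X unfolding lorentzian_pre_length_space_def by (elim conjE)
  show ?thesis using pq 1[rule_format, of p q] 2[rule_format, of p q] by simp
qed

section \<open>The space of eventual vertices\<close>

type_synonym vertex_index = "nat \<times> nat \<times> nat \<times> bool"

text \<open>An address consists of the index of the cover, the level, the position in the list and
  the end of the diamond. It makes vertices of different spaces comparable. Beyond the end of a list
  the value is unspecified.\<close>

definition vertex :: "(nat \<Rightarrow> nat \<Rightarrow> ('a \<times> 'a) list) \<Rightarrow> vertex_index \<Rightarrow> 'a" where
  "vertex S = (\<lambda>(k, l, i, s). if s then fst (S k l ! i) else snd (S k l ! i))"

lemma image_times_bool:
  "(\<lambda>(i, s). g i s) ` (I \<times> UNIV) = (\<lambda>i. g i True) ` I \<union> (\<lambda>i. g i False) ` I"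
  by (auto simp: UNIV_bool)

lemma net_vertices_vertex:
  "net_vertices (S k l) = (\<lambda>(i, s). vertex S (k, l, i, s)) ` ({..<length (S k l)} \<times> UNIV)"
proof -
  have "f ` set xs = (\<lambda>i. f (xs ! i)) ` {..<length xs}" for f :: "'a \<times> 'a \<Rightarrow> 'a" and xs
    by (auto simp: set_conv_nth)
  then show ?thesis unfolding net_vertices_def image_times_bool by (simp add: vertex_def)
qed

text \<open>The discrete metric makes lower semicontinuity trivial, and forward density is witnessed by
  constant sequences.\<close>

locale vertex_limit =
  fixes X :: "nat \<Rightarrow> 'a lspace" and U :: "nat \<Rightarrow> nat \<Rightarrow> 'a set"
    and S :: "nat \<Rightarrow> nat \<Rightarrow> nat \<Rightarrow> ('a \<times> 'a) list" and len :: "nat \<Rightarrow> nat \<Rightarrow> nat"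
  assumes lpls: "\<And>n. lorentzian_pre_length_space (X n)"
    and nets: "\<And>k l. l \<ge> 1 \<Longrightarrow> \<forall>\<^sub>F n in sequentially. finite_net (X n) (U n k) (1 / real l) (S n k l) \<and>
      length (S n k l) = len k l \<and> net_vertices (S n k l) \<subseteq> net_vertices (S n k (Suc l)) \<and>
      net_vertices (S n k l) \<subseteq> net_vertices (S n (Suc k) l)"
    and cover: "\<And>k l k' l'. l \<ge> 1 \<Longrightarrow> l' \<ge> 1 \<Longrightarrow> k \<le> k' \<Longrightarrow> \<forall>\<^sub>F n in sequentially. \<forall>v\<in>net_vertices (S n k l).
      \<exists>(p, q)\<in>set (S n k' l'). v \<in> causal_diamond (X n) p q"
    and const_eq: "\<And>\<iota> \<iota>'. (\<forall>\<^sub>F n in sequentially. vertex (S n) \<iota> = vertex (S n) \<iota>') \<or>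
      (\<forall>\<^sub>F n in sequentially. vertex (S n) \<iota> \<noteq> vertex (S n) \<iota>')"
    and const_caus: "\<And>\<iota> \<iota>'. (\<forall>\<^sub>F n in sequentially. caus (X n) (vertex (S n) \<iota>) (vertex (S n) \<iota>')) \<or>
      (\<forall>\<^sub>F n in sequentially. \<not> caus (X n) (vertex (S n) \<iota>) (vertex (S n) \<iota>'))"
    and conv: "\<And>k l i s k' l' i' s'. l \<ge> 1 \<Longrightarrow> i < len k l \<Longrightarrow> l' \<ge> 1 \<Longrightarrow> i' < len k' l' \<Longrightarrow>
      \<exists>T\<ge>0. (\<lambda>n. tsep (X n) (vertex (S n) (k, l, i, s)) (vertex (S n) (k', l', i', s'))) \<longlonglongrightarrow> ennreal T"
begin

abbreviation w :: "nat \<Rightarrow> vertex_index \<Rightarrow> 'a" where "w n \<equiv> vertex (S n)"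

definition level :: "nat \<Rightarrow> nat \<Rightarrow> vertex_index set" where
  "level k l = (\<lambda>(i, s). (k, l, i, s)) ` ({..<len k l} \<times> UNIV)"

definition valid :: "vertex_index set" where "valid = (\<Union>k. \<Union>l\<in>{1..}. level k l)"

lemma finite_level: "finite (level k l)" by (auto simp: level_def)

lemma level_valid: "l \<ge> 1 \<Longrightarrow> \<iota> \<in> level k l \<Longrightarrow> \<iota> \<in> valid" by (auto simp: valid_def)

lemma net_vertices_level:
  assumes "l \<ge> 1" shows "\<forall>\<^sub>F n in sequentially. net_vertices (S n k l) = w n ` level k l"
  using nets[OF assms, of k]
proof eventually_elim
  case (elim n)
  then show ?case unfolding net_vertices_vertex level_def by (auto simp: image_iff)
qed

definition same :: "vertex_index \<Rightarrow> vertex_index \<Rightarrow> bool" where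
  "same \<iota> \<iota>' \<longleftrightarrow> (\<forall>\<^sub>F n in sequentially. w n \<iota> = w n \<iota>')"

text \<open>The class of eventually equal addresses is represented by its least code number, so that
  the limit space is carried by real numbers.\<close>

definition pt :: "vertex_index \<Rightarrow> real" where
  "pt \<iota> = real (LEAST c. same \<iota> (from_nat c))"

lemma same_refl: "same \<iota> \<iota>" by (simp add: same_def)

lemma same_sym: "same \<iota> \<iota>' \<Longrightarrow> same \<iota>' \<iota>"
  unfolding same_def by (erule eventually_mono) simp

lemma same_trans: "same \<iota> \<iota>' \<Longrightarrow> same \<iota>' \<iota>'' \<Longrightarrow> same \<iota> \<iota>''"
  unfolding same_def by (erule (1) eventually_elim2) simp

lemma pt_eq_iff: "pt \<iota> = pt \<iota>' \<longleftrightarrow> same \<iota> \<iota>'"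
proof
  have ex: "same \<iota> (from_nat (LEAST c. same \<iota> (from_nat c)))" for \<iota>
    by (rule LeastI[of _ "to_nat \<iota>"]) (simp add: same_refl)
  assume "pt \<iota> = pt \<iota>'"
  then show "same \<iota> \<iota>'" using ex[of \<iota>] ex[of \<iota>'] same_sym same_trans unfolding pt_def by (metis of_nat_eq_iff)
next
  assume "same \<iota> \<iota>'"
  then have "same \<iota> (from_nat c) \<longleftrightarrow> same \<iota>' (from_nat c)" for c using same_sym same_trans by blast
  then show "pt \<iota> = pt \<iota>'" by (simp add: pt_def)
qed

text \<open>The representative is chosen among the valid addresses because limits of time
  separations are guaranteed only for these.\<close>

definition idx :: "real \<Rightarrow> vertex_index" where
  "idx x = (SOME \<iota>. \<iota> \<in> valid \<and> pt \<iota> = x)"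

lemma idx_pt: assumes "\<iota> \<in> valid" shows "idx (pt \<iota>) \<in> valid" "same (idx (pt \<iota>)) \<iota>"
proof -
  have "idx (pt \<iota>) \<in> valid \<and> pt (idx (pt \<iota>)) = pt \<iota>"
    unfolding idx_def by (rule someI[of _ \<iota>]) (use assms in auto)
  then show "idx (pt \<iota>) \<in> valid" "same (idx (pt \<iota>)) \<iota>" using pt_eq_iff by auto
qed

definition tlim :: "vertex_index \<Rightarrow> vertex_index \<Rightarrow> ennreal" where
  "tlim \<iota> \<iota>' = lim (\<lambda>n. tsep (X n) (w n \<iota>) (w n \<iota>'))"

definition cle :: "vertex_index \<Rightarrow> vertex_index \<Rightarrow> bool" where
  "cle \<iota> \<iota>' \<longleftrightarrow> (\<forall>\<^sub>F n in sequentially. caus (X n) (w n \<iota>) (w n \<iota>'))"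

lemma tlim: assumes "\<iota> \<in> valid" "\<iota>' \<in> valid"
  shows "(\<lambda>n. tsep (X n) (w n \<iota>) (w n \<iota>')) \<longlonglongrightarrow> tlim \<iota> \<iota>'" "tlim \<iota> \<iota>' < \<infinity>"
proof -
  obtain T where T: "(\<lambda>n. tsep (X n) (w n \<iota>) (w n \<iota>')) \<longlonglongrightarrow> ennreal T"
    using assms conv by (fastforce simp: valid_def level_def)
  then have "tlim \<iota> \<iota>' = ennreal T" unfolding tlim_def by (rule limI)
  then show "(\<lambda>n. tsep (X n) (w n \<iota>) (w n \<iota>')) \<longlonglongrightarrow> tlim \<iota> \<iota>'" "tlim \<iota> \<iota>' < \<infinity>" using T by auto
qed

lemma valid_carrier: assumes "\<iota> \<in> valid" shows "\<forall>\<^sub>F n in sequentially. w n \<iota> \<in> lcarrier (X n)"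
proof -
  obtain k l where kl: "l \<ge> 1" "\<iota> \<in> level k l" using assms by (auto simp: valid_def)
  show ?thesis using nets[OF kl(1), of k] net_vertices_level[OF kl(1), of k]
  proof eventually_elim
    case (elim n)
    then have "w n \<iota> \<in> net_vertices (S n k l)" using kl by auto
    then show ?case using elim(1) unfolding net_vertices_def finite_net_def by fastforce
  qed
qed

text \<open>Chronology is read off from the limiting time separation and not taken as the eventual
  relation of the vertices, since positive time separations may tend to 0.\<close>

definition lim_space :: "real lspace" where
  "lim_space = \<lparr>lmetric = metric (pt ` valid, discrete_metric.dd),
     chron = (\<lambda>x y. 0 < tlim (idx x) (idx y)), caus = (\<lambda>x y. cle (idx x) (idx y)), tsep = (\<lambda>x y. tlim (idx x) (idx y))\<rparr>"

lemma lim_carrier [simp]: "lcarrier lim_space = pt ` valid"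
  by (simp add: lim_space_def Metric_space.mspace_metric[OF metric_M_dd])

lemma lim_topology: "mtopology_of (lmetric lim_space) = discrete_topology (pt ` valid)"
  by (simp add: lim_space_def mtopology_of_def Metric_space.mspace_metric[OF metric_M_dd]
     Metric_space.mdist_metric[OF metric_M_dd] discrete_metric.mtopology_discrete_metric)

lemma cle_cong: assumes "same \<iota>1 \<iota>1'" "same \<iota>2 \<iota>2'" shows "cle \<iota>1 \<iota>2 \<longleftrightarrow> cle \<iota>1' \<iota>2'"
  unfolding cle_def
proof (rule eventually_subst)
  show "\<forall>\<^sub>F n in sequentially. caus (X n) (w n \<iota>1) (w n \<iota>2) = caus (X n) (w n \<iota>1') (w n \<iota>2')"
    using assms unfolding same_def by eventually_elim simp
qed

lemma tlim_cong: assumes "same \<iota>1 \<iota>1'" "same \<iota>2 \<iota>2'" "\<iota>1 \<in> valid" "\<iota>2 \<in> valid" "\<iota>1' \<in> valid" "\<iota>2' \<in> valid"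
  shows "tlim \<iota>1 \<iota>2 = tlim \<iota>1' \<iota>2'"
proof -
  have "\<forall>\<^sub>F n in sequentially. tsep (X n) (w n \<iota>1) (w n \<iota>2) = tsep (X n) (w n \<iota>1') (w n \<iota>2')"
    using assms(1,2) unfolding same_def by eventually_elim simp
  then have "(\<lambda>n. tsep (X n) (w n \<iota>1') (w n \<iota>2')) \<longlonglongrightarrow> tlim \<iota>1 \<iota>2"
    by (rule Lim_transform_eventually[OF tlim(1)[OF assms(3,4)]])
  then show ?thesis using tlim(1)[OF assms(5,6)] LIMSEQ_unique by blast
qed

lemma lim_caus: assumes "\<iota> \<in> valid" "\<iota>' \<in> valid" shows "caus lim_space (pt \<iota>) (pt \<iota>') \<longleftrightarrow> cle \<iota> \<iota>'"
  using cle_cong[OF idx_pt(2)[OF assms(1)] idx_pt(2)[OF assms(2)]] by (simp add: lim_space_def)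

lemma lim_tsep: assumes "\<iota> \<in> valid" "\<iota>' \<in> valid" shows "tsep lim_space (pt \<iota>) (pt \<iota>') = tlim \<iota> \<iota>'"
  using tlim_cong[OF idx_pt(2)[OF assms(1)] idx_pt(2)[OF assms(2)] idx_pt(1)[OF assms(1)] idx_pt(1)[OF assms(2)] assms]
  by (simp add: lim_space_def)

lemma lim_chron: "chron lim_space x y \<longleftrightarrow> 0 < tsep lim_space x y"
  by (simp add: lim_space_def)

lemma cle_refl: "\<iota> \<in> valid \<Longrightarrow> cle \<iota> \<iota>"
  unfolding cle_def using valid_carrier[of \<iota>] by (auto elim!: eventually_mono intro: lpls_refl[OF lpls])

lemma cle_trans:
  assumes v: "\<iota>1 \<in> valid" "\<iota>2 \<in> valid" "\<iota>3 \<in> valid" and c: "cle \<iota>1 \<iota>2" "cle \<iota>2 \<iota>3"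
  shows "cle \<iota>1 \<iota>3" "tlim \<iota>1 \<iota>2 + tlim \<iota>2 \<iota>3 \<le> tlim \<iota>1 \<iota>3"
proof -
  have *: "\<forall>\<^sub>F n in sequentially. caus (X n) (w n \<iota>1) (w n \<iota>3) \<and>
     tsep (X n) (w n \<iota>1) (w n \<iota>2) + tsep (X n) (w n \<iota>2) (w n \<iota>3) \<le> tsep (X n) (w n \<iota>1) (w n \<iota>3)"
    using c[unfolded cle_def] v[THEN valid_carrier]
    by eventually_elim (auto intro: lpls_trans[OF lpls])
  then show "cle \<iota>1 \<iota>3" unfolding cle_def by (rule eventually_mono) simp
  have "(\<lambda>n. tsep (X n) (w n \<iota>1) (w n \<iota>2) + tsep (X n) (w n \<iota>2) (w n \<iota>3)) \<longlonglongrightarrow> tlim \<iota>1 \<iota>2 + tlim \<iota>2 \<iota>3"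
    by (intro tendsto_add tlim v)
  moreover have "\<forall>\<^sub>F n in sequentially. tsep (X n) (w n \<iota>1) (w n \<iota>2) + tsep (X n) (w n \<iota>2) (w n \<iota>3) \<le> tsep (X n) (w n \<iota>1) (w n \<iota>3)"
    using * by (rule eventually_mono) simp
  ultimately show "tlim \<iota>1 \<iota>2 + tlim \<iota>2 \<iota>3 \<le> tlim \<iota>1 \<iota>3"
    using tlim(1)[OF v(1,3)] by (intro tendsto_le[OF sequentially_bot]) auto
qed

lemma cle_of_tlim: assumes "\<iota> \<in> valid" "\<iota>' \<in> valid" "0 < tlim \<iota> \<iota>'" shows "cle \<iota> \<iota>'"
  unfolding cle_def using order_tendstoD(1)[OF tlim(1)[OF assms(1,2)] assms(3)] assms(1,2)[THEN valid_carrier]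
  by eventually_elim (auto intro: lpls_caus_of_tsep[OF lpls])

lemma lim_lpls: "lorentzian_pre_length_space lim_space"
proof -
  have chron: "caus lim_space p q" if "p \<in> pt ` valid" "q \<in> pt ` valid" "chron lim_space p q" for p q
    using that by (auto simp: lim_chron lim_tsep lim_caus intro: cle_of_tlim)
  have tri: "tsep lim_space p q + tsep lim_space q r \<le> tsep lim_space p r"
    if "p \<in> pt ` valid" "q \<in> pt ` valid" "r \<in> pt ` valid" "caus lim_space p q" "caus lim_space q r" for p q r
    using that by (auto simp: lim_tsep lim_caus intro: cle_trans)
  have refl: "caus lim_space p p" if "p \<in> pt ` valid" for p using that by (auto simp: lim_caus intro: cle_refl)
  have trans: "caus lim_space p r"
    if "p \<in> pt ` valid" "q \<in> pt ` valid" "r \<in> pt ` valid" "caus lim_space p q" "caus lim_space q r" for p q r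
    using that by (auto simp: lim_caus intro: cle_trans(1))
  have chron_trans: "chron lim_space p r"
    if "p \<in> pt ` valid" "q \<in> pt ` valid" "r \<in> pt ` valid" "chron lim_space p q" "chron lim_space q r" for p q r
  proof -
    have "0 < tsep lim_space p q" using that lim_chron by simp
    also have "\<dots> \<le> tsep lim_space p q + tsep lim_space q r" by simp
    also have "\<dots> \<le> tsep lim_space p r" using that chron by (intro tri) auto
    finally show ?thesis by (simp add: lim_chron)
  qed
  have op: "\<forall>c. openin (prod_topology (mtopology_of (lmetric lim_space)) (mtopology_of (lmetric lim_space)))
            {(p, q) \<in> pt ` valid \<times> pt ` valid. c < tsep lim_space p q}"
    unfolding lim_topology prod_topology_discrete_topology[symmetric] by auto
  let ?V = "pt ` valid"
  have 1: "\<forall>p\<in>?V. \<forall>q\<in>?V. chron lim_space p q \<longrightarrow> caus lim_space p q" using chron by blast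
  have 2: "\<forall>p\<in>?V. caus lim_space p p" using refl by blast
  have 3: "\<forall>p\<in>?V. \<forall>q\<in>?V. \<forall>r\<in>?V. caus lim_space p q \<and> caus lim_space q r \<longrightarrow> caus lim_space p r"
    using trans by blast
  have 4: "\<forall>p\<in>?V. \<forall>q\<in>?V. \<forall>r\<in>?V. chron lim_space p q \<and> chron lim_space q r \<longrightarrow> chron lim_space p r"
    using chron_trans by blast
  have 5: "\<forall>p\<in>?V. \<forall>q\<in>?V. \<forall>r\<in>?V. caus lim_space p q \<and> caus lim_space q r \<longrightarrow>
      tsep lim_space p q + tsep lim_space q r \<le> tsep lim_space p r" using tri by blast
  have 6: "\<forall>p\<in>?V. \<forall>q\<in>?V. 0 < tsep lim_space p q \<longleftrightarrow> chron lim_space p q" using lim_chron by blast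
  show ?thesis unfolding lorentzian_pre_length_space_def lim_carrier
    by (intro conjI 1 2 3 4 5 6 op)
qed

text \<open>All vertices of the nets of \<open>U n k\<close> become points of the limit set,
  including those outside \<open>U n k\<close>. This is the reason for the locale assumption
  \<open>cover\<close>.\<close>

definition lim_cover :: "nat \<Rightarrow> real set" where
  "lim_cover k = (\<Union>l\<in>{1..}. pt ` level k l)"

definition lim_net :: "nat \<Rightarrow> nat \<Rightarrow> (real \<times> real) list" where
  "lim_net k l = map (\<lambda>i. (pt (k, l, i, True), pt (k, l, i, False))) [0..<len k l]"

lemma lim_net_vertices: "net_vertices (lim_net k l) = pt ` level k l"
  unfolding level_def image_image case_prod_beta net_vertices_def lim_net_def
  using image_times_bool[of "\<lambda>i s. pt (k, l, i, s)" "{..<len k l}"]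
  by (simp add: case_prod_beta image_image lessThan_atLeast0)

text \<open>The matching address could depend on \<open>n\<close>. There are finitely many
  candidates, and coincidence with each is eventually decided, so one of them serves for all large
  \<open>n\<close>.\<close>

lemma level_transfer:
  assumes l: "l' \<ge> 1" and \<iota>: "\<iota> \<in> level k l"
    and ev: "\<forall>\<^sub>F n in sequentially. w n \<iota> \<in> net_vertices (S n k' l')"
  obtains \<iota>' where "\<iota>' \<in> level k' l'" "same \<iota> \<iota>'"
proof -
  have ex: "\<forall>\<^sub>F n in sequentially. \<exists>\<iota>'\<in>level k' l'. w n \<iota> = w n \<iota>'"
    using ev net_vertices_level[OF l, of k'] by eventually_elim auto
  show ?thesis
  proof (rule eventually_const_pigeonhole[OF finite_level ex const_eq])
    fix \<iota>' assume "\<iota>' \<in> level k' l'" "\<forall>\<^sub>F n in sequentially. w n \<iota> = w n \<iota>'"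
    then show ?thesis by (intro that) (simp_all add: same_def)
  qed
qed

lemma level_Suc:
  assumes "l \<ge> 1" "\<iota> \<in> level k l"
  obtains \<iota>' where "\<iota>' \<in> level k (Suc l)" "same \<iota> \<iota>'"
proof (rule level_transfer[OF _ assms(2)])
  show "\<forall>\<^sub>F n in sequentially. w n \<iota> \<in> net_vertices (S n k (Suc l))"
    using nets[OF assms(1), of k] net_vertices_level[OF assms(1), of k]
    by eventually_elim (use assms(2) in auto)
qed (use that in auto)

lemma level_Suc_cover:
  assumes "l \<ge> 1" "\<iota> \<in> level k l"
  obtains \<iota>' where "\<iota>' \<in> level (Suc k) l" "same \<iota> \<iota>'"
proof (rule level_transfer[OF assms])
  show "\<forall>\<^sub>F n in sequentially. w n \<iota> \<in> net_vertices (S n (Suc k) l)"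
    using nets[OF assms(1), of k] net_vertices_level[OF assms(1), of k]
    by eventually_elim (use assms(2) in auto)
qed (use that in auto)

lemma index_level: "i < len k l \<Longrightarrow> (k, l, i, s) \<in> level k l"
  by (force simp: level_def)

text \<open>The same selection, now of a diamond that contains a given vertex. It makes each limit
  net cover the vertices of all levels.\<close>

lemma level_covered:
  assumes "l \<ge> 1" "l' \<ge> 1" "k \<le> k'" "\<iota> \<in> level k l"
  obtains i where "i < len k' l'" "cle (k', l', i, True) \<iota>" "cle \<iota> (k', l', i, False)"
proof -
  let ?P = "\<lambda>i n. caus (X n) (w n (k', l', i, True)) (w n \<iota>) \<and> caus (X n) (w n \<iota>) (w n (k', l', i, False))"
  have "\<forall>\<^sub>F n in sequentially. \<exists>i\<in>{..<len k' l'}. ?P i n"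
    using cover[OF assms(1-3)] net_vertices_level[OF assms(1), of k] nets[OF assms(2), of k']
  proof eventually_elim
    case (elim n)
    then obtain p q where pq: "(p, q) \<in> set (S n k' l')" "w n \<iota> \<in> causal_diamond (X n) p q"
      using assms(4) by blast
    then obtain i where i: "i < length (S n k' l')" "S n k' l' ! i = (p, q)" by (auto simp: in_set_conv_nth)
    then show ?case using pq elim by (intro bexI[of _ i]) (auto simp: vertex_def causal_diamond_def)
  qed
  moreover have "(\<forall>\<^sub>F n in sequentially. ?P i n) \<or> (\<forall>\<^sub>F n in sequentially. \<not> ?P i n)" for i
  proof -
    consider "\<forall>\<^sub>F n in sequentially. \<not> caus (X n) (w n (k', l', i, True)) (w n \<iota>)"
      | "\<forall>\<^sub>F n in sequentially. \<not> caus (X n) (w n \<iota>) (w n (k', l', i, False))"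
      | "\<forall>\<^sub>F n in sequentially. caus (X n) (w n (k', l', i, True)) (w n \<iota>)"
        "\<forall>\<^sub>F n in sequentially. caus (X n) (w n \<iota>) (w n (k', l', i, False))"
      using const_caus by blast
    then show ?thesis
    proof cases
      case 1
      then show ?thesis by (intro disjI2) (erule eventually_mono, simp)
    next
      case 2
      then show ?thesis by (intro disjI2) (erule eventually_mono, simp)
    next
      case 3
      then show ?thesis by (intro disjI1 eventually_conj)
    qed
  qed
  ultimately show ?thesis
  proof (rule eventually_const_pigeonhole[OF finite_lessThan])
    fix i assume "i \<in> {..<len k' l'}" "\<forall>\<^sub>F n in sequentially. ?P i n"
    then show ?thesis using that[of i] by (simp add: cle_def eventually_conj_iff)
  qed
qed

lemma lim_net_diamond:
  assumes "l \<ge> 1" "i < len k l"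
  shows "cle (k, l, i, True) (k, l, i, False)" "tlim (k, l, i, True) (k, l, i, False) \<le> ennreal (1 / real l)"
proof -
  have *: "\<forall>\<^sub>F n in sequentially. caus (X n) (w n (k, l, i, True)) (w n (k, l, i, False)) \<and>
     tsep (X n) (w n (k, l, i, True)) (w n (k, l, i, False)) \<le> ennreal (1 / real l)"
    using nets[OF assms(1), of k]
  proof eventually_elim
    case (elim n)
    obtain p q where pq: "S n k l ! i = (p, q)" by fastforce
    then have "(p, q) \<in> set (S n k l)" using elim assms(2) by (metis nth_mem)
    then have f: "p \<in> lcarrier (X n)" "q \<in> lcarrier (X n)" "tsep (X n) p q \<le> ennreal (1 / real l)"
       "U n k \<inter> causal_diamond (X n) p q \<noteq> {}"
      using elim by (auto simp: finite_net_def)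
    then obtain x where "x \<in> lcarrier (X n)" "caus (X n) p x" "caus (X n) x q" by (auto simp: causal_diamond_def)
    then have "caus (X n) p q" using lpls_trans(1)[OF lpls] f by blast
    then show ?case using f pq by (simp add: vertex_def)
  qed
  then show "cle (k, l, i, True) (k, l, i, False)" unfolding cle_def by (rule eventually_mono) simp
  show "tlim (k, l, i, True) (k, l, i, False) \<le> ennreal (1 / real l)"
    using assms * by (intro tendsto_upperbound[OF tlim(1)]) (auto elim!: eventually_mono intro: level_valid index_level)
qed

lemma lim_finite_net: assumes l: "l \<ge> 1" shows "finite_net lim_space (lim_cover k) (1 / real l) (lim_net k l)"
  unfolding finite_net_def
proof (intro conjI ballI)
  fix pq assume "pq \<in> set (lim_net k l)"
  then obtain i where i: "i < len k l" "pq = (pt (k, l, i, True), pt (k, l, i, False))"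
    by (auto simp: lim_net_def)
  have v: "(k, l, i, s) \<in> valid" for s using level_valid[OF l index_level[OF i(1)]] .
  have "pt (k, l, i, True) \<in> lim_cover k \<inter> causal_diamond lim_space (pt (k, l, i, True)) (pt (k, l, i, False))"
    using l index_level[OF i(1)] v lim_net_diamond[OF l i(1)] cle_refl
    by (auto simp: lim_cover_def causal_diamond_def lim_caus)
  then show "case pq of (p, q) \<Rightarrow> p \<in> lcarrier lim_space \<and> q \<in> lcarrier lim_space \<and>
      tsep lim_space p q \<le> ennreal (1 / real l) \<and> lim_cover k \<inter> causal_diamond lim_space p q \<noteq> {}"
    using v lim_net_diamond[OF l i(1)] i by (auto simp: lim_tsep)
next
  show "lim_cover k \<subseteq> (\<Union>(p, q)\<in>set (lim_net k l). causal_diamond lim_space p q)"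
  proof
    fix x assume "x \<in> lim_cover k"
    then obtain l' \<iota> where \<iota>: "l' \<ge> 1" "\<iota> \<in> level k l'" "x = pt \<iota>" by (auto simp: lim_cover_def)
    obtain i where i: "i < len k l" "cle (k, l, i, True) \<iota>" "cle \<iota> (k, l, i, False)"
      using level_covered[OF \<iota>(1) l order_refl \<iota>(2)] .
    have v: "(k, l, i, s) \<in> valid" "\<iota> \<in> valid" for s
      using level_valid[OF l index_level[OF i(1)]] level_valid \<iota> by auto
    then have "x \<in> causal_diamond lim_space (pt (k, l, i, True)) (pt (k, l, i, False))"
      using i \<iota> by (auto simp: causal_diamond_def lim_caus)
    moreover have "(pt (k, l, i, True), pt (k, l, i, False)) \<in> set (lim_net k l)"
      using i by (auto simp: lim_net_def)
    ultimately show "x \<in> (\<Union>(p, q)\<in>set (lim_net k l). causal_diamond lim_space p q)" by blast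
  qed
qed

lemma lim_covered: "covered_lpls (lim_space, lim_cover)"
proof -
  have "lim_cover k \<subseteq> lim_cover (Suc k)" for k
  proof
    fix x assume "x \<in> lim_cover k"
    then obtain l \<iota> where \<iota>: "l \<ge> 1" "\<iota> \<in> level k l" "x = pt \<iota>" by (auto simp: lim_cover_def)
    obtain \<iota>' where "\<iota>' \<in> level (Suc k) l" "same \<iota> \<iota>'" using level_Suc_cover[OF \<iota>(1,2)] .
    then show "x \<in> lim_cover (Suc k)"
      using \<iota> pt_eq_iff[of \<iota> \<iota>'] unfolding lim_cover_def by (intro UN_I[of l]) auto
  qed
  moreover have "(\<Union>k. lim_cover k) = pt ` valid" by (auto simp: lim_cover_def valid_def)
  ultimately show ?thesis by (simp add: covered_lpls_def lim_lpls)
qed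

text \<open>Equal addresses are paired, so the nets match by construction. It need not be a map in
  either direction, as coincidences of vertices at a given \<open>n\<close> may differ from the
  eventual ones.\<close>

definition lim_rel :: "nat \<Rightarrow> nat \<Rightarrow> nat \<Rightarrow> ('a \<times> real) set" where
  "lim_rel n k l = (\<lambda>\<iota>. (w n \<iota>, pt \<iota>)) ` level k l"

lemma lim_rel_mono: assumes l: "l \<ge> 1" shows "\<forall>\<^sub>F n in sequentially. lim_rel n k l \<subseteq> lim_rel n k (Suc l)"
proof -
  have "\<forall>\<iota>\<in>level k l. \<forall>\<^sub>F n in sequentially. (w n \<iota>, pt \<iota>) \<in> lim_rel n k (Suc l)"
  proof
    fix \<iota> assume \<iota>: "\<iota> \<in> level k l"
    obtain \<iota>' where \<iota>': "\<iota>' \<in> level k (Suc l)" "same \<iota> \<iota>'" using level_Suc[OF l \<iota>] .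
    then have "pt \<iota> = pt \<iota>'" using pt_eq_iff by simp
    then show "\<forall>\<^sub>F n in sequentially. (w n \<iota>, pt \<iota>) \<in> lim_rel n k (Suc l)"
      using \<iota>' unfolding same_def lim_rel_def by (auto elim!: eventually_mono)
  qed
  then have "\<forall>\<^sub>F n in sequentially. \<forall>\<iota>\<in>level k l. (w n \<iota>, pt \<iota>) \<in> lim_rel n k (Suc l)"
    by (rule eventually_ball_finite[OF finite_level])
  then show ?thesis by (rule eventually_mono) (auto simp: lim_rel_def)
qed

text \<open>A level has finitely many pairs of addresses, so the convergence of their time
  separations is uniform.\<close>

lemma lim_distortion: assumes l: "l \<ge> 1"
  shows "(\<lambda>n. distortion (X n) lim_space (lim_rel n k l)) \<longlonglongrightarrow> 0"
proof (rule order_tendstoI)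
  fix a :: ennreal assume a: "0 < a"
  then obtain e where e: "0 < e" "e < a" using dense by blast
  have "\<forall>p\<in>level k l \<times> level k l. \<forall>\<^sub>F n in sequentially.
    ennreal_absdiff (tsep (X n) (w n (fst p)) (w n (snd p))) (tsep lim_space (pt (fst p)) (pt (snd p))) < e"
  proof
    fix p assume "p \<in> level k l \<times> level k l"
    then have v: "fst p \<in> valid" "snd p \<in> valid" using level_valid[OF l] by auto
    obtain T where T: "tlim (fst p) (snd p) = ennreal T" "0 \<le> T"
      using tlim(2)[OF v] by (cases "tlim (fst p) (snd p)") auto
    have "(\<lambda>n. ennreal_absdiff (tsep (X n) (w n (fst p)) (w n (snd p))) (ennreal T)) \<longlonglongrightarrow> 0"
      using tlim(1)[OF v] T by (intro ennreal_absdiff_tendsto_0) auto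
    then show "\<forall>\<^sub>F n in sequentially.
      ennreal_absdiff (tsep (X n) (w n (fst p)) (w n (snd p))) (tsep lim_space (pt (fst p)) (pt (snd p))) < e"
      unfolding lim_tsep[OF v] T(1) using e(1) by (rule order_tendstoD)
  qed
  then have "\<forall>\<^sub>F n in sequentially. \<forall>p\<in>level k l \<times> level k l.
    ennreal_absdiff (tsep (X n) (w n (fst p)) (w n (snd p))) (tsep lim_space (pt (fst p)) (pt (snd p))) < e"
    by (intro eventually_ball_finite finite_cartesian_product finite_level)
  then show "\<forall>\<^sub>F n in sequentially. distortion (X n) lim_space (lim_rel n k l) < a"
  proof eventually_elim
    case (elim n)
    have "distortion (X n) lim_space (lim_rel n k l) \<le> e"
      unfolding distortion_def
    proof (rule SUP_least)
      fix z assume "z \<in> lim_rel n k l \<times> lim_rel n k l"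
      then obtain \<iota> \<iota>' where "\<iota> \<in> level k l" "\<iota>' \<in> level k l" "z = ((w n \<iota>, pt \<iota>), (w n \<iota>', pt \<iota>'))"
        by (auto simp: lim_rel_def)
      then show "(case z of (x, xa) \<Rightarrow> (case x of (v, y) \<Rightarrow> \<lambda>(v', y'). ennreal_absdiff (tsep (X n) v v') (tsep lim_space y y')) xa) \<le> e"
        using elim[THEN bspec, of "(\<iota>, \<iota>')"] by (auto intro: less_imp_le)
    qed
    then show ?case using e(2) by (rule le_less_trans)
  qed
qed auto

theorem lim_converges: "lgh_converges (\<lambda>n. (X n, U n)) (lim_space, lim_cover)"
  unfolding lgh_converges_def prod.case
proof (intro exI[of _ S] exI[of _ lim_net] exI[of _ lim_rel] conjI allI impI)
  fix k l :: nat assume l: "1 \<le> l"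
  show "finite_net lim_space (lim_cover k) (1 / real l) (lim_net k l)" by (rule lim_finite_net[OF l])
  show "net_vertices (lim_net k l) \<subseteq> net_vertices (lim_net k (Suc l))"
    unfolding lim_net_vertices
  proof
    fix x assume "x \<in> pt ` level k l"
    then obtain \<iota> where \<iota>: "\<iota> \<in> level k l" "x = pt \<iota>" by auto
    obtain \<iota>' where "\<iota>' \<in> level k (Suc l)" "same \<iota> \<iota>'" using level_Suc[OF l \<iota>(1)] .
    then show "x \<in> pt ` level k (Suc l)" using \<iota> pt_eq_iff by auto
  qed
  show "(\<lambda>n. distortion (fst (X n, U n)) lim_space (lim_rel n k l)) \<longlonglongrightarrow> 0"
    using lim_distortion[OF l] by simp
  show "\<forall>\<^sub>F n in sequentially. finite_net (fst (X n, U n)) (snd (X n, U n) k) (1 / real l) (S n k l) \<and>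
       net_vertices (S n k l) \<subseteq> net_vertices (S n k (Suc l)) \<and>
       correspondence (net_vertices (S n k l)) (net_vertices (lim_net k l)) (lim_rel n k l) \<and>
       lim_rel n k l \<subseteq> lim_rel n k (Suc l) \<and> matching_nets (lim_rel n k l) (S n k l) (lim_net k l)"
    using nets[OF l, of k] net_vertices_level[OF l, of k] lim_rel_mono[OF l, of k]
  proof eventually_elim
    case (elim n)
    have "correspondence (net_vertices (S n k l)) (net_vertices (lim_net k l)) (lim_rel n k l)"
      unfolding correspondence_def lim_net_vertices elim(2) by (auto simp: lim_rel_def image_image)
    moreover have "matching_nets (lim_rel n k l) (S n k l) (lim_net k l)"
      unfolding matching_nets_def list_all2_conv_all_nth
    proof (intro conjI allI impI)
      show "length (S n k l) = length (lim_net k l)" using elim by (simp add: lim_net_def)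
      fix i assume "i < length (S n k l)"
      then have i: "i < len k l" using elim by simp
      have "(w n (k, l, i, s), pt (k, l, i, s)) \<in> lim_rel n k l" for s
        unfolding lim_rel_def using index_level[OF i] by blast
      from this[of True] this[of False]
      show "(case S n k l ! i of (p, q) \<Rightarrow> \<lambda>(p', q'). (p, p') \<in> lim_rel n k l \<and> (q, q') \<in> lim_rel n k l) (lim_net k l ! i)"
        using i by (simp add: lim_net_def vertex_def case_prod_beta)
    qed
    ultimately show ?case using elim by simp
  qed
next
  fix k
  show "forward_dense lim_space (\<Union>l\<in>{1..}. net_vertices (lim_net k l)) (lim_cover k)"
    unfolding forward_dense_def lim_net_vertices lim_cover_def[symmetric]
  proof
    fix x assume x: "x \<in> lim_cover k"
    then have xc: "x \<in> pt ` valid" by (auto simp: lim_cover_def valid_def)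
    then have "caus lim_space x x" using lpls_refl[OF lim_lpls] by simp
    moreover have "limitin (mtopology_of (lmetric lim_space)) (\<lambda>_. x) x sequentially"
      unfolding lim_topology using xc by simp
    ultimately show "\<exists>v. (\<forall>i. v i \<in> lim_cover k \<and> caus lim_space (v i) (v (Suc i)) \<and> caus lim_space (v i) x) \<and>
        limitin (mtopology_of (lmetric lim_space)) v x sequentially"
      using x by (intro exI[of _ "\<lambda>_. x"]) auto
  qed
qed

end

section \<open>A convergent subsequence from towers of nets\<close>

lemma of_bool_eventually_const:
  assumes "convergent (\<lambda>n. of_bool (P n) :: real)"
  shows "(\<forall>\<^sub>F n in sequentially. P n) \<or> (\<forall>\<^sub>F n in sequentially. \<not> P n)"
proof -
  have "convergent (\<lambda>n. real (of_bool (P n)))" using assms by simp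
  then obtain c :: nat where c: "\<forall>\<^sub>F n in sequentially. of_bool (P n) = c"
    by (rule convergent_nat_eventually_const)
  show ?thesis
  proof (cases "c = 1")
    case True
    then have "\<forall>\<^sub>F n in sequentially. P n" using c by (auto elim!: eventually_mono simp: of_bool_def split: if_splits)
    then show ?thesis ..
  next
    case False
    then have "\<forall>\<^sub>F n in sequentially. \<not> P n" using c by (auto elim!: eventually_mono simp: of_bool_def split: if_splits)
    then show ?thesis ..
  qed
qed

text \<open>Nothing is required beyond level \<open>L\<close>. Vertices of every level have to be
  covered at every other level, coarser or finer, because all of them survive in the limit.\<close>

definition net_tower ::
  "'a lspace \<Rightarrow> 'a set \<Rightarrow> (nat \<Rightarrow> nat) \<Rightarrow> nat \<Rightarrow> (nat \<Rightarrow> ('a \<times> 'a) list) \<Rightarrow> bool" where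
  "net_tower X U Nb L S \<longleftrightarrow>
     (\<forall>l. 1 \<le> l \<and> l \<le> L \<longrightarrow> finite_net X U (1 / real l) (S l) \<and> length (S l) \<le> Nb l) \<and>
     (\<forall>l. 1 \<le> l \<and> l < L \<longrightarrow> net_vertices (S l) \<subseteq> net_vertices (S (Suc l))) \<and>
     (\<forall>l l'. 1 \<le> l \<and> l \<le> L \<and> 1 \<le> l' \<and> l' \<le> L \<longrightarrow>
        (\<forall>v\<in>net_vertices (S l). \<exists>(p, q)\<in>set (S l'). v \<in> causal_diamond X p q))"

theorem lgh_subsequence_of_net_towers:
  fixes X :: "nat \<Rightarrow> 'a lspace" and U :: "nat \<Rightarrow> nat \<Rightarrow> 'a set"
  assumes lpls: "\<And>n. lorentzian_pre_length_space (X n)" and U_mono: "\<And>n k. U n k \<subseteq> U n (Suc k)"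
    and tower: "\<And>n k. net_tower (X n) (U n k) (Nb k) n (S n k)"
    and bound: "\<And>n k l k' l' v w. 1 \<le> l \<Longrightarrow> l \<le> n \<Longrightarrow> 1 \<le> l' \<Longrightarrow> l' \<le> n \<Longrightarrow> v \<in> net_vertices (S n k l) \<Longrightarrow>
      w \<in> net_vertices (S n k' l') \<Longrightarrow> tsep (X n) v w \<le> ennreal (Cb k k')"
  obtains r and Z :: "real covered" where "strict_mono (r :: nat \<Rightarrow> nat)" "covered_lpls Z"
    "lgh_converges (\<lambda>n. (X (r n), U (r n))) Z"
proof -
  have U_mono': "U n j \<subseteq> U n k" if "j \<le> k" for n j k
    using lift_Suc_mono_le[of "U n", OF U_mono that] .
  \<comment> \<open>The nets of all smaller sets are included, so that the vertices also increase
    with \<open>k\<close> and the sets of the limit cover are nested.\<close>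
  define SS where "SS n k l = concat (map (\<lambda>j. S n j l) [0..<Suc k])" for n k l
  have set_SS: "set (SS n k l) = (\<Union>j\<in>{..k}. set (S n j l))" for n k l
    unfolding SS_def set_concat set_map image_image set_upt atLeast0LessThan lessThan_Suc_atMost ..
  have vert_SS: "net_vertices (SS n k l) = (\<Union>j\<in>{..k}. net_vertices (S n j l))" for n k l
    unfolding net_vertices_def set_SS by auto
  define Nb' where "Nb' k l = (\<Sum>j\<le>k. Nb j l)" for k l
  have len_SS: "length (SS n k l) \<le> Nb' k l" if "1 \<le> l" "l \<le> n" for n k l
  proof -
    have "length (SS n k l) = (\<Sum>j\<leftarrow>[0..<Suc k]. length (S n j l))"
      by (simp only: SS_def length_concat map_map o_def)
    also have "\<dots> = (\<Sum>j\<in>{..k}. length (S n j l))"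
      by (simp only: interv_sum_list_conv_sum_set_nat set_upt atLeast0LessThan lessThan_Suc_atMost)
    also have "\<dots> \<le> Nb' k l" unfolding Nb'_def
      using tower that by (intro sum_mono) (auto simp: net_tower_def)
    finally show ?thesis .
  qed
  have net_SS: "finite_net (X n) (U n k) (1 / real l) (SS n k l)" if l: "1 \<le> l" "l \<le> n" for n k l
    unfolding finite_net_def
  proof (intro conjI ballI)
    have fn: "finite_net (X n) (U n j) (1 / real l) (S n j l)" for j
      using tower l by (auto simp: net_tower_def)
    fix pq assume "pq \<in> set (SS n k l)"
    then obtain j where j: "j \<le> k" "pq \<in> set (S n j l)" by (auto simp: set_SS)
    then show "case pq of (p, q) \<Rightarrow> p \<in> lcarrier (X n) \<and> q \<in> lcarrier (X n) \<and>
        tsep (X n) p q \<le> ennreal (1 / real l) \<and> U n k \<inter> causal_diamond (X n) p q \<noteq> {}"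
      using fn[of j] U_mono'[OF j(1), of n] unfolding finite_net_def by fast
  next
    have "finite_net (X n) (U n k) (1 / real l) (S n k l)"
      using tower l by (auto simp: net_tower_def)
    then show "U n k \<subseteq> (\<Union>(p, q)\<in>set (SS n k l). causal_diamond (X n) p q)"
      unfolding finite_net_def set_SS by blast
  qed
  have Suc_SS: "net_vertices (SS n k l) \<subseteq> net_vertices (SS n k (Suc l))" if l: "1 \<le> l" "l < n" for n k l
    unfolding vert_SS using tower l unfolding net_tower_def by blast
  have k_SS: "net_vertices (SS n k l) \<subseteq> net_vertices (SS n (Suc k) l)" for n k l
    unfolding vert_SS by (rule UN_mono) auto
  have cover_SS: "\<exists>(p, q)\<in>set (SS n k' l'). v \<in> causal_diamond (X n) p q"
    if h: "1 \<le> l" "l \<le> n" "1 \<le> l'" "l' \<le> n" "k \<le> k'" "v \<in> net_vertices (SS n k l)" for n k l k' l' v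
  proof -
    obtain j where j: "j \<le> k" "v \<in> net_vertices (S n j l)" using h(6) by (auto simp: vert_SS)
    have "\<exists>(p, q)\<in>set (S n j l'). v \<in> causal_diamond (X n) p q"
      using tower[of n j] h(1-4) j(2) unfolding net_tower_def by blast
    moreover have "set (S n j l') \<subseteq> set (SS n k' l')" using j h(5) unfolding set_SS by (intro UN_upper) auto
    ultimately show ?thesis by blast
  qed
  \<comment> \<open>One bound for all pairs of smaller indices, since a vertex at \<open>k\<close>
    may stem from any \<open>j \<le> k\<close>.\<close>
  define Cb' where "Cb' k k' = (\<Sum>j\<le>k. \<Sum>j'\<le>k'. \<bar>Cb j j'\<bar>)" for k k'
  have bound_SS: "tsep (X n) v w \<le> ennreal (Cb' k k')"
    if h: "1 \<le> l" "l \<le> n" "1 \<le> l'" "l' \<le> n" "v \<in> net_vertices (SS n k l)" "w \<in> net_vertices (SS n k' l')"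
    for n k l k' l' v w
  proof -
    obtain j j' where j: "j \<le> k" "v \<in> net_vertices (S n j l)" "j' \<le> k'" "w \<in> net_vertices (S n j' l')"
      using h(5,6) by (auto simp: vert_SS)
    have "tsep (X n) v w \<le> ennreal (Cb j j')" using bound[OF h(1-4) j(2,4)] .
    also have "\<dots> \<le> ennreal (Cb' k k')"
    proof (rule ennreal_leI)
      have "Cb j j' \<le> \<bar>Cb j j'\<bar>" by simp
      also have "\<dots> \<le> (\<Sum>j'\<le>k'. \<bar>Cb j j'\<bar>)" using j by (intro member_le_sum) auto
      also have "\<dots> \<le> Cb' k k'" unfolding Cb'_def
        using j by (intro member_le_sum[of j "{..k}" "\<lambda>j. \<Sum>j'\<le>k'. \<bar>Cb j j'\<bar>"]) (auto intro: sum_nonneg)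
      finally show "Cb j j' \<le> Cb' k k'" .
    qed
    finally show ?thesis .
  qed
  have Cb'_nonneg: "0 \<le> Cb' k k'" for k k' by (auto simp: Cb'_def intro!: sum_nonneg)
  \<comment> \<open>Active addresses denote actual vertices within the depth of the tower. For all
    others the time separation has no bound and is replaced by 0 in \<open>g\<close>.\<close>
  define act where "act n = (\<lambda>(k, l, i, s :: bool). 1 \<le> l \<and> l \<le> n \<and> i < length (SS n k l))" for n
  \<comment> \<open>All data that must converge form a single family of bounded sequences over a
    countable set: lengths of nets, coincidences, causal relations and time separations.\<close>
  define g :: "nat \<Rightarrow> (nat \<times> nat) + (vertex_index \<times> vertex_index) + (vertex_index \<times> vertex_index) +
      (vertex_index \<times> vertex_index) \<Rightarrow> real" where
    "g n = case_sum (\<lambda>(k, l). if 1 \<le> l \<and> l \<le> n then real (length (SS n k l)) else 0)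
      (case_sum (\<lambda>(x, y). of_bool (vertex (SS n) x = vertex (SS n) y))
      (case_sum (\<lambda>(x, y). of_bool (caus (X n) (vertex (SS n) x) (vertex (SS n) y)))
      (\<lambda>(x, y). if act n x \<and> act n y then enn2real (tsep (X n) (vertex (SS n) x) (vertex (SS n) y)) else 0)))" for n
  define Bd where "Bd = case_sum (\<lambda>(k, l). real (Nb' k l))
      (case_sum (\<lambda>_ :: vertex_index \<times> vertex_index. 1) (case_sum (\<lambda>_ :: vertex_index \<times> vertex_index. 1)
      (\<lambda>(x :: vertex_index, y :: vertex_index). Cb' (fst x) (fst y))))"
  have act_vertex: "vertex (SS n) (k, l, i, s) \<in> net_vertices (SS n k l)" if "i < length (SS n k l)" for n k l i s
    unfolding net_vertices_vertex using that by force
  have bd: "\<bar>g n x\<bar> \<le> Bd x" for n x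
  proof (cases x)
    case (Inl kl)
    then show ?thesis using len_SS by (cases kl) (auto simp: g_def Bd_def)
  next
    case (Inr x')
    show ?thesis
    proof (cases x')
      case (Inl y)
      then show ?thesis using Inr by (cases y) (simp add: g_def Bd_def)
    next
      case x'': (Inr x'')
      show ?thesis
      proof (cases x'')
        case (Inl y)
        then show ?thesis using Inr x'' by (cases y) (simp add: g_def Bd_def)
      next
        case y: (Inr y)
        obtain k l i s k' l' i' s' where yy: "y = ((k, l, i, s), (k', l', i', s'))" by (metis prod_cases4 prod.exhaust)
        have "enn2real (tsep (X n) (vertex (SS n) (k, l, i, s)) (vertex (SS n) (k', l', i', s'))) \<le> Cb' k k'"
          if "act n (k, l, i, s)" "act n (k', l', i', s')"
          using that bound_SS[of l n l' "vertex (SS n) (k, l, i, s)" k "vertex (SS n) (k', l', i', s')" k'] act_vertex Cb'_nonneg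
          by (intro enn2real_leI) (auto simp: act_def)
        then show ?thesis using Inr x'' y yy Cb'_nonneg by (simp add: g_def Bd_def)
      qed
    qed
  qed
  obtain r :: "nat \<Rightarrow> nat" where r: "strict_mono r" "\<And>x. convergent (\<lambda>n. g (r n) x)"
    using diagonal_convergent_subsequence[of g Bd] bd by blast
  have rn: "n \<le> r n" for n using seq_suble[OF r(1)] .
  have ev: "\<forall>\<^sub>F n in sequentially. l < r n" for l
    using eventually_gt_at_top[of l] by eventually_elim (use rn in \<open>auto intro: less_le_trans\<close>)
  have "\<exists>c. \<forall>\<^sub>F n in sequentially. length (SS (r n) k l) = c" if l: "1 \<le> l" for k l
  proof -
    let ?a = "\<lambda>n. if 1 \<le> l \<and> l \<le> r n then length (SS (r n) k l) else 0"
    have eq: "(\<lambda>n. g (r n) (Inl (k, l))) = (\<lambda>n. real (?a n))" by (auto simp: g_def)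
    have "convergent (\<lambda>n. real (?a n))" using r(2)[of "Inl (k, l)"] unfolding eq .
    then obtain c where c: "\<forall>\<^sub>F n in sequentially. ?a n = c"
      by (rule convergent_nat_eventually_const)
    then have "\<forall>\<^sub>F n in sequentially. length (SS (r n) k l) = c"
      using ev[of l] by eventually_elim (use l in auto)
    then show ?thesis ..
  qed
  note len_ex = this
  define len where "len k l = (SOME c. \<forall>\<^sub>F n in sequentially. length (SS (r n) k l) = c)" for k l
  have len: "\<forall>\<^sub>F n in sequentially. length (SS (r n) k l) = len k l" if "1 \<le> l" for k l
    unfolding len_def by (rule someI_ex[OF len_ex[OF that]])
  interpret vertex_limit "\<lambda>n. X (r n)" "\<lambda>n. U (r n)" "\<lambda>n. SS (r n)" len
  proof
    show "lorentzian_pre_length_space (X (r n))" for n by (rule lpls)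
    show "\<forall>\<^sub>F n in sequentially. finite_net (X (r n)) (U (r n) k) (1 / real l) (SS (r n) k l) \<and>
      length (SS (r n) k l) = len k l \<and> net_vertices (SS (r n) k l) \<subseteq> net_vertices (SS (r n) k (Suc l)) \<and>
      net_vertices (SS (r n) k l) \<subseteq> net_vertices (SS (r n) (Suc k) l)" if "l \<ge> 1" for k l
      using ev[of l] len[OF that, of k]
      by eventually_elim (use net_SS Suc_SS k_SS that in auto)
    show "\<forall>\<^sub>F n in sequentially. \<forall>v\<in>net_vertices (SS (r n) k l).
      \<exists>(p, q)\<in>set (SS (r n) k' l'). v \<in> causal_diamond (X (r n)) p q"
      if "l \<ge> 1" "l' \<ge> 1" "k \<le> k'" for k l k' l'
      using ev[of l] ev[of l'] by eventually_elim (use cover_SS that in \<open>meson less_imp_le\<close>)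
    show "(\<forall>\<^sub>F n in sequentially. vertex (SS (r n)) x = vertex (SS (r n)) y) \<or>
      (\<forall>\<^sub>F n in sequentially. vertex (SS (r n)) x \<noteq> vertex (SS (r n)) y)" for x y
      using r(2)[of "Inr (Inl (x, y))"] by (intro of_bool_eventually_const) (simp add: g_def)
    show "(\<forall>\<^sub>F n in sequentially. caus (X (r n)) (vertex (SS (r n)) x) (vertex (SS (r n)) y)) \<or>
      (\<forall>\<^sub>F n in sequentially. \<not> caus (X (r n)) (vertex (SS (r n)) x) (vertex (SS (r n)) y))" for x y
      using r(2)[of "Inr (Inr (Inl (x, y)))"] by (intro of_bool_eventually_const) (simp add: g_def)
    fix k l i k' l' i' :: nat and s s' :: bool
    assume i: "1 \<le> l" "i < len k l" "1 \<le> l'" "i' < len k' l'"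
    let ?x = "(k, l, i, s)" and ?y = "(k', l', i', s')"
    let ?\<tau> = "\<lambda>n. tsep (X (r n)) (vertex (SS (r n)) ?x) (vertex (SS (r n)) ?y)"
    obtain T where T: "(\<lambda>n. g (r n) (Inr (Inr (Inr (?x, ?y))))) \<longlonglongrightarrow> T"
      using r(2)[of "Inr (Inr (Inr (?x, ?y)))"] by (auto simp: convergent_def)
    have g0: "0 \<le> g n (Inr (Inr (Inr (?x, ?y))))" for n by (simp add: g_def)
    have "(\<lambda>n. ennreal (g (r n) (Inr (Inr (Inr (?x, ?y)))))) \<longlonglongrightarrow> ennreal T"
      by (rule tendsto_ennrealI[OF T])
    moreover have "\<forall>\<^sub>F n in sequentially. ennreal (g (r n) (Inr (Inr (Inr (?x, ?y))))) = ?\<tau> n"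
      using ev[of l] ev[of l'] len[OF i(1), of k] len[OF i(3), of k']
    proof eventually_elim
      case (elim n)
      have "?\<tau> n \<le> ennreal (Cb' k k')"
        using elim i by (intro bound_SS[of l _ l'] act_vertex) auto
      then have "?\<tau> n < \<top>" by (rule le_less_trans) simp
      then show ?case using elim i by (simp add: g_def act_def)
    qed
    ultimately have "?\<tau> \<longlonglongrightarrow> ennreal T" by (rule Lim_transform_eventually)
    moreover have "0 \<le> T" using g0 by (intro LIMSEQ_le_const[OF T]) auto
    ultimately show "\<exists>T\<ge>0. ?\<tau> \<longlonglongrightarrow> ennreal T" by blast
  qed
  show ?thesis by (rule that[OF r(1) lim_covered lim_converges])
qed

section \<open>Nets in generalized cones\<close>

definition net_vertex_list :: "('a \<times> 'a) list \<Rightarrow> 'a list" where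
  "net_vertex_list S = map fst S @ map snd S"

lemma set_net_vertex_list: "set (net_vertex_list S) = net_vertices S"
  by (simp add: net_vertex_list_def net_vertices_def)

text \<open>The excess \<open>h l\<close> is halved from level to level, so that coarse nets also cover the vertices of
  finer ones; these all become points of the limit of \<open>U\<close>.\<close>

locale cone_net = cone_window J f Y X A B M R H
  for J f and Y :: "'y metric" and X A B M R H +
  fixes a b :: real and Bs :: "'y set" and h :: "nat \<Rightarrow> real" and F :: "nat \<Rightarrow> 'y list" and L :: nat
  assumes ab: "A < a" "a < b" "b < B" and Bs: "Bs \<subseteq> mspace Y"
    and h_pos: "\<And>l. 1 \<le> l \<Longrightarrow> 0 < h l"
    and h_half: "\<And>l l'. 1 \<le> l \<Longrightarrow> l < l' \<Longrightarrow> h l' \<le> h l / 2"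
    and h_mesh: "\<And>l. 1 \<le> l \<Longrightarrow> M * h l \<le> 1 / (6 * real l)"
    and h_window: "\<And>l. 1 \<le> l \<Longrightarrow> M * h l < a - A" "\<And>l. 1 \<le> l \<Longrightarrow> M * h l < B - b"
    and h_R: "\<And>l. 1 \<le> l \<Longrightarrow> h l < R"
    and centers: "\<And>l. 1 \<le> l \<Longrightarrow> set (F l) \<subseteq> Bs"
      "\<And>l z. 1 \<le> l \<Longrightarrow> z \<in> Bs \<Longrightarrow> \<exists>y\<in>set (F l). mdist Y y z < h l / 2"
    and persist_lower: "\<And>s y. y \<in> Bs \<Longrightarrow> A < s \<Longrightarrow> s \<le> a \<Longrightarrow> H a - H s \<le> h 1 \<Longrightarrow>
      \<exists>q\<in>{a<..<b} \<times> Bs. caus X (s, y) q \<and> tsep X (s, y) q \<le> ennreal (1 / real L)"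
    and persist_upper: "\<And>s y. y \<in> Bs \<Longrightarrow> b \<le> s \<Longrightarrow> s < B \<Longrightarrow> H s - H b \<le> h 1 \<Longrightarrow>
      \<exists>p\<in>{a<..<b} \<times> Bs. caus X p (s, y) \<and> tsep X p (s, y) \<le> ennreal (1 / real L)"
begin

definition U :: "(real \<times> 'y) set" where "U = {a<..<b} \<times> Bs"

lemma U_carrier: "U \<subseteq> lcarrier X"
  using ab Bs window unfolding U_def lcarrier_eq by (intro Sigma_mono) auto

text \<open>A diamond will extend over at most six mesh widths, which gives the time separation
  \<open>1 / l\<close>.\<close>

definition mesh :: "nat \<Rightarrow> real" where "mesh l = 1 / (6 * real l)"

lemma mesh_pos: "1 \<le> l \<Longrightarrow> 0 < mesh l" by (simp add: mesh_def)

text \<open>The extreme times of the vertices are prescribed through conformal time, in which the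
  excess can be compared with distances in the base.\<close>

definition lower :: "nat \<Rightarrow> real" where "lower l = (SOME s. A < s \<and> s < a \<and> H s = H a - h l)"
definition upper :: "nat \<Rightarrow> real" where "upper l = (SOME t. b < t \<and> t < B \<and> H t = H b + h l)"

text \<open>Going back by \<open>M * h l\<close> in time uses at least \<open>h l\<close> of
  conformal time and stays in the window, so the intermediate value theorem applies.\<close>

lemma lower: assumes l: "1 \<le> l" shows "A < lower l" "lower l < a" "H (lower l) = H a - h l"
proof -
  have Mh: "0 < M * h l" using M_pos h_pos[OF l] by simp
  have "(a - (a - M * h l)) / M \<le> H a - H (a - M * h l)"
    using h_window[OF l] Mh ab by (intro H_diff_ge) auto
  then have "H (a - M * h l) \<le> H a - h l" using M_pos by simp
  then obtain s where s: "a - M * h l \<le> s" "s \<le> a" "H s = H a - h l"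
    using H_ivt[of "a - M * h l" a "H a - h l"] h_window[OF l] h_pos[OF l] Mh ab by auto
  have "s \<noteq> a" using s(3) h_pos[OF l] by auto
  then have "A < s \<and> s < a \<and> H s = H a - h l" using s h_window[OF l] by auto
  then have "A < lower l \<and> lower l < a \<and> H (lower l) = H a - h l" unfolding lower_def by (rule someI)
  then show "A < lower l" "lower l < a" "H (lower l) = H a - h l" by auto
qed

lemma upper: assumes l: "1 \<le> l" shows "b < upper l" "upper l < B" "H (upper l) = H b + h l"
proof -
  have Mh: "0 < M * h l" using M_pos h_pos[OF l] by simp
  have "((b + M * h l) - b) / M \<le> H (b + M * h l) - H b"
    using h_window[OF l] Mh ab by (intro H_diff_ge) auto
  then have "H b + h l \<le> H (b + M * h l)" using M_pos by simp
  then obtain s where s: "b \<le> s" "s \<le> b + M * h l" "H s = H b + h l"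
    using H_ivt[of b "b + M * h l" "H b + h l"] h_window[OF l] h_pos[OF l] Mh ab by auto
  have "s \<noteq> b" using s(3) h_pos[OF l] by auto
  then have "b < s \<and> s < B \<and> H s = H b + h l" using s h_window[OF l] by auto
  then have "b < upper l \<and> upper l < B \<and> H (upper l) = H b + h l" unfolding upper_def by (rule someI)
  then show "b < upper l" "upper l < B" "H (upper l) = H b + h l" by auto
qed

definition grid :: "nat \<Rightarrow> real list" where
  "grid l = map (\<lambda>j. a + real j * mesh l) [0..<Suc (nat \<lfloor>(b - a) / mesh l\<rfloor>)]"

lemma grid_range: assumes l: "1 \<le> l" and T: "T \<in> set (grid l)" shows "a \<le> T" "T \<le> b"
proof -
  obtain j where j: "j < Suc (nat \<lfloor>(b - a) / mesh l\<rfloor>)" "T = a + real j * mesh l" using T unfolding grid_def set_map set_upt atLeast0LessThan by blast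
  have "0 \<le> (b - a) / mesh l" using ab mesh_pos[OF l] by simp
  then have "real j \<le> (b - a) / mesh l" using j(1) by linarith
  then show "a \<le> T" "T \<le> b" using j(2) mesh_pos[OF l] by (auto simp: field_simps)
qed

text \<open>Times may lie one mesh width outside \<open>{a..b}\<close>, and the last grid time is
  less than one width below \<open>b\<close>; this adds up to two widths.\<close>

lemma grid_near:
  assumes l: "1 \<le> l" and u: "a - mesh l \<le> u" "u \<le> b + mesh l"
  obtains T where "T \<in> set (grid l)" "\<bar>u - T\<bar> \<le> 2 * mesh l"
proof -
  let ?m = "mesh l"
  have m: "0 < ?m" by (rule mesh_pos[OF l])
  define n where "n = nat \<lfloor>(b - a) / ?m\<rfloor>"
  have "0 \<le> (b - a) / ?m" using ab m by simp
  then have "(b - a) / ?m < real n + 1" unfolding n_def by linarith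
  then have n: "b - a < (real n + 1) * ?m" using m by (simp add: divide_less_eq)
  have grid: "a + real j * ?m \<in> set (grid l)" if "j \<le> n" for j
    using that unfolding grid_def n_def by auto
  consider "u < a" | "a \<le> u" "u < a + (real n + 1) * ?m" | "a + (real n + 1) * ?m \<le> u" by linarith
  then show ?thesis
  proof cases
    case 1
    then show ?thesis using that[OF grid[of 0]] u m by auto
  next
    case 2
    define j where "j = nat \<lfloor>(u - a) / ?m\<rfloor>"
    have "0 \<le> (u - a) / ?m" using 2 m by simp
    then have j: "real j \<le> (u - a) / ?m" "(u - a) / ?m < real j + 1" unfolding j_def by linarith+
    have "(u - a) / ?m < real n + 1" using 2 m by (simp add: divide_less_eq)
    then have "j \<le> n" using j by linarith
    have "real j * ?m \<le> u - a" "u - a < (real j + 1) * ?m" using j m by (simp_all add: field_simps)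
    then have "\<bar>u - (a + real j * ?m)\<bar> \<le> 2 * ?m" using m by (simp add: abs_le_iff algebra_simps)
    then show ?thesis using that[OF grid[OF \<open>j \<le> n\<close>]] by blast
  next
    case 3
    have "u - (a + real n * ?m) \<le> 2 * ?m" "0 \<le> u - (a + real n * ?m)"
      using 3 u n m unfolding distrib_right mult_1 by linarith+
    then show ?thesis using that[OF grid[of n]] by auto
  qed
qed

text \<open>Of the three mesh widths, two reach the covered times and one makes the relation causal.
  The cut keeps the excess within \<open>h l\<close>.\<close>

definition lo :: "nat \<Rightarrow> real \<Rightarrow> real" where "lo l T = max (lower l) (T - 3 * mesh l)"
definition up :: "nat \<Rightarrow> real \<Rightarrow> real" where "up l T = min (upper l) (T + 3 * mesh l)"

definition base :: "nat \<Rightarrow> ((real \<times> 'y) \<times> (real \<times> 'y)) list" where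
  "base l = concat (map (\<lambda>T. map (\<lambda>y. ((lo l T, y), (up l T, y))) (F l)) (grid l))"

lemma set_base: "set (base l) = (\<lambda>(T, y). ((lo l T, y), (up l T, y))) ` (set (grid l) \<times> set (F l))"
  by (auto simp: base_def)

lemma length_base: "length (base l) = Suc (nat \<lfloor>(b - a) / mesh l\<rfloor>) * length (F l)"
proof -
  have "length (base l) = (\<Sum>T\<leftarrow>grid l. length (F l))"
    by (simp add: base_def length_concat o_def)
  also have "\<dots> = length (grid l) * length (F l)" by (simp add: sum_list_triv)
  finally show ?thesis by (simp add: grid_def)
qed

lemma mesh_H: assumes l: "1 \<le> l" shows "h l \<le> mesh l / M"
  using divide_right_mono[OF h_mesh[OF l], of M] M_pos by (simp add: mesh_def)

text \<open>In conformal time \<open>(u, z)\<close> is at least \<open>h l / 2\<close> away from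
  both vertices, which exceeds the distance from \<open>y\<close> to \<open>z\<close>. At a cut
  vertex this is the assumption on \<open>H u\<close>; otherwise one mesh width is left, worth
  \<open>mesh l / M \<ge> h l\<close> in conformal time.\<close>

lemma base_diamond:
  assumes l: "1 \<le> l" and T: "T \<in> set (grid l)" and y: "y \<in> set (F l)"
    and z: "z \<in> Bs" "mdist Y y z < h l / 2" and u: "A < u" "u < B" "\<bar>u - T\<bar> \<le> 2 * mesh l"
    and Hu: "H a - h l / 2 \<le> H u" "H u \<le> H b + h l / 2"
  shows "(u, z) \<in> causal_diamond X (lo l T, y) (up l T, y)"
proof -
  have m: "0 < mesh l" by (rule mesh_pos[OF l])
  have hm: "h l \<le> mesh l / M" by (rule mesh_H[OF l])
  have h: "0 < h l" by (rule h_pos[OF l])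
  have yz: "y \<in> mspace Y" "z \<in> mspace Y" using centers(1)[OF l] y z Bs by auto
  have dR: "mdist Y y z < R" using z h h_R[OF l] by linarith
  have "lo l T < u \<and> h l / 2 \<le> H u - H (lo l T) \<and> A < lo l T"
  proof (cases "T - 3 * mesh l \<le> lower l")
    case True
    then have lo: "lo l T = lower l" by (simp add: lo_def)
    have "H (lower l) < H u" using lower[OF l] Hu h by auto
    then show ?thesis using lower[OF l] Hu H_less_iff[of "lower l" u] u ab unfolding lo by auto
  next
    case False
    then have lo: "lo l T = T - 3 * mesh l" by (simp add: lo_def)
    have d: "mesh l \<le> u - lo l T" using u(3) lo by linarith
    have A: "A < lo l T" using False lower[OF l] lo by linarith
    have "h l \<le> (u - lo l T) / M"
      using hm divide_right_mono[OF d, of M] M_pos by linarith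
    also have "\<dots> \<le> H u - H (lo l T)" using d m A u by (intro H_diff_ge) auto
    finally show ?thesis using h d m A by auto
  qed
  then have 1: "caus X (lo l T, y) (u, z)"
    using u z yz dR by (intro caus_of_mdist_less) auto
  have "u < up l T \<and> h l / 2 \<le> H (up l T) - H u \<and> up l T < B"
  proof (cases "upper l \<le> T + 3 * mesh l")
    case True
    then have up: "up l T = upper l" by (simp add: up_def)
    have "H u < H (upper l)" using upper[OF l] Hu h by auto
    then show ?thesis using upper[OF l] Hu H_less_iff[of u "upper l"] u ab unfolding up by auto
  next
    case False
    then have up: "up l T = T + 3 * mesh l" by (simp add: up_def)
    have d: "mesh l \<le> up l T - u" using u(3) up by linarith
    have B: "up l T < B" using False upper[OF l] up by linarith
    have "h l \<le> (up l T - u) / M"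
      using hm divide_right_mono[OF d, of M] M_pos by linarith
    also have "\<dots> \<le> H (up l T) - H u" using d m B u by (intro H_diff_ge) auto
    finally show ?thesis using h d m B by auto
  qed
  then have 2: "caus X (u, z) (up l T, y)"
    using u z yz dR YM.commute[of y z] by (intro caus_of_mdist_less) auto
  show ?thesis using 1 2 in_carrier[OF u(1,2) yz(2)] by (simp add: causal_diamond_def)
qed

text \<open>The covered region exceeds \<open>U\<close> by half of \<open>h l\<close>. As the excess
  is at least halved from level to level, it contains the vertices of all finer base nets.\<close>

lemma base_covers:
  assumes l: "1 \<le> l" and z: "z \<in> Bs" and u: "A < u" "u < B"
    and Hu: "H a - h l / 2 \<le> H u" "H u \<le> H b + h l / 2"
  shows "\<exists>(p, q)\<in>set (base l). (u, z) \<in> causal_diamond X p q"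
proof -
  obtain y where y: "y \<in> set (F l)" "mdist Y y z < h l / 2" using centers(2)[OF l z] by blast
  have hm: "h l \<le> mesh l / M" by (rule mesh_H[OF l])
  have h: "0 < h l" by (rule h_pos[OF l])
  have "a - mesh l \<le> u"
  proof (cases "u < a")
    case True
    have "(a - u) / M \<le> H a - H u" using True u ab by (intro H_diff_ge) auto
    then have "(a - u) / M \<le> mesh l / M" using Hu hm h by linarith
    then show ?thesis using M_pos by (simp add: divide_le_cancel)
  next
    case False
    then show ?thesis using mesh_pos[OF l] by linarith
  qed
  moreover have "u \<le> b + mesh l"
  proof (cases "b < u")
    case True
    have "(u - b) / M \<le> H u - H b" using True u ab by (intro H_diff_ge) auto
    then have "(u - b) / M \<le> mesh l / M" using Hu hm h by linarith
    then show ?thesis using M_pos by (simp add: divide_le_cancel)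
  next
    case False
    then show ?thesis using mesh_pos[OF l] by linarith
  qed
  ultimately obtain T where T: "T \<in> set (grid l)" "\<bar>u - T\<bar> \<le> 2 * mesh l" using grid_near[OF l] by blast
  have "((lo l T, y), (up l T, y)) \<in> set (base l)" using T y unfolding set_base by (intro image_eqI[of _ _ "(T, y)"]) auto
  then show ?thesis using base_diamond[OF l T(1) y(1) z y(2) u T(2) Hu] by blast
qed

lemma U_H: assumes "(u, z) \<in> U" "0 \<le> c" shows "H a - c \<le> H u" "H u \<le> H b + c" "A < u" "u < B" "z \<in> Bs"
proof -
  have u: "a < u" "u < b" "z \<in> Bs" using assms(1) by (auto simp: U_def)
  then show "A < u" "u < B" "z \<in> Bs" using ab by auto
  show "H a - c \<le> H u" "H u \<le> H b + c" using H_le[of a u] H_le[of u b] u ab assms(2) by auto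
qed

lemma base_covers_U: assumes l: "1 \<le> l" and v: "v \<in> U"
  shows "\<exists>(p, q)\<in>set (base l). v \<in> causal_diamond X p q"
proof -
  obtain u z where uz: "v = (u, z)" by fastforce
  have "0 \<le> h l / 2" using h_pos[OF l] by simp
  then show ?thesis using base_covers[OF l] U_H[of u z "h l / 2"] v unfolding uz by blast
qed

lemma base_vertex:
  assumes l: "1 \<le> l" and v: "v \<in> net_vertices (base l)"
  obtains s y where "v = (s, y)" "y \<in> Bs" "A < s" "s < B" "H a - h l \<le> H s" "H s \<le> H b + h l"
proof -
  have m: "0 < mesh l" by (rule mesh_pos[OF l])
  obtain T y where T: "T \<in> set (grid l)" "y \<in> set (F l)" "v = (lo l T, y) \<or> v = (up l T, y)"
    using v unfolding net_vertices_def set_base by auto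
  note r = grid_range[OF l T(1)]
  have "lower l \<le> lo l T" "lo l T \<le> upper l" "lower l \<le> up l T" "up l T \<le> upper l"
    using r lower[OF l] upper[OF l] m ab by (auto simp: lo_def up_def)
  then obtain s where s: "v = (s, y)" "lower l \<le> s" "s \<le> upper l" using T(3) by auto
  have "H (lower l) \<le> H s" "H s \<le> H (upper l)"
    using s lower[OF l] upper[OF l] ab by (intro H_le; linarith)+
  then show ?thesis using that[of s y] s lower[OF l] upper[OF l] centers(1)[OF l] T(2) by auto
qed

lemma base_net: assumes l: "1 \<le> l" shows "finite_net X U (1 / real l) (base l)"
  unfolding finite_net_def
proof (intro conjI ballI)
  show "U \<subseteq> (\<Union>(p, q)\<in>set (base l). causal_diamond X p q)" using base_covers_U[OF l] by blast
  fix pq assume "pq \<in> set (base l)"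
  then obtain T y where T: "T \<in> set (grid l)" "y \<in> set (F l)" "pq = ((lo l T, y), (up l T, y))"
    unfolding set_base by auto
  have m: "0 < mesh l" by (rule mesh_pos[OF l])
  note r = grid_range[OF l T(1)]
  have y: "y \<in> Bs" "y \<in> mspace Y" using T(2) centers(1)[OF l] Bs by auto
  have range: "A < lo l T" "lo l T < B" "A < up l T" "up l T < B"
    using r lower[OF l] upper[OF l] m ab by (auto simp: lo_def up_def)
  have "tsep X (lo l T, y) (up l T, y) \<le> ennreal (up l T - lo l T)" by (rule tsep_le_time)
  also have "\<dots> \<le> ennreal (1 / real l)"
  proof (rule ennreal_leI)
    have "up l T - lo l T \<le> 6 * mesh l" unfolding lo_def up_def by linarith
    also have "6 * mesh l = 1 / real l" by (simp add: mesh_def)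
    finally show "up l T - lo l T \<le> 1 / real l" .
  qed
  finally have ts: "tsep X (lo l T, y) (up l T, y) \<le> ennreal (1 / real l)" .
  \<comment> \<open>The grid time may be an end point of \<open>{a..b}\<close>, while the diamond
    has to meet \<open>U\<close>, which lies over the open interval.\<close>
  obtain u where u: "a < u" "u < b" "\<bar>u - T\<bar> \<le> 2 * mesh l"
  proof (cases "T = b")
    case True
    then show ?thesis using that[of "b - min (mesh l) ((b - a) / 2)"] m ab by (auto simp: min_def field_simps)
  next
    case False
    then show ?thesis using that[of "T + min (mesh l) ((b - T) / 2)"] m ab r by (auto simp: min_def field_simps)
  qed
  have uU: "(u, y) \<in> U" using u y by (simp add: U_def)
  have h: "0 < h l" by (rule h_pos[OF l])
  then have "0 \<le> h l / 2" by simp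
  note U_H[OF uU this]
  moreover have "mdist Y y y < h l / 2" using y h by simp
  ultimately have "(u, y) \<in> causal_diamond X (lo l T, y) (up l T, y)"
    using base_diamond[OF l T(1,2) y(1) _ _ _ u(3)] by blast
  then show "case pq of (p, q) \<Rightarrow> p \<in> lcarrier X \<and> q \<in> lcarrier X \<and>
      tsep X p q \<le> ennreal (1 / real l) \<and> U \<inter> causal_diamond X p q \<noteq> {}"
    using T(3) ts uU in_carrier[OF range(1,2) y(2)] in_carrier[OF range(3,4) y(2)] by auto
qed

text \<open>The bound \<open>1 / L\<close> makes one and the same diamond admissible at all levels
  up to \<open>L\<close>. Its vertex other than \<open>v\<close> is in \<open>U\<close>, so that the
  diamond meets \<open>U\<close>.\<close>

definition persists :: "real \<times> 'y \<Rightarrow> (real \<times> 'y) \<times> (real \<times> 'y) \<Rightarrow> bool" where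
  "persists v = (\<lambda>(p, q). p \<in> lcarrier X \<and> q \<in> lcarrier X \<and> tsep X p q \<le> ennreal (1 / real L) \<and>
     caus X p q \<and> (p = v \<and> q \<in> U \<or> q = v \<and> p \<in> U))"

definition partner :: "real \<times> 'y \<Rightarrow> (real \<times> 'y) \<times> (real \<times> 'y)" where
  "partner v = (SOME pq. persists v pq)"

text \<open>A vertex in \<open>U\<close> is its own partner. The others get one from the locale
  assumptions, which apply because the excess of every level is at most \<open>h 1\<close>.\<close>

lemma base_persists: assumes l: "1 \<le> l" and v: "v \<in> net_vertices (base l)"
  shows "persists v (partner v)"
proof -
  obtain s y where s: "v = (s, y)" "y \<in> Bs" "A < s" "s < B" "H a - h l \<le> H s" "H s \<le> H b + h l"
    using base_vertex[OF l v] .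
  have h1: "h l \<le> h 1" using h_half[of 1 l] h_pos[of 1] l by (cases "l = 1") auto
  have vc: "v \<in> lcarrier X" using in_carrier[OF s(3,4)] s(1,2) Bs by auto
  have "\<exists>pq. persists v pq"
  proof -
    consider "s \<le> a" | "a < s" "s < b" | "b \<le> s" by linarith
    then show ?thesis
    proof cases
      case 1
      have "H a - H s \<le> h 1" using s(5) h1 by linarith
      then obtain q where q: "q \<in> U" "caus X (s, y) q" "tsep X (s, y) q \<le> ennreal (1 / real L)"
        using persist_lower[OF s(2,3) 1] unfolding U_def by blast
      moreover have "q \<in> lcarrier X" using q(1) U_carrier by blast
      ultimately have "persists v (v, q)" using vc s(1) by (simp add: persists_def del: lcarrier_eq)
      then show ?thesis by blast
    next
      case 2
      then have "v \<in> U" using s by (simp add: U_def)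
      moreover have "tsep X v v \<le> ennreal (1 / real L)" 
        using tsep_le_time[of s y s y] s(1) by simp
      ultimately have "persists v (v, v)" using vc caus_refl[OF vc] by (simp add: persists_def del: lcarrier_eq)
      then show ?thesis by blast
    next
      case 3
      have "H s - H b \<le> h 1" using s(6) h1 by linarith
      then obtain q where q: "q \<in> U" "caus X q (s, y)" "tsep X q (s, y) \<le> ennreal (1 / real L)"
        using persist_upper[OF s(2) 3 s(4)] unfolding U_def by blast
      moreover have "q \<in> lcarrier X" using q(1) U_carrier by blast
      ultimately have "persists v (q, v)" using vc s(1) by (simp add: persists_def del: lcarrier_eq)
      then show ?thesis by blast
    qed
  qed
  then show ?thesis unfolding partner_def by (rule someI_ex)
qed

lemma persists_diamond:
  assumes "persists v pq"
  shows "v \<in> causal_diamond X (fst pq) (snd pq)" "U \<inter> causal_diamond X (fst pq) (snd pq) \<noteq> {}"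
    "v \<in> {fst pq, snd pq}" "{fst pq, snd pq} \<subseteq> insert v U"
    "fst pq \<in> lcarrier X" "snd pq \<in> lcarrier X" "tsep X (fst pq) (snd pq) \<le> ennreal (1 / real L)"
proof -
  obtain p q where pq: "pq = (p, q)" by (cases pq)
  have P: "p \<in> lcarrier X" "q \<in> lcarrier X" "tsep X p q \<le> ennreal (1 / real L)" "caus X p q"
     "p = v \<and> q \<in> U \<or> q = v \<and> p \<in> U"
    using assms unfolding pq persists_def by auto
  have "p \<in> causal_diamond X p q" "q \<in> causal_diamond X p q"
    using P(1,2,4) caus_refl unfolding causal_diamond_def by blast+
  then show "v \<in> causal_diamond X (fst pq) (snd pq)" "U \<inter> causal_diamond X (fst pq) (snd pq) \<noteq> {}"
    "v \<in> {fst pq, snd pq}" "{fst pq, snd pq} \<subseteq> insert v U"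
    "fst pq \<in> lcarrier X" "snd pq \<in> lcarrier X" "tsep X (fst pq) (snd pq) \<le> ennreal (1 / real L)"
    using P unfolding pq fst_conv snd_conv by blast+
qed

text \<open>The base nets of different levels are unrelated. Inheritance of vertices comes from the
  partner diamonds, which are kept for all base nets up to the current level.\<close>

definition tower :: "nat \<Rightarrow> ((real \<times> 'y) \<times> (real \<times> 'y)) list" where
  "tower l = base l @ map partner (concat (map (\<lambda>l'. net_vertex_list (base l')) [1..<Suc l]))"

lemma set_tower: "set (tower l) = set (base l) \<union> partner ` (\<Union>l'\<in>{1..l}. net_vertices (base l'))"
proof -
  have "{1..<Suc l} = {1..l}" by auto
  then show ?thesis
    by (simp only: tower_def set_append set_map set_concat set_upt image_image set_net_vertex_list)
qed

lemma partner_tower: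
  "1 \<le> l' \<Longrightarrow> l' \<le> l \<Longrightarrow> v \<in> net_vertices (base l') \<Longrightarrow> partner v \<in> set (tower l)"
  unfolding set_tower by (intro UnI2 imageI UN_I[of l']) auto

lemma tower_vertex:
  assumes l: "1 \<le> l" and v: "v \<in> net_vertices (tower l)"
  shows "v \<in> U \<or> (\<exists>l'. 1 \<le> l' \<and> l' \<le> l \<and> v \<in> net_vertices (base l'))"
proof -
  obtain pq where pq: "pq \<in> set (tower l)" "v = fst pq \<or> v = snd pq" using v by (auto simp: net_vertices_def)
  show ?thesis
  proof (cases "pq \<in> set (base l)")
    case True
    then have "v \<in> net_vertices (base l)" using pq(2) by (auto simp: net_vertices_def)
    then show ?thesis using l by blast
  next
    case False
    then obtain v' l' where v': "1 \<le> l'" "l' \<le> l" "v' \<in> net_vertices (base l')" "pq = partner v'"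
      using pq(1) unfolding set_tower by auto
    have "{fst pq, snd pq} \<subseteq> insert v' U" unfolding v'(4) by (rule persists_diamond[OF base_persists[OF v'(1,3)]])
    then have "v \<in> insert v' U" using pq(2) by auto
    then show ?thesis using v'(1-3) by auto
  qed
qed

lemma tower_vertex_window: 
  assumes l: "1 \<le> l" and v: "v \<in> net_vertices (tower l)" shows "A < fst v" "fst v < B"
proof -
  consider "v \<in> U" | l' where "1 \<le> l'" "v \<in> net_vertices (base l')" using tower_vertex[OF assms] by blast
  then have "A < fst v \<and> fst v < B"
  proof cases
    case 1
    then show ?thesis using ab by (auto simp: U_def)
  next
    case 2
    then show ?thesis by (rule base_vertex) auto
  qed
  then show "A < fst v" "fst v < B" by auto
qed

theorem tower_net_tower:
  assumes Nb: "\<And>l. (\<Sum>l'\<in>{1..l}. 3 * (Suc (nat \<lfloor>(b - a) * (6 * real l')\<rfloor>) * length (F l'))) \<le> Nb l"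
  shows "net_tower X U Nb L tower"
  unfolding net_tower_def
proof (intro conjI allI impI)
  fix l :: nat assume l: "1 \<le> l \<and> l \<le> L"
  then have l1: "1 \<le> l" by simp
  show "finite_net X U (1 / real l) (tower l)"
    unfolding finite_net_def
  proof (intro conjI ballI)
    show "U \<subseteq> (\<Union>(p, q)\<in>set (tower l). causal_diamond X p q)"
      using base_covers_U[OF l1] unfolding set_tower by blast
    fix pq assume "pq \<in> set (tower l)"
    then consider "pq \<in> set (base l)" | v l' where "1 \<le> l'" "v \<in> net_vertices (base l')" "pq = partner v"
      unfolding set_tower by auto
    then show "case pq of (p, q) \<Rightarrow> p \<in> lcarrier X \<and> q \<in> lcarrier X \<and>
      tsep X p q \<le> ennreal (1 / real l) \<and> U \<inter> causal_diamond X p q \<noteq> {}"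
    proof cases
      case 1
      then show ?thesis using base_net[OF l1] unfolding finite_net_def by blast
    next
      case 2
      have "ennreal (1 / real L) \<le> ennreal (1 / real l)" using l by (intro ennreal_leI divide_left_mono) auto
      then show ?thesis using persists_diamond[OF base_persists[OF 2(1,2)]] unfolding 2(3)[symmetric]
        by (auto simp: case_prod_beta simp del: lcarrier_eq intro: order_trans)
    qed
  qed
  \<comment> \<open>A base diamond accounts for at most three diamonds, itself and the partners of
    its two vertices; hence the factor 3 in \<open>Nb\<close>.\<close>
  have "length (tower l) = length (base l) + (\<Sum>l'\<leftarrow>[1..<Suc l]. 2 * length (base l'))"
    by (simp only: tower_def length_append length_map length_concat map_map o_def net_vertex_list_def mult_2)
  also have "(\<Sum>l'\<leftarrow>[1..<Suc l]. 2 * length (base l')) = (\<Sum>l'\<in>{1..l}. 2 * length (base l'))"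
    by (simp only: interv_sum_list_conv_sum_set_nat set_upt atLeastLessThanSuc_atLeastAtMost)
  also have "length (base l) \<le> (\<Sum>l'\<in>{1..l}. length (base l'))"
    using l1 by (intro member_le_sum) auto
  also have "(\<Sum>l'\<in>{1..l}. length (base l')) + (\<Sum>l'\<in>{1..l}. 2 * length (base l')) =
     (\<Sum>l'\<in>{1..l}. 3 * (Suc (nat \<lfloor>(b - a) * (6 * real l')\<rfloor>) * length (F l')))"
    unfolding sum.distrib[symmetric] by (intro sum.cong refl) (simp add: length_base mesh_def)
  also have "\<dots> \<le> Nb l" by (rule Nb)
  finally show "length (tower l) \<le> Nb l" by simp
next
  fix l assume "1 \<le> l \<and> l < L"
  then have l: "1 \<le> l" by simp
  show "net_vertices (tower l) \<subseteq> net_vertices (tower (Suc l))"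
  proof
    fix v assume "v \<in> net_vertices (tower l)"
    then obtain pq where pq: "pq \<in> set (tower l)" "v = fst pq \<or> v = snd pq" by (auto simp: net_vertices_def)
    show "v \<in> net_vertices (tower (Suc l))"
    proof (cases "pq \<in> set (base l)")
      case True
      then have vb: "v \<in> net_vertices (base l)" using pq(2) by (auto simp: net_vertices_def)
      have "partner v \<in> set (tower (Suc l))" using vb l by (intro partner_tower[of l]) auto
      moreover have "v \<in> {fst (partner v), snd (partner v)}"
        by (rule persists_diamond[OF base_persists[OF l vb]])
      ultimately show ?thesis by (auto simp: net_vertices_def)
    next
      case False
      then obtain v' l' where v': "1 \<le> l'" "l' \<le> l" "v' \<in> net_vertices (base l')" "pq = partner v'"
        using pq(1) unfolding set_tower by auto
      then have "pq \<in> set (tower (Suc l))" by (auto intro: partner_tower[of l'])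
      then show ?thesis using pq(2) by (auto simp: net_vertices_def)
    qed
  qed
next
  fix l l' assume "1 \<le> l \<and> l \<le> L \<and> 1 \<le> l' \<and> l' \<le> L"
  then have l: "1 \<le> l" "1 \<le> l'" by auto
  show "\<forall>v\<in>net_vertices (tower l). \<exists>(p, q)\<in>set (tower l'). v \<in> causal_diamond X p q"
  proof
    fix v assume "v \<in> net_vertices (tower l)"
    then consider "v \<in> U" | l1 where "1 \<le> l1" "l1 \<le> l" "v \<in> net_vertices (base l1)"
      using tower_vertex[OF l(1)] by blast
    then show "\<exists>(p, q)\<in>set (tower l'). v \<in> causal_diamond X p q"
    proof cases
      case 1
      then show ?thesis using base_covers_U[OF l(2)] unfolding set_tower by blast
    next
      case 2
      show ?thesis
      \<comment> \<open>A vertex of a coarser or equal level lies in its partner diamond, one of a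
        finer level in the larger region of the base net.\<close>
      proof (cases "l1 \<le> l'")
        case True
        then have "partner v \<in> set (tower l')" using 2 by (intro partner_tower[of l1])
        moreover have "v \<in> causal_diamond X (fst (partner v)) (snd (partner v))"
          by (rule persists_diamond[OF base_persists[OF 2(1,3)]])
        ultimately show ?thesis by (intro bexI[of _ "partner v"]) (auto simp: case_prod_beta)
      next
        case False
        then have hh: "h l1 \<le> h l' / 2" using h_half[OF l(2)] by simp
        obtain s y where s: "v = (s, y)" "y \<in> Bs" "A < s" "s < B" "H a - h l1 \<le> H s" "H s \<le> H b + h l1"
          using base_vertex[OF 2(1,3)] .
        have "\<exists>(p, q)\<in>set (base l'). v \<in> causal_diamond X p q"
          unfolding s(1) using s hh by (intro base_covers[OF l(2)]) auto
        then show ?thesis unfolding set_tower by blast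
      qed
    qed
  qed
qed

end

section \<open>Null related partners inside the cover\<close>

lemma ball_path:
  assumes len: "length_space Y" and y0: "y0 \<in> mspace Y" and x: "x \<in> mball_of Y y0 k"
  obtains c where "pathin (mtopology_of Y) c" "c 0 = y0" "c 1 = x" "\<And>s. s \<in> {0..1} \<Longrightarrow> c s \<in> mball_of Y y0 k"
proof -
  have xk: "x \<in> mspace Y" "mdist Y y0 x < k" using x by auto
  obtain c where c: "pathin (mtopology_of Y) c" "c 0 = y0" "c 1 = x" "\<And>s. s \<in> {0..1} \<Longrightarrow> c s \<in> mspace Y"
     "\<And>s. s \<in> {0..1} \<Longrightarrow> mdist Y y0 (c s) + mdist Y (c s) x < k"
    by (rule length_space_path[OF len y0 xk]) blast
  show ?thesis
  proof (rule that[OF c(1-3)])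
    fix s :: real assume s: "s \<in> {0..1}"
    have "0 \<le> mdist Y (c s) x" by simp
    then have "mdist Y y0 (c s) < k" using c(5)[OF s] by linarith
    then show "c s \<in> mball_of Y y0 k" using y0 c(4)[OF s] by simp
  qed
qed

text \<open>A supremum of distances from the centre need not be attained. A point beyond half of it
  provides an attained measure for the size of the ball.\<close>

lemma ball_half_diameter:
  assumes y0: "y0 \<in> mspace Y" and k: "0 < k" and ne: "mball_of Y y0 k \<noteq> {y0}"
  obtains w where "w \<in> mball_of Y y0 k" "0 < mdist Y y0 w" "mball_of Y y0 k \<subseteq> mball_of Y y0 (2 * mdist Y y0 w)"
proof -
  interpret Metric_space "mspace Y" "mdist Y" by simp
  let ?S = "(\<lambda>z. mdist Y y0 z) ` mball_of Y y0 k"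
  have y0B: "y0 \<in> mball_of Y y0 k" using y0 k by simp
  then obtain x where x: "x \<in> mball_of Y y0 k" "x \<noteq> y0" using ne by blast
  have bdd: "bdd_above ?S" by (rule bdd_aboveI[where M=k]) auto
  have xpos: "0 < mdist Y y0 x" using x y0 mdist_pos_less[of y0 x] by auto
  have "mdist Y y0 x \<le> Sup ?S" using x bdd by (intro cSup_upper) auto
  then have S: "Sup ?S / 2 < Sup ?S" "0 < Sup ?S" using xpos by auto
  then obtain w where w: "w \<in> mball_of Y y0 k" "Sup ?S / 2 < mdist Y y0 w"
    using less_cSupD[OF _ S(1)] y0B by blast
  show ?thesis
  proof (rule that[OF w(1)])
    show "0 < mdist Y y0 w" using S w by linarith
    show "mball_of Y y0 k \<subseteq> mball_of Y y0 (2 * mdist Y y0 w)"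
    proof
      fix z assume z: "z \<in> mball_of Y y0 k"
      then have "mdist Y y0 z \<le> Sup ?S" using bdd by (intro cSup_upper) auto
      then show "z \<in> mball_of Y y0 (2 * mdist Y y0 w)" using z w by auto
    qed
  qed
qed

context cone_window
begin

text \<open>Paths that stay in the ball are known only from its centre. The distance from
  \<open>y\<close> takes the value \<open>v\<close> on the path from the centre to \<open>y\<close>
  or on that to \<open>w0\<close>. The point found there is then moved to the end of a geodesic from
  \<open>y\<close>, without leaving the ball.\<close>

lemma intermediate_geodesic_point:
  assumes len: "length_space Y" and y0: "y0 \<in> mspace Y" and y: "y \<in> mball_of Y y0 k" and w0: "w0 \<in> mball_of Y y0 k"
    and d: "0 \<le> d" "d < mdist Y y w0" "d < R" and \<kappa>: "0 < \<kappa>"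
  obtains w where "w \<in> mball_of Y y0 k" "geodesic Y y w" "d < mdist Y y w" "mdist Y y w < d + \<kappa>"
proof -
  have yY: "y \<in> mspace Y" using y by auto
  define e where "e = min (d + \<kappa>) R"
  have e: "d < e" "e \<le> d + \<kappa>" "e \<le> R" using d \<kappa> by (auto simp: e_def)
  define v where "v = min ((d + e) / 2) (mdist Y y w0)"
  have "d < (d + e) / 2" "(d + e) / 2 < e" using e(1) by auto
  then have v: "d < v" "v < e" "v \<le> mdist Y y w0" using d by (auto simp: v_def min_less_iff_disj)
  obtain x where x: "x \<in> mball_of Y y0 k" "mdist Y y x = v"
  proof (cases "v \<le> mdist Y y y0")
    case True
    obtain c where c: "pathin (mtopology_of Y) c" "c 0 = y0" "c 1 = y" "\<And>s. s \<in> {0..1} \<Longrightarrow> c s \<in> mball_of Y y0 k"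
      by (rule ball_path[OF len y0 y]) blast
    have "mdist Y y (c 1) \<le> v \<and> v \<le> mdist Y y (c 0)" using c True yY v d by simp
    then obtain s where "s \<in> {0..1}" "mdist Y y (c s) = v"
      using path_mdist_attains[OF c(1) yY] by blast
    then show ?thesis using that c(4) by blast
  next
    case False
    obtain c where c: "pathin (mtopology_of Y) c" "c 0 = y0" "c 1 = w0" "\<And>s. s \<in> {0..1} \<Longrightarrow> c s \<in> mball_of Y y0 k"
      by (rule ball_path[OF len y0 w0]) blast
    have "mdist Y y (c 0) \<le> v \<and> v \<le> mdist Y y (c 1)" using c False v by simp
    then obtain s where "s \<in> {0..1}" "mdist Y y (c s) = v"
      using path_mdist_attains[OF c(1) yY] by blast
    then show ?thesis using that c(4) by blast
  qed
  have xY: "x \<in> mspace Y" "mdist Y y0 x < k" using x by auto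
  define r where "r = min (min (v - d) (e - v)) (k - mdist Y y0 x)"
  have r: "0 < r" "r \<le> v - d" "r \<le> e - v" "r \<le> k - mdist Y y0 x" using v xY by (auto simp: r_def)
  have "mdist Y y x < R" using x v e by linarith
  then obtain w where w: "geodesic Y y w" "mdist Y x w < r"
    using geodesics_dense[OF yY xY(1) _ r(1)] by blast
  have wY: "w \<in> mspace Y" using geodesic_mspace[OF w(1)] by simp
  show ?thesis
  proof (rule that[OF _ w(1)])
    show "w \<in> mball_of Y y0 k" using YM.triangle[OF y0 xY(1) wY] w r y0 wY by auto
    show "d < mdist Y y w" using YM.triangle[OF yY wY xY(1)] w r x(2) YM.commute[of w x] by linarith
    show "mdist Y y w < d + \<kappa>" using YM.triangle[OF yY xY(1) wY] w r x(2) e by linarith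
  qed
qed

text \<open>The time \<open>t\<close> solves \<open>H t - H s = mdist Y y w\<close> exactly. The
  pair is then causally related with time separation 0, which meets any tolerance, and the strict
  bounds on \<open>mdist Y y w\<close> place \<open>t\<close> in \<open>{a<..<b}\<close>.\<close>

lemma null_partner_above:
  assumes len: "length_space Y" and y0: "y0 \<in> mspace Y" and y: "y \<in> mball_of Y y0 k" and w0: "w0 \<in> mball_of Y y0 k"
    and s: "A < s" "s \<le> a" "a < b" "b < B" and d: "H a - H s < mdist Y y w0" "H a - H s < R"
  shows "\<exists>q\<in>{a<..<b} \<times> mball_of Y y0 k. caus X (s, y) q \<and> tsep X (s, y) q \<le> ennreal c"
proof -
  have "0 \<le> H a - H s" using H_le[of s a] s by simp
  moreover have "0 < H b - H a" using H_less[of a b] s by simp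
  ultimately obtain w where w: "w \<in> mball_of Y y0 k" "geodesic Y y w" "H a - H s < mdist Y y w"
     "mdist Y y w < (H a - H s) + (H b - H a)"
    using intermediate_geodesic_point[OF len y0 y w0 _ d] by blast
  obtain t where t: "a \<le> t" "t \<le> b" "H t = H s + mdist Y y w"
    using H_ivt[of a b "H s + mdist Y y w"] s w by auto
  have "t \<noteq> a" "t \<noteq> b" using t w by auto
  then have t': "a < t" "t < b" using t by auto
  have "caus X (s, y) (t, w)" using t t' s w by (intro caus_geodesic) auto
  moreover have "tsep X (s, y) (t, w) = 0" using t t' s w by (intro tsep_null) auto
  ultimately show ?thesis using t' w(1) by (intro bexI[of _ "(t, w)"]) auto
qed

lemma null_partner_below:
  assumes len: "length_space Y" and y0: "y0 \<in> mspace Y" and y: "y \<in> mball_of Y y0 k" and w0: "w0 \<in> mball_of Y y0 k"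
    and s: "A < a" "a < b" "b \<le> s" "s < B" and d: "H s - H b < mdist Y y w0" "H s - H b < R"
  shows "\<exists>p\<in>{a<..<b} \<times> mball_of Y y0 k. caus X p (s, y) \<and> tsep X p (s, y) \<le> ennreal c"
proof -
  have "0 \<le> H s - H b" using H_le[of b s] s by simp
  moreover have "0 < H b - H a" using H_less[of a b] s by simp
  ultimately obtain w where w: "w \<in> mball_of Y y0 k" "geodesic Y y w" "H s - H b < mdist Y y w"
     "mdist Y y w < (H s - H b) + (H b - H a)"
    using intermediate_geodesic_point[OF len y0 y w0 _ d] by blast
  have sym: "mdist Y w y = mdist Y y w" by (rule YM.commute)
  obtain t where t: "a \<le> t" "t \<le> b" "H t = H s - mdist Y y w"
    using H_ivt[of a b "H s - mdist Y y w"] s w by auto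
  have "t \<noteq> a" "t \<noteq> b" using t w by auto
  then have t': "a < t" "t < b" using t by auto
  have "caus X (t, w) (s, y)" using t t' s sym by (intro caus_geodesic geodesic_sym[OF w(2)]) auto
  moreover have "tsep X (t, w) (s, y) = 0" using t t' s y sym by (intro tsep_null) auto
  ultimately show ?thesis using t' w(1) by (intro bexI[of _ "(t, w)"]) auto
qed

end

section \<open>Towers with bounds uniform over the class\<close>

lemma net_tower_mono: "net_tower X U Nb L' S \<Longrightarrow> L \<le> L' \<Longrightarrow> net_tower X U Nb L S"
  unfolding net_tower_def by (meson le_trans less_le_trans)

lemma finite_set_list:
  assumes "\<exists>F. finite F \<and> F \<subseteq> S \<and> card F \<le> n \<and> (\<forall>z\<in>S. \<exists>x\<in>F. P x z)"
  shows "\<exists>xs. set xs \<subseteq> S \<and> length xs \<le> n \<and> (\<forall>z\<in>S. \<exists>x\<in>set xs. P x z)"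
proof -
  obtain F where F: "finite F" "F \<subseteq> S" "card F \<le> n" "\<forall>z\<in>S. \<exists>x\<in>F. P x z" using assms by blast
  obtain xs where "set xs = F" "distinct xs" using finite_distinct_list[OF F(1)] by blast
  then show ?thesis using F distinct_card[of xs] by (intro exI[of _ xs]) auto
qed

text \<open>\<open>Nb\<close> is fixed before the cone and before the depth \<open>L\<close>. The
  second part of the conclusion confines the vertices in time, which later bounds the time
  separation between nets of different sets of the cover.\<close>

lemma cone_net_towers:
  fixes N K \<epsilon> M T k :: real
  assumes N: "N > 1" and pos: "0 < \<epsilon>" "0 < M"
  obtains Nb :: "nat \<Rightarrow> nat" where "\<And>X J f (Y :: 'y metric) m a b y\<^sub>0 L.
    is_generalized_cone X J f Y \<Longrightarrow> lorentzian_pre_length_space X \<Longrightarrow> metric_measure_space Y m \<Longrightarrow> MCP K N Y m \<Longrightarrow>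
    y\<^sub>0 \<in> mspace Y \<Longrightarrow> {a - \<epsilon><..<b + \<epsilon>} \<subseteq> J \<Longrightarrow> \<bar>a - b\<bar> < T \<Longrightarrow> (\<forall>t\<in>{a - \<epsilon><..<b + \<epsilon>}. f t \<le> M) \<Longrightarrow>
    \<exists>S. net_tower X ({a<..<b} \<times> mball_of Y y\<^sub>0 k) Nb L S \<and>
      (\<forall>l v. 1 \<le> l \<longrightarrow> v \<in> net_vertices (S l) \<longrightarrow> a < b \<and> a - \<epsilon> < fst v \<and> fst v < b + \<epsilon> \<and>
         (\<forall>w. tsep X v w \<le> ennreal (fst w - fst v)))"
proof -
  define R where "R = mcp_radius K N"
  have R: "0 < R" using mcp_radius_pos[OF N] by (simp add: R_def)
  \<comment> \<open>The three bounds serve the time extent of the diamonds (\<open>h_mesh\<close>),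
    the room in the window (\<open>h_window\<close>) and the scale on which packing and geodesics
    are available.\<close>
  define \<rho> where "\<rho> = min (min (1 / (6 * M)) (\<epsilon> / (2 * M))) (R / 64)"
  have \<rho>: "0 < \<rho>" "\<rho> \<le> 1 / (6 * M)" "\<rho> \<le> \<epsilon> / (2 * M)" "\<rho> \<le> R / 64" using pos R by (auto simp: \<rho>_def)
  have "\<exists>C. \<forall>(Y :: 'y metric) m y S. mcp_space K N Y m \<longrightarrow> y \<in> mspace Y \<longrightarrow> S \<subseteq> mball_of Y y k \<longrightarrow>
    (\<exists>F. finite F \<and> F \<subseteq> S \<and> card F \<le> C \<and> (\<forall>z\<in>S. \<exists>x\<in>F. mdist Y x z < \<rho> / 2 ^ l / 2))" for l :: nat
  proof -
    have r: "0 < \<rho> / 2 ^ l / 2" using \<rho>(1) by simp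
    show ?thesis by (rule uniform_cover[OF N r, of K k, where 'y='y]) blast
  qed
  then obtain C1 where C1: "\<And>(Y :: 'y metric) m y S l. mcp_space K N Y m \<Longrightarrow> y \<in> mspace Y \<Longrightarrow> S \<subseteq> mball_of Y y k \<Longrightarrow>
    \<exists>F. finite F \<and> F \<subseteq> S \<and> card F \<le> C1 l \<and> (\<forall>z\<in>S. \<exists>x\<in>F. mdist Y x z < \<rho> / 2 ^ l / 2)"
    by metis
  \<comment> \<open>The ratio is that of the mesh \<open>D / (8 * 2 ^ l)\<close> to
    \<open>6 * (2 * D)\<close>, for a small ball of size \<open>D\<close> below.\<close>
  define c2 where "c2 l = contraction_coeff N (1 / (96 * 2 ^ l))" for l :: nat
  have c2: "0 < c2 l" for l unfolding c2_def by (rule contraction_coeff_pos) simp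
  \<comment> \<open>The 1 is for a ball with a single point.\<close>
  define C where "C l = max 1 (max (C1 l) (nat \<lfloor>1 / c2 l\<rfloor>))" for l
  define Nb where "Nb l = (\<Sum>l'\<in>{1..l}. 3 * (Suc (nat \<lfloor>T * (6 * real l')\<rfloor>) * C l'))" for l
  show ?thesis
  proof (rule that[of Nb])
    fix X J f and Y :: "'y metric" and m a b y\<^sub>0 L
    assume cone: "is_generalized_cone X J f Y" and lpls: "lorentzian_pre_length_space X"
      and mms: "metric_measure_space Y m" and mcp: "MCP K N Y m" and y0: "y\<^sub>0 \<in> mspace Y"
      and J: "{a - \<epsilon><..<b + \<epsilon>} \<subseteq> J" and T: "\<bar>a - b\<bar> < T" and fM: "\<forall>t\<in>{a - \<epsilon><..<b + \<epsilon>}. f t \<le> M"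
    let ?B = "mball_of Y y\<^sub>0 k"
    show "\<exists>S. net_tower X ({a<..<b} \<times> ?B) Nb L S \<and>
      (\<forall>l v. 1 \<le> l \<longrightarrow> v \<in> net_vertices (S l) \<longrightarrow> a < b \<and> a - \<epsilon> < fst v \<and> fst v < b + \<epsilon> \<and>
         (\<forall>w. tsep X v w \<le> ennreal (fst w - fst v)))"
    \<comment> \<open>The ball is empty for \<open>k = 0\<close>, which is the first index of every
      cover in the class. The empty net serves then.\<close>
    proof (cases "a < b \<and> 0 < k")
      case False
      have "{a<..<b} \<times> ?B = {}"
      proof (cases "a < b")
        case True
        with False have "k \<le> 0" by simp
        have "\<not> mdist Y y\<^sub>0 x < k" for x using \<open>k \<le> 0\<close> mdist_nonneg[of Y y\<^sub>0 x] by linarith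
        then have "?B = {}" by auto
        then show ?thesis by simp
      qed auto
      then have "net_tower X ({a<..<b} \<times> ?B) Nb L (\<lambda>_. [])"
        by (simp add: net_tower_def finite_net_def net_vertices_def)
      then show ?thesis by (intro exI[of _ "\<lambda>_. []"]) (simp add: net_vertices_def)
    next
      case True
      then have ab: "a < b" and k: "0 < k" by auto
      have len: "length_space Y" and Xc: "X = cone J f Y" and oJ: "open J" and fc: "continuous_on J f"
        and fpos: "\<And>t. t \<in> J \<Longrightarrow> 0 < f t"
        using cone by (auto simp: is_generalized_cone_def)
      interpret mcp: mcp_space K N Y m using N mms mcp len by unfold_locales
      have "\<exists>H. \<forall>t. ereal (a - \<epsilon>) < ereal t \<longrightarrow> ereal t < ereal (b + \<epsilon>) \<longrightarrow> (H has_vector_derivative 1 / f t) (at t)"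
      proof (rule einterval_antiderivative)
        show "ereal (a - \<epsilon>) < ereal (b + \<epsilon>)" using ab pos by simp
        fix t assume "ereal (a - \<epsilon>) < ereal t" "ereal t < ereal (b + \<epsilon>)"
        then have t: "t \<in> J" using J by auto
        then have "isCont f t" using fc oJ continuous_on_eq_continuous_at by blast
        then show "isCont (\<lambda>t. 1 / f t) t" using fpos[OF t] by (intro continuous_intros) auto
      qed
      then obtain H where H: "\<And>t. a - \<epsilon> < t \<Longrightarrow> t < b + \<epsilon> \<Longrightarrow> (H has_real_derivative 1 / f t) (at t)"
        by (auto simp: has_real_derivative_iff_has_vector_derivative)
      interpret W: cone_window J f Y X "a - \<epsilon>" "b + \<epsilon>" M R H
      proof
        show "\<exists>D. countable D \<and> D \<subseteq> mspace Y \<and> (\<forall>x\<in>mspace Y. \<forall>e>0. \<exists>z\<in>D. mdist Y x z < e)"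
          by (rule mcp.dense_sequence)
        show "\<exists>x. geodesic Y y x \<and> mdist Y z x < e"
          if "y \<in> mspace Y" "z \<in> mspace Y" "mdist Y y z < R" "0 < e" for y z e
          using mcp.dense_geodesics[OF that(1,2) that(3)[unfolded R_def] that(4)] by blast
      qed (use Xc lpls J fc fpos fM pos H R in auto)
      \<comment> \<open>For \<open>L = 0\<close> the number \<open>1 / real L\<close> is 0, and so
        would be the excess chosen for a ball with a single point.\<close>
      let ?L = "max 1 L"
      have y0B: "y\<^sub>0 \<in> ?B" using y0 k by simp
      have towers: "\<exists>S. net_tower X ({a<..<b} \<times> ?B) Nb L S \<and>
        (\<forall>l v. 1 \<le> l \<longrightarrow> v \<in> net_vertices (S l) \<longrightarrow> a < b \<and> a - \<epsilon> < fst v \<and> fst v < b + \<epsilon> \<and>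
         (\<forall>w. tsep X v w \<le> ennreal (fst w - fst v)))"
        if \<eta>: "0 < \<eta>" "\<eta> \<le> \<rho>"
          and cov: "\<And>l. \<exists>xs. set xs \<subseteq> ?B \<and> length xs \<le> C l \<and> (\<forall>z\<in>?B. \<exists>x\<in>set xs. mdist Y x z < \<eta> / 2 ^ l / 2)"
          and low: "\<And>s y. y \<in> ?B \<Longrightarrow> a - \<epsilon> < s \<Longrightarrow> s \<le> a \<Longrightarrow> H a - H s \<le> \<eta> / 2 ^ 1 \<Longrightarrow>
            \<exists>q\<in>{a<..<b} \<times> ?B. caus X (s, y) q \<and> tsep X (s, y) q \<le> ennreal (1 / real ?L)"
          and upp: "\<And>s y. y \<in> ?B \<Longrightarrow> b \<le> s \<Longrightarrow> s < b + \<epsilon> \<Longrightarrow> H s - H b \<le> \<eta> / 2 ^ 1 \<Longrightarrow>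
            \<exists>p\<in>{a<..<b} \<times> ?B. caus X p (s, y) \<and> tsep X p (s, y) \<le> ennreal (1 / real ?L)" for \<eta>
      proof -
        obtain F where F: "\<And>l. set (F l) \<subseteq> ?B" "\<And>l. length (F l) \<le> C l"
          "\<And>l z. z \<in> ?B \<Longrightarrow> \<exists>x\<in>set (F l). mdist Y x z < \<eta> / 2 ^ l / 2"
          using cov by metis
        have pow: "real l \<le> 2 ^ l" for l :: nat
          using of_nat_less_two_power[of l, where 'a=real] by simp
        have h_le: "\<eta> / 2 ^ l \<le> \<eta>" for l :: nat using \<eta>(1) by (simp add: divide_le_eq)
        have "M * \<rho> \<le> M * (\<epsilon> / (2 * M))" using \<rho>(3) pos by (intro mult_left_mono) auto
        then have M\<rho>: "M * \<rho> \<le> \<epsilon> / 2" using pos by simp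
        have Mh: "M * (\<eta> / 2 ^ l) < \<epsilon>" for l :: nat
        proof -
          have "M * (\<eta> / 2 ^ l) \<le> M * \<rho>" using h_le[of l] \<eta>(2) pos by (intro mult_left_mono) auto
          then show ?thesis using M\<rho> pos by linarith
        qed
        interpret net: cone_net J f Y X "a - \<epsilon>" "b + \<epsilon>" M R H a b ?B "\<lambda>l. \<eta> / 2 ^ l" F ?L
        proof
          show "\<eta> / 2 ^ l' \<le> \<eta> / 2 ^ l / 2" if "l < l'" for l l' :: nat
          proof -
            have "(2::real) ^ Suc l \<le> 2 ^ l'" using that by (intro power_increasing) auto
            then have "\<eta> / 2 ^ l' \<le> \<eta> / 2 ^ Suc l" using \<eta>(1) by (intro divide_left_mono) auto
            then show ?thesis by simp
          qed
          show "M * (\<eta> / 2 ^ l) \<le> 1 / (6 * real l)" if "1 \<le> l" for l :: nat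
          proof -
            have "M * \<eta> \<le> M * (1 / (6 * M))" using \<eta>(2) \<rho>(2) pos by (intro mult_left_mono) auto
            then have "M * \<eta> / 2 ^ l \<le> (1 / 6) / 2 ^ l" using pos by (intro divide_right_mono) auto
            also have "\<dots> \<le> (1 / 6) / real l" using that pow[of l] by (intro divide_left_mono) auto
            finally show ?thesis by simp
          qed
          show "\<eta> / 2 ^ l < R" for l :: nat using h_le[of l] \<eta>(2) \<rho>(4) R by linarith
        qed (use ab pos \<eta>(1) Mh F low upp in auto)
        have Nb: "(\<Sum>l'\<in>{1..l}. 3 * (Suc (nat \<lfloor>(b - a) * (6 * real l')\<rfloor>) * length (F l'))) \<le> Nb l" for l
          unfolding Nb_def
        proof (intro sum_mono mult_le_mono le_refl Suc_le_mono[THEN iffD2] nat_mono floor_mono F(2))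
          fix l'
          show "(b - a) * (6 * real l') \<le> T * (6 * real l')" using T ab by (intro mult_right_mono) auto
        qed
        have "net_tower X ({a<..<b} \<times> ?B) Nb ?L net.tower"
          using net.tower_net_tower[OF Nb] unfolding net.U_def .
        then have "net_tower X ({a<..<b} \<times> ?B) Nb L net.tower" by (rule net_tower_mono) simp
        moreover have "a < b \<and> a - \<epsilon> < fst v \<and> fst v < b + \<epsilon> \<and> (\<forall>w. tsep X v w \<le> ennreal (fst w - fst v))"
          if "1 \<le> l" "v \<in> net_vertices (net.tower l)" for l v
          using net.tower_vertex_window[OF that] ab W.tsep_le_time[of "fst v" "snd v"] by auto
        ultimately show ?thesis by blast
      qed
      show ?thesis
      proof (cases "?B = {y\<^sub>0}")
        case True
        \<comment> \<open>There are no null related points, but an excess that depends on \<open>L\<close> does no harm, since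
          a single point is a net of the ball.\<close>
        define \<eta> where "\<eta> = min \<rho> (1 / (M * real ?L))"
        have \<eta>: "0 < \<eta>" "\<eta> \<le> \<rho>" "\<eta> \<le> 1 / (M * real ?L)" using \<rho>(1) pos by (auto simp: \<eta>_def)
        have "M * \<eta> \<le> M * (1 / (M * real ?L))" using \<eta>(3) pos by (intro mult_left_mono) auto
        then have M\<eta>: "M * \<eta> \<le> 1 / real ?L" using pos by simp
        \<comment> \<open>The tolerance is shared equally: by \<open>short\<close>, the part of the
          diamond outside the window takes at most one half, and the part inside takes
          \<open>\<delta>\<close>.\<close>
        define \<delta> where "\<delta> = min (1 / (2 * real ?L)) ((b - a) / 2)"
        have \<delta>: "0 < \<delta>" "\<delta> \<le> 1 / (2 * real ?L)" "\<delta> < b - a"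
        proof -
          have "(b - a) / 2 < b - a" using ab by simp
          then show "0 < \<delta>" "\<delta> \<le> 1 / (2 * real ?L)" "\<delta> < b - a" using ab by (auto simp: \<delta>_def min_less_iff_disj)
        qed
        have short: "t - s \<le> 1 / (2 * real ?L)"
          if "a - \<epsilon> < s" "s \<le> t" "t < b + \<epsilon>" "H t - H s \<le> \<eta> / 2 ^ 1" for s t
        proof -
          have "(t - s) / M \<le> \<eta> / 2" using W.H_diff_ge[OF that(1-3)] that(4) unfolding power_one_right by linarith
          then have "t - s \<le> M * \<eta> / 2" using pos by (simp add: field_simps)
          then show ?thesis using M\<eta> by simp
        qed
        have double: "1 / (2 * real ?L) + 1 / (2 * real ?L) = 1 / real ?L" by simp
        show ?thesis
        proof (rule towers[OF \<eta>(1,2)])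
          show "\<exists>xs. set xs \<subseteq> ?B \<and> length xs \<le> C l \<and> (\<forall>z\<in>?B. \<exists>x\<in>set xs. mdist Y x z < \<eta> / 2 ^ l / 2)" for l
            unfolding True using \<eta>(1) y0 by (intro exI[of _ "[y\<^sub>0]"]) (auto simp: C_def)
        next
          fix s y assume y: "y \<in> ?B" and s: "a - \<epsilon> < s" "s \<le> a" "H a - H s \<le> \<eta> / 2 ^ 1"
          then have y: "y = y\<^sub>0" using True by blast
          have "caus X (s, y) (a + \<delta>, y)"
            using s \<delta> pos ab y y0 R W.H_less[of s "a + \<delta>"] by (intro W.caus_of_mdist_less) auto
          moreover have "tsep X (s, y) (a + \<delta>, y) \<le> ennreal (1 / real ?L)"
          proof (rule order_trans[OF W.tsep_le_time ennreal_leI])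
            show "a + \<delta> - s \<le> 1 / real ?L" using short[of s a] s ab pos \<delta> double by linarith
          qed
          ultimately show "\<exists>q\<in>{a<..<b} \<times> ?B. caus X (s, y) q \<and> tsep X (s, y) q \<le> ennreal (1 / real ?L)"
            using \<delta> y0B y by (intro bexI[of _ "(a + \<delta>, y)"]) auto
        next
          fix s y assume y: "y \<in> ?B" and s: "b \<le> s" "s < b + \<epsilon>" "H s - H b \<le> \<eta> / 2 ^ 1"
          then have y: "y = y\<^sub>0" using True by blast
          have "caus X (b - \<delta>, y) (s, y)"
            using s \<delta> pos ab y y0 R W.H_less[of "b - \<delta>" s] by (intro W.caus_of_mdist_less) auto
          moreover have "tsep X (b - \<delta>, y) (s, y) \<le> ennreal (1 / real ?L)"
          proof (rule order_trans[OF W.tsep_le_time ennreal_leI])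
            show "s - (b - \<delta>) \<le> 1 / real ?L" using short[of b s] s ab pos \<delta> double by linarith
          qed
          ultimately show "\<exists>p\<in>{a<..<b} \<times> ?B. caus X p (s, y) \<and> tsep X p (s, y) \<le> ennreal (1 / real ?L)"
            using \<delta> y0B y by (intro bexI[of _ "(b - \<delta>, y)"]) auto
        qed
      next
        case False
        obtain w where w: "w \<in> ?B" "0 < mdist Y y\<^sub>0 w" "?B \<subseteq> mball_of Y y\<^sub>0 (2 * mdist Y y\<^sub>0 w)"
          using ball_half_diameter[OF y0 k False] .
        define D where "D = mdist Y y\<^sub>0 w"
        have D: "0 < D" "?B \<subseteq> mball_of Y y\<^sub>0 (2 * D)" using w by (auto simp: D_def)
        \<comment> \<open>Each point of the ball has distance at least \<open>D / 2\<close> from the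
          centre or from \<open>w\<close>. An excess of at most \<open>D / 4\<close> therefore
          leaves room for a null related point.\<close>
        define \<eta> where "\<eta> = min \<rho> (D / 4)"
        have \<eta>: "0 < \<eta>" "\<eta> \<le> \<rho>" "\<eta> \<le> D / 4" using \<rho>(1) D by (auto simp: \<eta>_def)
        have far: "\<exists>w0\<in>?B. d < mdist Y y w0" if y: "y \<in> ?B" and d: "d \<le> \<eta> / 2 ^ 1" for y d
        proof -
          have yY: "y \<in> mspace Y" using y by simp
          have wY: "w \<in> mspace Y" using w(1) by simp
          have "D \<le> mdist Y y y\<^sub>0 + mdist Y y w"
            using mcp.YM.triangle[OF y0 yY wY] mcp.YM.commute[of y y\<^sub>0] by (simp add: D_def)
          then have "d < mdist Y y y\<^sub>0 \<or> d < mdist Y y w" using d \<eta>(3) D(1) by (simp add: not_less) linarith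
          then show ?thesis using y0B w(1) by blast
        qed
        show ?thesis
        proof (rule towers[OF \<eta>(1,2)])
          fix l
          have "\<exists>F. finite F \<and> F \<subseteq> ?B \<and> card F \<le> C l \<and> (\<forall>z\<in>?B. \<exists>x\<in>F. mdist Y x z < \<eta> / 2 ^ l / 2)"
          \<comment> \<open>The excess is smaller than \<open>\<rho>\<close> only if
            \<open>D\<close> is below \<open>4 * \<rho>\<close>. The whole ball is then within the
            scale of \<open>local_cover\<close>, whose bound depends only on the ratio of the radii
            and hence not on \<open>D\<close>.\<close>
          proof (cases "\<rho> \<le> D / 4")
            case True
            then have "\<eta> = \<rho>" by (simp add: \<eta>_def)
            moreover obtain F where "finite F" "F \<subseteq> ?B" "card F \<le> C1 l" "\<forall>z\<in>?B. \<exists>x\<in>F. mdist Y x z < \<rho> / 2 ^ l / 2"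
              using C1[OF mcp.mcp_space_axioms y0 order_refl, of l] by blast
            ultimately show ?thesis by (intro exI[of _ F]) (auto simp: C_def)
          next
            case False
            then have \<eta>D: "\<eta> = D / 4" by (simp add: \<eta>_def)
            define r where "r = \<eta> / 2 ^ l / 2"
            have r: "r = D / (8 * 2 ^ l)" by (simp add: r_def \<eta>D)
            have one: "(1::real) \<le> 2 ^ l" by simp
            have r0: "0 < r" using D by (simp add: r)
            have "1 \<le> 8 * (2::real) ^ l" using one by linarith
            then have "r \<le> D / 1" unfolding r using D by (intro divide_left_mono) auto
            then have r1: "r \<le> 2 * D" using D by simp
            have "D \<le> 4 * \<rho>" using False by simp
            then have r2: "4 * (2 * D) \<le> mcp_radius K N" using \<rho>(4) R unfolding R_def[symmetric] by linarith
            have "r / (6 * (2 * D)) = 1 / (96 * 2 ^ l)" using D by (simp add: r)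
            then have "c2 l \<le> contraction_coeff N (r / (6 * (2 * D)))" by (simp add: c2_def)
            then obtain F where F: "finite F" "F \<subseteq> ?B" "real (card F) \<le> 1 / c2 l" "\<And>z. z \<in> ?B \<Longrightarrow> \<exists>x\<in>F. mdist Y x z < r"
              using mcp.local_cover[OF y0 r0 r1 r2 D(2) c2[of l]] by metis
            have "card F \<le> nat \<lfloor>1 / c2 l\<rfloor>" using F(3) by linarith
            then show ?thesis using F unfolding r_def by (intro exI[of _ F]) (auto simp: C_def)
          qed
          then show "\<exists>xs. set xs \<subseteq> ?B \<and> length xs \<le> C l \<and> (\<forall>z\<in>?B. \<exists>x\<in>set xs. mdist Y x z < \<eta> / 2 ^ l / 2)"
            by (rule finite_set_list)
        next
          fix s y assume y: "y \<in> ?B" and s: "a - \<epsilon> < s" "s \<le> a" "H a - H s \<le> \<eta> / 2 ^ 1"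
          obtain w0 where w0: "w0 \<in> ?B" "H a - H s < mdist Y y w0" using far[OF y s(3)] by blast
          have "H a - H s < R" using s(3) \<eta>(1,2) \<rho>(4) by simp
          then show "\<exists>q\<in>{a<..<b} \<times> ?B. caus X (s, y) q \<and> tsep X (s, y) q \<le> ennreal (1 / real ?L)"
            using s ab pos by (intro W.null_partner_above[OF len y0 y w0(1) _ _ _ _ w0(2)]) auto
        next
          fix s y assume y: "y \<in> ?B" and s: "b \<le> s" "s < b + \<epsilon>" "H s - H b \<le> \<eta> / 2 ^ 1"
          obtain w0 where w0: "w0 \<in> ?B" "H s - H b < mdist Y y w0" using far[OF y s(3)] by blast
          have "H s - H b < R" using s(3) \<eta>(1,2) \<rho>(4) by simp
          then show "\<exists>p\<in>{a<..<b} \<times> ?B. caus X p (s, y) \<and> tsep X p (s, y) \<le> ennreal (1 / real ?L)"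
            using s ab pos by (intro W.null_partner_below[OF len y0 y w0(1) _ _ _ _ w0(2)]) auto
        qed
      qed
    qed
  qed
qed

theorem theorem5p1:
  fixes N K :: real and M T \<epsilon> :: "nat \<Rightarrow> real"
  assumes "N > 1"
    and "\<forall>i. M i > 0" and "\<forall>i. T i > 0" and "\<forall>i. \<epsilon> i > 0"
    and "\<epsilon> \<longlonglongrightarrow> 0"
  shows "lgh_precompact {(X, U). covered_lpls (X, U) \<and>
    (\<exists>J f (Y :: 'y metric) m a b. \<exists>y\<^sub>0\<in>mspace Y.
       is_generalized_cone X J f Y \<and>
       metric_measure_space Y m \<and> essentially_non_branching Y m \<and> MCP K N Y m \<and>
       (\<forall>i. U i = {a i<..<b i} \<times> mball_of Y y\<^sub>0 (real i)) \<and>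
       (\<forall>i. {a i<..<b i} \<subseteq> J \<and> \<bar>a i - b i\<bar> < T i) \<and>
       (\<forall>i j. i \<le> j \<longrightarrow> {a i<..<b i} \<subseteq> {a j<..<b j}) \<and>
       (\<forall>i. {a i - \<epsilon> i<..<b i + \<epsilon> i} \<subseteq> J) \<and>
       (\<forall>i. \<forall>t\<in>{a i - \<epsilon> i<..<b i + \<epsilon> i}. f t \<le> M i))}"
  unfolding lgh_precompact_def
proof (intro allI impI)
  fix XU :: "nat \<Rightarrow> (real \<times> 'y) covered"
  define X where "X n = fst (XU n)" for n
  define U where "U n = snd (XU n)" for n
  have XU: "XU = (\<lambda>n. (X n, U n))" by (simp add: X_def U_def)
  assume "\<forall>n. XU n \<in> {(X, U). covered_lpls (X, U) \<and>
    (\<exists>J f (Y :: 'y metric) m a b. \<exists>y\<^sub>0\<in>mspace Y.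
       is_generalized_cone X J f Y \<and>
       metric_measure_space Y m \<and> essentially_non_branching Y m \<and> MCP K N Y m \<and>
       (\<forall>i. U i = {a i<..<b i} \<times> mball_of Y y\<^sub>0 (real i)) \<and>
       (\<forall>i. {a i<..<b i} \<subseteq> J \<and> \<bar>a i - b i\<bar> < T i) \<and>
       (\<forall>i j. i \<le> j \<longrightarrow> {a i<..<b i} \<subseteq> {a j<..<b j}) \<and>
       (\<forall>i. {a i - \<epsilon> i<..<b i + \<epsilon> i} \<subseteq> J) \<and>
       (\<forall>i. \<forall>t\<in>{a i - \<epsilon> i<..<b i + \<epsilon> i}. f t \<le> M i))}"
  then have cov: "\<And>n. covered_lpls (X n, U n)"
    and data: "\<And>n. \<exists>J f (Y :: 'y metric) m a b. \<exists>y\<^sub>0\<in>mspace Y.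
       is_generalized_cone (X n) J f Y \<and>
       metric_measure_space Y m \<and> essentially_non_branching Y m \<and> MCP K N Y m \<and>
       (\<forall>i. U n i = {a i<..<b i} \<times> mball_of Y y\<^sub>0 (real i)) \<and>
       (\<forall>i. {a i<..<b i} \<subseteq> J \<and> \<bar>a i - b i\<bar> < T i) \<and>
       (\<forall>i j. i \<le> j \<longrightarrow> {a i<..<b i} \<subseteq> {a j<..<b j}) \<and>
       (\<forall>i. {a i - \<epsilon> i<..<b i + \<epsilon> i} \<subseteq> J) \<and>
       (\<forall>i. \<forall>t\<in>{a i - \<epsilon> i<..<b i + \<epsilon> i}. f t \<le> M i)"
    unfolding XU by auto
  have lpls: "lorentzian_pre_length_space (X n)" and U_mono: "U n k \<subseteq> U n (Suc k)" for n k
    using cov[of n] by (auto simp: covered_lpls_def)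
  \<comment> \<open>The bound for each index of the covers is characterised without reference to the
    sequence, so one choice serves all its members.\<close>
  define good where "good i Nb \<longleftrightarrow> (\<forall>X J f (Y :: 'y metric) m a b y\<^sub>0 L.
    is_generalized_cone X J f Y \<longrightarrow> lorentzian_pre_length_space X \<longrightarrow> metric_measure_space Y m \<longrightarrow> MCP K N Y m \<longrightarrow>
    y\<^sub>0 \<in> mspace Y \<longrightarrow> {a - \<epsilon> i<..<b + \<epsilon> i} \<subseteq> J \<longrightarrow> \<bar>a - b\<bar> < T i \<longrightarrow> (\<forall>t\<in>{a - \<epsilon> i<..<b + \<epsilon> i}. f t \<le> M i) \<longrightarrow>
    (\<exists>S. net_tower X ({a<..<b} \<times> mball_of Y y\<^sub>0 (real i)) Nb L S \<and>
      (\<forall>l v. 1 \<le> l \<longrightarrow> v \<in> net_vertices (S l) \<longrightarrow> a < b \<and> a - \<epsilon> i < fst v \<and> fst v < b + \<epsilon> i \<and>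
         (\<forall>w. tsep X v w \<le> ennreal (fst w - fst v)))))" for i Nb
  have "\<exists>Nb. good i Nb" for i
  proof -
    have pos: "0 < \<epsilon> i" "0 < M i" using assms by auto
    show ?thesis unfolding good_def
      by (rule cone_net_towers[OF assms(1) pos, where K=K and T="T i" and k="real i" ]) blast
  qed
  then obtain Nb where Nb: "\<And>i. good i (Nb i)" by metis
  have "\<exists>S a b. (\<forall>k. net_tower (X n) (U n k) (Nb k) n (S k)) \<and>
      (\<forall>k l v. 1 \<le> l \<longrightarrow> v \<in> net_vertices (S k l) \<longrightarrow> a k < b k \<and> a k - \<epsilon> k < fst v \<and> fst v < b k + \<epsilon> k \<and>
         (\<forall>w. tsep (X n) v w \<le> ennreal (fst w - fst v))) \<and>
      (\<forall>i. \<bar>a i - b i\<bar> < T i) \<and> (\<forall>i j. i \<le> j \<longrightarrow> {a i<..<b i} \<subseteq> {a j<..<b j})" for n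
  proof -
    obtain J f and Y :: "'y metric" and m a b y\<^sub>0 where D: "y\<^sub>0 \<in> mspace Y" "is_generalized_cone (X n) J f Y"
      "metric_measure_space Y m" "MCP K N Y m" "\<And>i. U n i = {a i<..<b i} \<times> mball_of Y y\<^sub>0 (real i)"
      "\<And>i. \<bar>a i - b i\<bar> < T i" "\<And>i j. i \<le> j \<Longrightarrow> {a i<..<b i} \<subseteq> {a j<..<b j}"
      "\<And>i. {a i - \<epsilon> i<..<b i + \<epsilon> i} \<subseteq> J" "\<And>i. \<forall>t\<in>{a i - \<epsilon> i<..<b i + \<epsilon> i}. f t \<le> M i"
      using data[of n] by (elim exE bexE conjE) blast
    have "\<exists>S. net_tower (X n) (U n k) (Nb k) n S \<and>
      (\<forall>l v. 1 \<le> l \<longrightarrow> v \<in> net_vertices (S l) \<longrightarrow> a k < b k \<and> a k - \<epsilon> k < fst v \<and> fst v < b k + \<epsilon> k \<and>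
         (\<forall>w. tsep (X n) v w \<le> ennreal (fst w - fst v)))" for k
      unfolding D(5)
      by (rule Nb[of k, unfolded good_def, rule_format, OF D(2) lpls D(3,4,1) D(8,6)]) (use D(9) in blast)
    then obtain S where "\<And>k. net_tower (X n) (U n k) (Nb k) n (S k) \<and>
      (\<forall>l v. 1 \<le> l \<longrightarrow> v \<in> net_vertices (S k l) \<longrightarrow> a k < b k \<and> a k - \<epsilon> k < fst v \<and> fst v < b k + \<epsilon> k \<and>
         (\<forall>w. tsep (X n) v w \<le> ennreal (fst w - fst v)))" by metis
    then show ?thesis using D(6,7) by (intro exI[of _ S] exI[of _ a] exI[of _ b]) auto
  qed
  then obtain S a b where tower: "\<And>n k. net_tower (X n) (U n k) (Nb k) n (S n k)"
    and vtx: "\<And>n k l v. 1 \<le> l \<Longrightarrow> v \<in> net_vertices (S n k l) \<Longrightarrow> a n k < b n k \<and> a n k - \<epsilon> k < fst v \<and>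
       fst v < b n k + \<epsilon> k \<and> (\<forall>w. tsep (X n) v w \<le> ennreal (fst w - fst v))"
    and len: "\<And>n i. \<bar>a n i - b n i\<bar> < T i"
    and mono: "\<And>n i j. i \<le> j \<Longrightarrow> {a n i<..<b n i} \<subseteq> {a n j<..<b n j}"
    by metis
  obtain r and Z :: "real covered" where "strict_mono (r :: nat \<Rightarrow> nat)" "covered_lpls Z"
    "lgh_converges (\<lambda>n. (X (r n), U (r n))) Z"
  \<comment> \<open>As the windows are nested, the times of two vertices differ by at most the
    length of the longer window plus both margins.\<close>
  proof (rule lgh_subsequence_of_net_towers[where X=X and U=U and S=S and Nb=Nb and Cb="\<lambda>k k'. max (T k) (T k') + \<epsilon> k + \<epsilon> k'",
      OF lpls U_mono tower])
    fix n k l k' l' v w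
    assume l: "1 \<le> l" "1 \<le> l'" and vw: "v \<in> net_vertices (S n k l)" "w \<in> net_vertices (S n k' l')"
    note v = vtx[OF l(1) vw(1)] and w = vtx[OF l(2) vw(2)]
    have "fst w - fst v \<le> max (T k) (T k') + \<epsilon> k + \<epsilon> k'"
    proof (cases "k \<le> k'")
      case True
      \<comment> \<open>Inclusion of open intervals orders their end points only if the smaller one
        is nonempty; the existence of the vertex \<open>v\<close> ensures this.\<close>
      then have "a n k' \<le> a n k" using mono[OF True, of n] v by (simp add: greaterThanLessThan_subseteq_greaterThanLessThan)
      then show ?thesis using v w len[of n k'] by linarith
    next
      case False
      then have "b n k' \<le> b n k" using mono[of k' k n] w by (simp add: greaterThanLessThan_subseteq_greaterThanLessThan)
      then show ?thesis using v w len[of n k] by linarith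
    qed
    then have "ennreal (fst w - fst v) \<le> ennreal (max (T k) (T k') + \<epsilon> k + \<epsilon> k')" by (rule ennreal_leI)
    then show "tsep (X n) v w \<le> ennreal (max (T k) (T k') + \<epsilon> k + \<epsilon> k')" using v order_trans by blast
  qed
  then show "\<exists>r (Z :: real covered). strict_mono r \<and> covered_lpls Z \<and> lgh_converges (XU \<circ> r) Z"
    unfolding XU o_def by blast
qed

end
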